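(* Let $1\le p<2$ and let $(X_n)_{n\ge1}$ be a determining sequence of random variables on a probability space $(\Omega,\mathcal F,P)$ such that $\|X_n\|_p=1$ for all $n$, the family $\{|X_n|^p:n\ge1\}$ is uniformly integrable, and $X_n\to0$ weakly in $L^p$ (i.e. $\mathbb E(X_nZ)\to0$ for every $Z\in L^q$, $1/p+1/q=1$). Let $\mu$ be the limit random measure of $(X_n)$. Then there exists a subsequence $(X_{n_k})$ equivalent (in $L^p$) to the unit vector basis of $\ell^2$ if and only if $$\int_{-\infty}^{\infty}x^2\,d\mu(x)\in L^{p/2}(\Omega,\mathcal F,P),$$ i.e. $\mathbb E\big(\int x^2\,d\mu(x)\big)^{p/2}<\infty$.
   Context: A sequence $(X_n)$ of random variables is called determining if for every $A\in\mathcal F$ with $P(A)>0$ there is a distribution function $F_A$ with $P(X_n\le t\mid A)\to F_A(t)$ at every continuity point $t$ of $F_A$. For a determining sequence there exists a random measure $\mu$ (a measurable map from $(\Omega,\mathcal F)$ into the space of Borel probability measures on $\mathbb R$ equipped with the Prohorov metric) such that for every $A$ with $P(A)>0$ and every continuity point $t$ of $F_A$, $F_A(t)=\mathbb E_A\big(\mu(-\infty,t]\big)$, where $\mathbb E_A$ denotes conditional expectation given $A$, i.e. $\mathbb E_A(Z)=P(A)^{-1}\int_A Z\,dP$; $\mu$ is called the limit random measure of $(X_n)$. Two sequences $(x_n),(y_n)$ in a Banach space are equivalent if there is $K>0$ with $K^{-1}\|\sum_{i=1}^n a_ix_i\|\le\|\sum_{i=1}^n a_iy_i\|\le K\|\sum_{i=1}^n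 a_ix_i\|$ for all $n\ge1$ and all $(a_1,\dots,a_n)\in\mathbb R^n$. Equivalence of $(X_{n_k})$ to the unit vector basis of $\ell^2$ means there is $K>0$ with $K^{-1}(\sum a_i^2)^{1/2}\le\|\sum_{i=1}^n a_iX_{n_i}\|_p\le K(\sum a_i^2)^{1/2}$ for all $n$ and $a\in\mathbb R^n$. *)

theory Defs
  imports "HOL-Probability.Probability"
begin

definition distribution_function :: "(real \<Rightarrow> real) \<Rightarrow> bool" where
  "distribution_function F \<longleftrightarrow> mono F \<and> (\<forall>t. continuous (at_right t) F) \<and>
     (F \<longlongrightarrow> 0) at_bot \<and> (F \<longlongrightarrow> 1) at_top"

definition cond_cdf :: "'a measure \<Rightarrow> ('a \<Rightarrow> real) \<Rightarrow> 'a set \<Rightarrow> real \<Rightarrow> real" where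
  "cond_cdf M Y A t = measure M ({\<omega>\<in>space M. Y \<omega> \<le> t} \<inter> A) / measure M A"

definition cond_limit_df :: "'a measure \<Rightarrow> (nat \<Rightarrow> 'a \<Rightarrow> real) \<Rightarrow> 'a set \<Rightarrow> (real \<Rightarrow> real) \<Rightarrow> bool" where
  "cond_limit_df M X A F \<longleftrightarrow> distribution_function F \<and>
     (\<forall>t. isCont F t \<longrightarrow> (\<lambda>n. cond_cdf M (X n) A t) \<longlonglongrightarrow> F t)"

definition determining :: "'a measure \<Rightarrow> (nat \<Rightarrow> 'a \<Rightarrow> real) \<Rightarrow> bool" where
  "determining M X \<longleftrightarrow> (\<forall>A\<in>sets M. measure M A > 0 \<longrightarrow> (\<exists>F. cond_limit_df M X A F))"

text \<open>Random measure: measurable map into the Borel probability measures on the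
  reals (Giry/evaluation sigma-algebra, which coincides with the Borel sigma-algebra
  of the Prohorov metric). Limit random measure of a determining sequence.\<close>
definition limit_random_measure ::
    "'a measure \<Rightarrow> (nat \<Rightarrow> 'a \<Rightarrow> real) \<Rightarrow> ('a \<Rightarrow> real measure) \<Rightarrow> bool" where
  "limit_random_measure M X \<mu> \<longleftrightarrow> determining M X \<and>
     \<mu> \<in> M \<rightarrow>\<^sub>M prob_algebra (borel :: real measure) \<and>
     (\<forall>A\<in>sets M. measure M A > 0 \<longrightarrow>
        (\<forall>F. cond_limit_df M X A F \<longrightarrow>
           (\<forall>t. isCont F t \<longrightarrow>
              F t = (\<integral>\<omega>. indicator A \<omega> * measure (\<mu> \<omega>) {..t} \<partial>M) / measure M A)))"

definition Lp_norm :: "'a measure \<Rightarrow> real \<Rightarrow> ('a \<Rightarrow> real) \<Rightarrow> real" where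
  "Lp_norm M p f = (\<integral>\<omega>. \<bar>f \<omega>\<bar> powr p \<partial>M) powr (1 / p)"

definition in_Lp :: "'a measure \<Rightarrow> real \<Rightarrow> ('a \<Rightarrow> real) \<Rightarrow> bool" where
  "in_Lp M q f \<longleftrightarrow> f \<in> borel_measurable M \<and> integrable M (\<lambda>\<omega>. \<bar>f \<omega>\<bar> powr q)"

definition in_Linf :: "'a measure \<Rightarrow> ('a \<Rightarrow> real) \<Rightarrow> bool" where
  "in_Linf M f \<longleftrightarrow> f \<in> borel_measurable M \<and> (\<exists>C. AE \<omega> in M. \<bar>f \<omega>\<bar> \<le> C)"

definition in_dual_Lp :: "'a measure \<Rightarrow> real \<Rightarrow> ('a \<Rightarrow> real) \<Rightarrow> bool" where
  "in_dual_Lp M p Z \<longleftrightarrow> (if p = 1 then in_Linf M Z else in_Lp M (p / (p - 1)) Z)"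

definition weakly_to_zero_Lp :: "'a measure \<Rightarrow> real \<Rightarrow> (nat \<Rightarrow> 'a \<Rightarrow> real) \<Rightarrow> bool" where
  "weakly_to_zero_Lp M p X \<longleftrightarrow>
     (\<forall>Z. in_dual_Lp M p Z \<longrightarrow> (\<lambda>n. \<integral>\<omega>. X n \<omega> * Z \<omega> \<partial>M) \<longlonglongrightarrow> 0)"

definition uniformly_integrable :: "'a measure \<Rightarrow> (nat \<Rightarrow> 'a \<Rightarrow> real) \<Rightarrow> bool" where
  "uniformly_integrable M f \<longleftrightarrow> (\<forall>n. integrable M (f n)) \<and>
     (\<forall>e>0. \<exists>K. \<forall>n. (\<integral>\<omega>. indicator {\<omega>. \<bar>f n \<omega>\<bar> \<ge> K} \<omega> * \<bar>f n \<omega>\<bar> \<partial>M) < e)"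

definition equiv_l2_basis :: "'a measure \<Rightarrow> real \<Rightarrow> (nat \<Rightarrow> 'a \<Rightarrow> real) \<Rightarrow> bool" where
  "equiv_l2_basis M p Y \<longleftrightarrow> (\<exists>K>0. \<forall>n (a :: nat \<Rightarrow> real).
     sqrt (\<Sum>i<n. (a i)\<^sup>2) / K \<le> Lp_norm M p (\<lambda>\<omega>. \<Sum>i<n. a i * Y i \<omega>) \<and>
     Lp_norm M p (\<lambda>\<omega>. \<Sum>i<n. a i * Y i \<omega>) \<le> K * sqrt (\<Sum>i<n. (a i)\<^sup>2))"

end

(* If X converges stably to mu, then f(X_n) minus the mu-integral of f is weakly null for bounded continuous f, so
   along a subsequence such functions of X are almost orthogonal.

   Suppose a subsequence satisfies the upper l2 estimate. Averaging over signs (Khinchin) bounds the p/2-th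
   moment of the averages of the X_i^2. The averages of the truncations min(X_i^2, L) converge in L2 to the
   truncated variance of mu, so these truncated variances have bounded p/2-th moments, uniformly in L.

   Conversely, let sigma^2 be the variance of mu and w = (1 + sigma)^(p - 2). Truncating X_n at a suitable level
   changes it by a summably small amount, and the truncated V_n have bounded w-weighted second moments. Almost
   orthogonality in L2(w) together with |x|^p <= w x^2 + (1 + sigma)^p gives the upper estimate. For the lower one,
   test sum a_i V_i against the truncation of sum a_i psi_i, where psi_i is X_i clamped to [-1, 1] and centred
   by mu: the pairing is about c * sum a_i^2, and truncating costs little as the fourth moments of sum a_i psi_i
   are bounded. *)

theory Submission
  imports Defs
begin

section \<open>Stable convergence\<close>

text \<open>For p < 2 the X_n need not have second moments, and sigma^2 lies only in L^(p/2), so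
  orthogonality in L2(P) is out of reach. Since w sigma^2 <= (1 + sigma)^p, the limit variance
  becomes integrable against w, while w > 0 keeps the nondegeneracy of mu. The lower estimate is
  sought in L1: w <= 1 makes the weighted L1 norm at most the unweighted one, and L^p dominates L1
  for every p >= 1, with p = 1 included. The test functions are the psi_i and not the V_i because
  the heights of the V_i may grow with i, which leaves fourth moments uncontrolled, whereas |psi_i|
  <= 2. Fourth moments are wanted since cutting sum a_i psi_i at height m costs its square over m.
  The hypotheses share the work: norm one and uniform integrability exclude that mu is almost surely
  the point mass at 0; weak nullity makes the V_i weakly null without centring and removes the mean
  term from the pairing of V_i with psi_i. In the other direction the number of averaged terms
  depends on the truncation level L, but the resulting bound does not.\<close>

lemma right_continuous_eq_off_countable:
  fixes F G :: "real \<Rightarrow> real"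
  assumes F: "continuous (at_right t) F" and G: "continuous (at_right t) G"
    and C: "countable C" and eq: "\<And>s. s \<notin> C \<Longrightarrow> F s = G s"
  shows "F t = G t"
proof (rule ccontr)
  assume ne: "F t \<noteq> G t"
  have "((\<lambda>s. F s - G s) \<longlongrightarrow> F t - G t) (at_right t)"
    using F G by (intro tendsto_diff) (auto simp: continuous_within)
  then have "eventually (\<lambda>s. F s - G s \<noteq> 0) (at_right t)"
    using ne by (intro tendsto_imp_eventually_ne) auto
  then obtain b where b: "t < b" "\<And>s. t < s \<Longrightarrow> s < b \<Longrightarrow> F s \<noteq> G s"
    unfolding eventually_at_right_field by auto
  then have "{t<..<b} \<subseteq> C" using eq by (meson greaterThanLessThan_iff subsetI)
  then show False
    using C b(1) countable_subset[of "{t<..<b}" C] uncountable_open_interval[of t b] by auto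
qed

text \<open>The hypothesis on the limit random measure speaks of F only at continuity points of F.
  Monotonicity leaves countably many other points, so this suffices to identify F with the cdf of a
  mixture of the kernel.\<close>

lemma distribution_function_unique:
  assumes F: "distribution_function F" and G: "distribution_function G"
    and eq: "\<And>t. isCont F t \<Longrightarrow> F t = G t"
  shows "F = G"
proof
  fix t
  have "countable {s. \<not> isCont F s}"
    using F by (intro mono_ctble_discont) (simp add: distribution_function_def)
  then show "F t = G t"
    by (rule right_continuous_eq_off_countable[rotated 2])
      (use F G eq in \<open>simp_all add: distribution_function_def\<close>)
qed

lemma distribution_function_cdf:
  assumes "real_distribution N"
  shows "distribution_function (cdf N)"
proof -
  interpret real_distribution N by fact
  interpret finite_borel_measure N by (rule finite_borel_measure_M)
  show ?thesis
    unfolding distribution_function_def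
    using cdf_nondecreasing cdf_is_right_cont cdf_lim_at_bot cdf_lim_at_top_prob
    by (auto simp: mono_def)
qed

lemma integrable_mult_bounded:
  fixes g k :: "'a \<Rightarrow> real"
  assumes g: "integrable M g" and k: "k \<in> borel_measurable M" "\<And>\<omega>. \<omega> \<in> space M \<Longrightarrow> \<bar>k \<omega>\<bar> \<le> C"
  shows "integrable M (\<lambda>\<omega>. g \<omega> * k \<omega>)"
proof (rule Bochner_Integration.integrable_bound)
  show "integrable M (\<lambda>\<omega>. C * g \<omega>)" using g by simp
  show "AE \<omega> in M. norm (g \<omega> * k \<omega>) \<le> norm (C * g \<omega>)"
  proof (rule AE_I2)
    fix \<omega> assume "\<omega> \<in> space M"
    then have "\<bar>k \<omega>\<bar> * \<bar>g \<omega>\<bar> \<le> \<bar>C\<bar> * \<bar>g \<omega>\<bar>" using k(2) by (intro mult_right_mono) force+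
    then show "norm (g \<omega> * k \<omega>) \<le> norm (C * g \<omega>)" by (simp add: abs_mult mult.commute)
  qed
qed (use g k in auto)

locale random_limit = prob_space M for M :: "'a measure" +
  fixes X :: "nat \<Rightarrow> 'a \<Rightarrow> real" and \<mu> :: "'a \<Rightarrow> real measure"
  assumes rv [measurable]: "\<And>n. X n \<in> borel_measurable M"
    and limit: "limit_random_measure M X \<mu>"
begin

lemma kernel_prob [measurable]: "\<mu> \<in> M \<rightarrow>\<^sub>M prob_algebra borel"
  using limit by (simp add: limit_random_measure_def)

lemma kernel [measurable]: "\<mu> \<in> M \<rightarrow>\<^sub>M subprob_algebra borel"
  by (rule measurable_prob_algebraD) (rule kernel_prob)

lemma kernel_at:
  assumes "\<omega> \<in> space M"
  shows "prob_space (\<mu> \<omega>)" "sets (\<mu> \<omega>) = sets borel"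
  using measurable_space[OF kernel_prob assms] by (auto simp: space_prob_algebra)

lemma kernel_real_distribution: "\<omega> \<in> space M \<Longrightarrow> real_distribution (\<mu> \<omega>)"
  by (simp add: kernel_at real_distribution_axioms_def real_distribution_def)

lemma kernel_integrable:
  fixes f :: "real \<Rightarrow> real"
  assumes "\<omega> \<in> space M" "\<And>x. \<bar>f x\<bar> \<le> B" "f \<in> borel_measurable borel"
  shows "integrable (\<mu> \<omega>) f"
proof -
  interpret K: real_distribution "\<mu> \<omega>" by (rule kernel_real_distribution) fact
  show ?thesis using assms by (intro K.integrable_const_bound[where B=B]) auto
qed

lemma kernel_integral_bound:
  fixes f :: "real \<Rightarrow> real"
  assumes "\<omega> \<in> space M" "\<And>x. \<bar>f x\<bar> \<le> B" "f \<in> borel_measurable borel"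
  shows "\<bar>\<integral>x. f x \<partial>\<mu> \<omega>\<bar> \<le> B"
proof -
  interpret K: real_distribution "\<mu> \<omega>" by (rule kernel_real_distribution) fact
  have "\<bar>\<integral>x. f x \<partial>\<mu> \<omega>\<bar> \<le> (\<integral>x. \<bar>f x\<bar> \<partial>\<mu> \<omega>)"
    by (rule integral_abs_bound)
  also have "\<dots> \<le> (\<integral>x. B \<partial>\<mu> \<omega>)"
    using assms by (intro integral_mono kernel_integrable[where B=B]) (auto intro: order_trans[OF abs_ge_zero])
  finally show ?thesis using K.prob_space by simp
qed

text \<open>Given A, the limit law of X n is the mixture of the kernel under P( . | A): the formula
  defining the limit random measure says exactly that F is the cdf of this mixture. Convergence of
  cdfs is then upgraded to bounded continuous test functions.\<close>

lemma conditional_law_converges: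
  fixes f :: "real \<Rightarrow> real"
  assumes A [measurable]: "A \<in> sets M" and pos: "measure M A > 0"
    and f: "\<And>x. isCont f x" "\<And>x. \<bar>f x\<bar> \<le> B"
  shows "(\<lambda>n. \<integral>\<omega>. indicator A \<omega> * f (X n \<omega>) \<partial>M) \<longlonglongrightarrow> (\<integral>\<omega>. indicator A \<omega> * (\<integral>x. f x \<partial>\<mu> \<omega>) \<partial>M)"
proof -
  define N where "N = uniform_measure M A"
  have emA: "emeasure M A \<noteq> 0" "emeasure M A \<noteq> \<infinity>"
    using pos by (auto simp: emeasure_eq_measure)
  have sN [measurable_cong]: "sets N = sets M" by (simp add: N_def)
  interpret N: prob_space N unfolding N_def by (rule prob_space_uniform_measure[OF emA])
  have fm [measurable]: "f \<in> borel_measurable borel"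
    using f(1) by (intro borel_measurable_continuous_onI continuous_at_imp_continuous_on) auto
  have intN: "(\<integral>\<omega>. h \<omega> \<partial>N) = (\<integral>\<omega>. indicator A \<omega> * h \<omega> \<partial>M) / measure M A"
    if [measurable]: "h \<in> borel_measurable M" for h :: "'a \<Rightarrow> real"
  proof -
    have dens: "indicator A \<omega> / emeasure M A = ennreal (indicator A \<omega> / measure M A)" for \<omega>
      using pos by (auto simp: emeasure_eq_measure divide_ennreal[of 1, simplified] indicator_def)
    have "(\<integral>\<omega>. h \<omega> \<partial>N) = (\<integral>\<omega>. (indicator A \<omega> / measure M A) *\<^sub>R h \<omega> \<partial>M)"
      unfolding N_def uniform_measure_def dens by (rule integral_density) auto
    then show ?thesis by simp
  qed
  define law where "law n = distr N borel (X n)" for n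
  \<comment> \<open>The monadic bind is the mixture: draw omega from P( . | A), then a real number
    from \<open>\<mu> \<omega>\<close>.\<close>
  define \<nu> where "\<nu> = N \<bind> \<mu>"
  have kN [measurable]: "\<mu> \<in> N \<rightarrow>\<^sub>M subprob_algebra borel" by measurable
  have kN' [measurable]: "\<mu> \<in> N \<rightarrow>\<^sub>M prob_algebra borel" by measurable
  have law: "real_distribution (law n)" for n
    unfolding law_def by (rule N.real_distribution_distr) measurable
  have "prob_space \<nu>" unfolding \<nu>_def
    by (rule prob_space_bind'[OF _ kN']) (simp add: space_prob_algebra N.prob_space_axioms)
  moreover have "sets \<nu> = sets borel" unfolding \<nu>_def
    by (rule sets_bind) (use not_empty in \<open>auto simp: N_def kernel_at\<close>)
  ultimately have \<nu>: "real_distribution \<nu>"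
    by (simp add: real_distribution_def real_distribution_axioms_def)
  have cdf_law: "cdf (law n) t = cond_cdf M (X n) A t" for n t
  proof -
    have "cdf (law n) t = measure N {\<omega> \<in> space M. X n \<omega> \<le> t}"
      unfolding law_def cdf_def
      by (subst measure_distr) (auto simp: N_def intro!: arg_cong[where f = "measure _"])
    also have "\<dots> = cond_cdf M (X n) A t"
      unfolding N_def cond_cdf_def
      using measure_uniform_measure[OF emA, of "{\<omega> \<in> space M. X n \<omega> \<le> t}"] by (simp add: Int_commute)
    finally show ?thesis .
  qed
  have cdf_\<nu>: "cdf \<nu> t = (\<integral>\<omega>. indicator A \<omega> * measure (\<mu> \<omega>) {..t} \<partial>M) / measure M A" for t
    unfolding \<nu>_def cdf_def by (subst N.measure_bind[OF kN]) (auto intro!: intN)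
  obtain F where F: "cond_limit_df M X A F"
    using limit A pos by (auto simp: limit_random_measure_def determining_def)
  have "F t = cdf \<nu> t" if "isCont F t" for t
    using limit A pos F that by (simp add: limit_random_measure_def cdf_\<nu>)
  then have "F = cdf \<nu>"
    using F distribution_function_cdf[OF \<nu>]
    by (intro distribution_function_unique) (auto simp: cond_limit_df_def)
  then have "weak_conv_m law \<nu>"
    using F by (auto simp: weak_conv_m_def weak_conv_def cond_limit_df_def cdf_law)
  then have "(\<lambda>n. integral\<^sup>L (law n) f) \<longlonglongrightarrow> integral\<^sup>L \<nu> f"
    using law \<nu> f by (intro weak_conv_imp_integral_bdd_continuous_conv[where B=B]) auto
  moreover have "integral\<^sup>L (law n) f = (\<integral>\<omega>. indicator A \<omega> * f (X n \<omega>) \<partial>M) / measure M A" for n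
    unfolding law_def by (subst integral_distr) (auto intro!: intN)
  moreover have "integral\<^sup>L \<nu> f = (\<integral>\<omega>. indicator A \<omega> * (\<integral>x. f x \<partial>\<mu> \<omega>) \<partial>M) / measure M A"
  proof -
    have "integral\<^sup>L \<nu> f = (\<integral>\<omega>. (\<integral>x. f x \<partial>\<mu> \<omega>) \<partial>N)"
      unfolding \<nu>_def
    proof (rule integral_bind[where K=borel and B=B and B'=1])
      show "AE \<omega> in N. emeasure (\<mu> \<omega>) (space (\<mu> \<omega>)) \<le> ennreal 1"
        using subprob_space.emeasure_space_le_1[OF subprob_space_kernel[OF kN]]
        by (intro AE_I2) simp
    qed (use f in \<open>auto intro: N.finite_measure\<close>)
    also have "\<dots> = (\<integral>\<omega>. indicator A \<omega> * (\<integral>x. f x \<partial>\<mu> \<omega>) \<partial>M) / measure M A"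
      by (rule intN) measurable
    finally show ?thesis .
  qed
  ultimately have "(\<lambda>n. (\<integral>\<omega>. indicator A \<omega> * f (X n \<omega>) \<partial>M) / measure M A)
      \<longlonglongrightarrow> (\<integral>\<omega>. indicator A \<omega> * (\<integral>x. f x \<partial>\<mu> \<omega>) \<partial>M) / measure M A" by simp
  from tendsto_mult_right[OF this, of "measure M A"] show ?thesis using pos by simp
qed

text \<open>Indicators are covered by the conditional laws. The passage to integrable Z works
  because the centred functions \<open>h n\<close> are bounded by 2 B uniformly in n, so an L1
  approximation of Z costs the same error for all n.\<close>

lemma stable_convergence:
  fixes f :: "real \<Rightarrow> real"
  assumes f: "\<And>x. isCont f x" "\<And>x. \<bar>f x\<bar> \<le> B" and Z: "integrable M Z"
  shows "(\<lambda>n. \<integral>\<omega>. Z \<omega> * f (X n \<omega>) \<partial>M) \<longlonglongrightarrow> (\<integral>\<omega>. Z \<omega> * (\<integral>x. f x \<partial>\<mu> \<omega>) \<partial>M)"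
proof -
  have fm [measurable]: "f \<in> borel_measurable borel"
    using f(1) by (intro borel_measurable_continuous_onI continuous_at_imp_continuous_on) auto
  define h where "h n \<omega> = f (X n \<omega>) - (\<integral>x. f x \<partial>\<mu> \<omega>)" for n \<omega>
  have hm [measurable]: "h n \<in> borel_measurable M" for n unfolding h_def by measurable
  have hb: "\<bar>h n \<omega>\<bar> \<le> 2 * B" if "\<omega> \<in> space M" for n \<omega>
    using kernel_integral_bound[OF that f(2) fm] f(2)[of "X n \<omega>"] unfolding h_def by linarith
  have B0: "0 \<le> B" using f(2)[of 0] by linarith
  have int_h: "integrable M (\<lambda>\<omega>. g \<omega> * h n \<omega>)" if "integrable M g" for g n
    using that hb B0 by (intro integrable_mult_bounded[where C="2*B"]) auto
  have "(\<lambda>n. \<integral>\<omega>. Z \<omega> * h n \<omega> \<partial>M) \<longlonglongrightarrow> 0"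
    using Z
  proof (induction rule: integrable_induct)
    case (base A c)
    note A [measurable] = base(1)
    show ?case
    proof (cases "measure M A > 0")
      case True
      have "(\<lambda>n. c * ((\<integral>\<omega>. indicator A \<omega> * f (X n \<omega>) \<partial>M) - (\<integral>\<omega>. indicator A \<omega> * (\<integral>x. f x \<partial>\<mu> \<omega>) \<partial>M))) \<longlonglongrightarrow> 0"
        using tendsto_mult_left[OF LIM_zero[OF conditional_law_converges[OF A True f]], of c] by simp
      moreover have "(\<integral>\<omega>. (indicator A \<omega> *\<^sub>R c) * h n \<omega> \<partial>M) =
          c * ((\<integral>\<omega>. indicator A \<omega> * f (X n \<omega>) \<partial>M) - (\<integral>\<omega>. indicator A \<omega> * (\<integral>x. f x \<partial>\<mu> \<omega>) \<partial>M))" for n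
      proof -
        have "(\<integral>\<omega>. (indicator A \<omega> *\<^sub>R c) * h n \<omega> \<partial>M) =
            (\<integral>\<omega>. c * (indicator A \<omega> * f (X n \<omega>) - indicator A \<omega> * (\<integral>x. f x \<partial>\<mu> \<omega>)) \<partial>M)"
          by (intro Bochner_Integration.integral_cong) (auto simp: h_def algebra_simps)
        also have "\<dots> = c * (\<integral>\<omega>. indicator A \<omega> * f (X n \<omega>) - indicator A \<omega> * (\<integral>x. f x \<partial>\<mu> \<omega>) \<partial>M)"
          by simp
        also have "(\<integral>\<omega>. indicator A \<omega> * f (X n \<omega>) - indicator A \<omega> * (\<integral>x. f x \<partial>\<mu> \<omega>) \<partial>M) =
           (\<integral>\<omega>. indicator A \<omega> * f (X n \<omega>) \<partial>M) - (\<integral>\<omega>. indicator A \<omega> * (\<integral>x. f x \<partial>\<mu> \<omega>) \<partial>M)"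
          using f B0 kernel_integral_bound[OF _ f(2) fm]
          by (intro Bochner_Integration.integral_diff integrable_mult_bounded[where C=B])
            (auto simp: emeasure_eq_measure)
        finally show ?thesis .
      qed
      ultimately show ?thesis by simp
    next
      \<comment> \<open>No conditional law exists given a null set, but there the integral
        vanishes.\<close>
      case False
      then have "emeasure M A = 0"
        by (simp add: emeasure_eq_measure zero_less_measure_iff)
      then have "AE \<omega> in M. \<omega> \<notin> A" by (intro AE_I[of _ _ A]) auto
      then have "(\<integral>\<omega>. (indicator A \<omega> *\<^sub>R c) * h n \<omega> \<partial>M) = 0" for n
        by (intro integral_eq_zero_AE) (auto simp: indicator_def)
      then show ?thesis by simp
    qed
  next
    case (add g k)
    have "(\<integral>\<omega>. (g \<omega> + k \<omega>) * h n \<omega> \<partial>M) = (\<integral>\<omega>. g \<omega> * h n \<omega> \<partial>M) + (\<integral>\<omega>. k \<omega> * h n \<omega> \<partial>M)" for n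
      using add by (simp add: distrib_right int_h)
    then show ?case using tendsto_add[OF add(3,4)] by simp
  next
    case (lim g s)
    note [measurable] = borel_measurable_integrable[OF lim(4)] borel_measurable_integrable[OF lim(1)]
    \<comment> \<open>The induction rule provides |s i| <= 2 |g|, whence the majorant 3 |g|.\<close>
    have L1: "(\<lambda>i. \<integral>\<omega>. \<bar>g \<omega> - s i \<omega>\<bar> \<partial>M) \<longlonglongrightarrow> (\<integral>\<omega>. 0 \<partial>M)"
    proof (rule integral_dominated_convergence[where w="\<lambda>\<omega>. 3 * \<bar>g \<omega>\<bar>"])
      show "AE \<omega> in M. (\<lambda>i. \<bar>g \<omega> - s i \<omega>\<bar>) \<longlonglongrightarrow> 0"
        using lim(2) by (intro AE_I2 tendsto_rabs_zero) (auto intro!: tendsto_eq_intros)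
      show "AE \<omega> in M. norm \<bar>g \<omega> - s i \<omega>\<bar> \<le> 3 * \<bar>g \<omega>\<bar>" for i
        using lim(3) by (intro AE_I2) (smt (verit) real_norm_def)
    qed (use lim(4) in auto)
    show ?case
    proof (rule LIMSEQ_I)
      fix e :: real assume e: "0 < e"
      have "(\<lambda>i. (2 * B) * (\<integral>\<omega>. \<bar>g \<omega> - s i \<omega>\<bar> \<partial>M)) \<longlonglongrightarrow> 0"
        using tendsto_mult_left[OF L1, of "2*B"] by simp
      then have "eventually (\<lambda>i. (2 * B) * (\<integral>\<omega>. \<bar>g \<omega> - s i \<omega>\<bar> \<partial>M) < e/2) sequentially"
        using e by (intro order_tendstoD(2)) auto
      then obtain i where i: "(2 * B) * (\<integral>\<omega>. \<bar>g \<omega> - s i \<omega>\<bar> \<partial>M) < e/2"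
        by (auto simp: eventually_sequentially)
      obtain n0 where n0: "\<And>n. n \<ge> n0 \<Longrightarrow> \<bar>\<integral>\<omega>. s i \<omega> * h n \<omega> \<partial>M\<bar> < e/2"
        using LIMSEQ_D[OF lim(5)[of i], of "e/2"] e by auto
      have "\<bar>\<integral>\<omega>. g \<omega> * h n \<omega> \<partial>M\<bar> < e" if "n \<ge> n0" for n
      proof -
        have "(\<integral>\<omega>. g \<omega> * h n \<omega> \<partial>M) - (\<integral>\<omega>. s i \<omega> * h n \<omega> \<partial>M) = (\<integral>\<omega>. (g \<omega> - s i \<omega>) * h n \<omega> \<partial>M)"
          using lim(1) lim(4) by (simp add: left_diff_distrib int_h)
        moreover have "\<bar>\<integral>\<omega>. (g \<omega> - s i \<omega>) * h n \<omega> \<partial>M\<bar> \<le> (\<integral>\<omega>. \<bar>(g \<omega> - s i \<omega>) * h n \<omega>\<bar> \<partial>M)"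
          by (rule integral_abs_bound)
        moreover have "\<dots> \<le> (\<integral>\<omega>. (2 * B) * \<bar>g \<omega> - s i \<omega>\<bar> \<partial>M)"
          using lim(1) lim(4) hb B0
          by (intro integral_mono integrable_abs int_h integrable_mult_right)
            (auto simp: abs_mult mult.commute[of "2 * B"] intro!: mult_left_mono)
        ultimately show ?thesis using i n0[OF that] by (simp; linarith)
      qed
      then show "\<exists>n0. \<forall>n\<ge>n0. norm ((\<integral>\<omega>. g \<omega> * h n \<omega> \<partial>M) - 0) < e" by auto
    qed
  qed
  moreover have "(\<integral>\<omega>. Z \<omega> * h n \<omega> \<partial>M) = (\<integral>\<omega>. Z \<omega> * f (X n \<omega>) \<partial>M) - (\<integral>\<omega>. Z \<omega> * (\<integral>x. f x \<partial>\<mu> \<omega>) \<partial>M)" for n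
  proof -
    have "integrable M (\<lambda>\<omega>. Z \<omega> * f (X n \<omega>))" "integrable M (\<lambda>\<omega>. Z \<omega> * (\<integral>x. f x \<partial>\<mu> \<omega>))"
      using Z f B0 kernel_integral_bound[OF _ f(2) fm] by (auto intro!: integrable_mult_bounded[where C=B])
    then show ?thesis by (simp add: h_def right_diff_distrib)
  qed
  ultimately show ?thesis by (simp add: LIM_zero_iff)
qed

end

section \<open>Elementary inequalities\<close>

text \<open>The premise \<open>local\<close> says that \<open>Q f k n\<close> reads f below k only.
  This is what makes the recursive choice of r k legitimate when a condition compares the new index
  with all earlier ones.\<close>

lemma strict_mono_selection:
  fixes Q :: "(nat \<Rightarrow> nat) \<Rightarrow> nat \<Rightarrow> nat \<Rightarrow> bool"
  assumes local: "\<And>f g k n. (\<And>i. i < k \<Longrightarrow> f i = g i) \<Longrightarrow> Q f k n = Q g k n"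
    and ev: "\<And>f k. eventually (Q f k) sequentially"
  obtains r where "strict_mono r" "\<And>k. Q r k (r k)"
proof -
  have "\<exists>r. \<forall>k. Q r k (r k) \<and> (\<forall>i<k. r i < r k)"
  proof (rule dependent_wellorder_choice)
    fix n k :: nat and f g :: "nat \<Rightarrow> nat"
    assume eq: "\<And>i. i < k \<Longrightarrow> f i = g i"
    show "(Q f k n \<and> (\<forall>i<k. f i < n)) = (Q g k n \<and> (\<forall>i<k. g i < n))"
      using local[of k f g n] eq by auto
  next
    fix f :: "nat \<Rightarrow> nat" and k :: nat
    \<comment> \<open>The inserted 0 keeps \<open>Max\<close> meaningful at k = 0, where no earlier
      index exists.\<close>
    have "eventually (\<lambda>n. Q f k n \<and> n > Max (insert 0 (f ` {..<k}))) sequentially"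
      by (intro eventually_conj ev eventually_gt_at_top)
    then obtain n where "Q f k n" "n > Max (insert 0 (f ` {..<k}))"
      by (auto simp: eventually_sequentially)
    then show "\<exists>n. Q f k n \<and> (\<forall>i<k. f i < n)" by auto
  qed
  then obtain r where r: "\<And>k. Q r k (r k)" "\<And>i k. i < k \<Longrightarrow> r i < r k" by blast
  then show thesis using that[of r] by (simp add: strict_mono_def)
qed

lemma sum_geometric_half: "(\<Sum>k<n. (1/2) ^ k) \<le> (2::real)"
  by (subst sum_gp_strict) (auto simp: field_simps)

text \<open>If \<open>q\<close> were truncated at height \<open>m\<close>, the error in \<open>s * q\<close> would be at most
  \<open>\<bar>s\<bar> * q\<^sup>2 / m\<close>; AM-GM splits that into the last two terms.\<close>

lemma truncated_product_bound:
  fixes s q m d :: real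
  assumes m: "m > 0" and d: "d > 0"
  shows "s * q \<le> m * \<bar>s\<bar> + d * s\<^sup>2 + q ^ 4 / (4 * d * m\<^sup>2)"
proof (cases "\<bar>q\<bar> \<le> m")
  case True
  have "s * q \<le> \<bar>s\<bar> * \<bar>q\<bar>" by (metis abs_ge_self abs_mult)
  also have "\<dots> \<le> m * \<bar>s\<bar>" using True by (simp add: mult.commute mult_right_mono)
  finally have "s * q \<le> m * \<bar>s\<bar>" .
  moreover have "0 \<le> d * s\<^sup>2" "0 \<le> q ^ 4 / (4 * d * m\<^sup>2)" using m d by auto
  ultimately show ?thesis by linarith
next
  case False
  have "s * q \<le> \<bar>s\<bar> * \<bar>q\<bar>" by (metis abs_ge_self abs_mult)
  also have "\<dots> \<le> \<bar>s\<bar> * (q\<^sup>2 / m)"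
  proof (rule mult_left_mono)
    have "\<bar>q\<bar> * m \<le> \<bar>q\<bar> * \<bar>q\<bar>" using False by (intro mult_left_mono) auto
    then show "\<bar>q\<bar> \<le> q\<^sup>2 / m" using m by (simp add: pos_le_divide_eq power2_eq_square)
  qed simp
  also have "\<dots> \<le> d * s\<^sup>2 + q ^ 4 / (4 * d * m\<^sup>2)"
  proof -
    have "0 \<le> (2 * d * \<bar>s\<bar> - q\<^sup>2 / m)\<^sup>2" by simp
    also have "\<dots> = 4 * d\<^sup>2 * s\<^sup>2 - 4 * d * (\<bar>s\<bar> * (q\<^sup>2 / m)) + (q\<^sup>2 / m)\<^sup>2"
      unfolding power2_diff by (simp add: power_mult_distrib)
    also have "(q\<^sup>2 / m)\<^sup>2 = q ^ 4 / m\<^sup>2" by (simp add: power_divide)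
    finally have "4 * d * (\<bar>s\<bar> * (q\<^sup>2 / m)) \<le> 4 * d\<^sup>2 * s\<^sup>2 + q ^ 4 / m\<^sup>2" by simp
    then have "4 * d * (\<bar>s\<bar> * (q\<^sup>2 / m)) / (4 * d) \<le> (4 * d\<^sup>2 * s\<^sup>2 + q ^ 4 / m\<^sup>2) / (4 * d)"
      using d by (intro divide_right_mono) auto
    then show ?thesis using d m by (simp add: add_divide_distrib power2_eq_square mult_ac)
  qed
  finally have "s * q \<le> d * s\<^sup>2 + q ^ 4 / (4 * d * m\<^sup>2)" .
  moreover have "0 \<le> m * \<bar>s\<bar>" using m by simp
  ultimately show ?thesis by linarith
qed

definition clamp_to :: "real \<Rightarrow> real \<Rightarrow> real" where
  "clamp_to L x = max (- L) (min L x)"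

lemma clamp_to_bound: "0 \<le> L \<Longrightarrow> \<bar>clamp_to L x\<bar> \<le> L"
  by (auto simp: clamp_to_def)

lemma isCont_clamp_to: "isCont (clamp_to L) x"
  unfolding clamp_to_def by (intro continuous_intros)

lemma borel_measurable_clamp_to [measurable]: "clamp_to L \<in> borel_measurable borel"
  unfolding clamp_to_def by measurable

text \<open>Clamping at the higher level moves the value further in the direction of its sign, so
  the difference of the two clamps has the sign of \<open>clamp_to 1 x\<close>. The pairing of V_k
  with psi_k thereby gets a lower bound free of the level L.\<close>

lemma clamp_to_mult_mono:
  assumes "1 \<le> L"
  shows "(clamp_to 1 x)\<^sup>2 \<le> clamp_to L x * clamp_to 1 x"
proof -
  have "0 \<le> (clamp_to L x - clamp_to 1 x) * clamp_to 1 x"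
    using assms by (auto simp: clamp_to_def zero_le_mult_iff max_def min_def)
  then show ?thesis by (simp add: algebra_simps power2_eq_square)
qed

lemma clamp_to_remainder: "0 \<le> L \<Longrightarrow> \<bar>x - clamp_to L x\<bar> \<le> (if L \<le> \<bar>x\<bar> then \<bar>x\<bar> else 0)"
  by (auto simp: clamp_to_def)

lemma powr_add_le:
  fixes x y p :: real
  assumes "0 \<le> x" "0 \<le> y" "0 \<le> p"
  shows "(x + y) powr p \<le> 2 powr p * (x powr p + y powr p)"
proof -
  have "(x + y) powr p \<le> (2 * max x y) powr p" using assms by (intro powr_mono2) auto
  also have "\<dots> = 2 powr p * (max x y powr p)" using assms by (simp add: powr_mult)
  also have "\<dots> \<le> 2 powr p * (x powr p + y powr p)"
    by (intro mult_left_mono) (auto simp: max_def)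
  finally show ?thesis .
qed

text \<open>Peeling off the first term costs a factor 2^p <= 4 each time, so the i-th term pays
  4^(i+1). This crude bound replaces the triangle inequality in L^p; it is affordable because the
  remainders it is applied to decay like 8^-(i+1).\<close>

lemma powr_sum_le:
  fixes v :: "nat \<Rightarrow> real"
  assumes "\<And>i. 0 \<le> v i" "0 \<le> p" "p \<le> 2"
  shows "(\<Sum>i<n. v i) powr p \<le> (\<Sum>i<n. 4 ^ Suc i * v i powr p)"
  using assms(1)
proof (induction n arbitrary: v)
  case (Suc n)
  have two: "2 powr p \<le> (4::real)"
    using powr_mono[of p 2 "2::real"] assms by simp
  have "(\<Sum>i<Suc n. v i) powr p = (v 0 + (\<Sum>i<n. v (Suc i))) powr p"
    by (subst sum.lessThan_Suc_shift) simp
  also have "\<dots> \<le> 2 powr p * (v 0 powr p + (\<Sum>i<n. v (Suc i)) powr p)"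
    using Suc.prems assms by (intro powr_add_le sum_nonneg) auto
  also have "\<dots> \<le> 4 * (v 0 powr p + (\<Sum>i<n. 4 ^ Suc i * v (Suc i) powr p))"
    using Suc.IH[of "\<lambda>i. v (Suc i)"] Suc.prems two
    by (intro mult_mono add_mono) (auto intro!: add_nonneg_nonneg)
  also have "\<dots> = (\<Sum>i<Suc n. 4 ^ Suc i * v i powr p)"
    by (subst sum.lessThan_Suc_shift) (simp add: sum_distrib_left algebra_simps)
  finally show ?case .
qed simp

lemma sum_scaled_abs_bound:
  fixes c b :: "'i \<Rightarrow> real"
  assumes "\<And>i. i \<in> I \<Longrightarrow> \<bar>b i\<bar> \<le> 1"
  shows "\<bar>\<Sum>i\<in>I. b i * c i\<bar> \<le> (\<Sum>i\<in>I. \<bar>c i\<bar>)"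
proof -
  have "\<bar>\<Sum>i\<in>I. b i * c i\<bar> \<le> (\<Sum>i\<in>I. \<bar>b i\<bar> * \<bar>c i\<bar>)"
    using sum_abs[of "\<lambda>i. b i * c i" I] by (simp add: abs_mult)
  also have "\<dots> \<le> (\<Sum>i\<in>I. \<bar>c i\<bar>)"
    using assms by (intro sum_mono mult_left_le_one_le) auto
  finally show ?thesis .
qed

section \<open>Almost orthogonal sequences\<close>

text \<open>The bound holds everywhere on the space, not almost everywhere. The notion then depends
  on the sigma-algebra alone and transfers unchanged between the probability and its weighted
  version.\<close>

definition bounded_rv :: "'a measure \<Rightarrow> ('a \<Rightarrow> real) \<Rightarrow> bool" where
  "bounded_rv N f \<longleftrightarrow> f \<in> borel_measurable N \<and> (\<exists>C. \<forall>\<omega>\<in>space N. \<bar>f \<omega>\<bar> \<le> C)"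

lemma bounded_rvI:
  "f \<in> borel_measurable N \<Longrightarrow> (\<And>\<omega>. \<omega> \<in> space N \<Longrightarrow> \<bar>f \<omega>\<bar> \<le> C) \<Longrightarrow> bounded_rv N f"
  unfolding bounded_rv_def by blast

lemma bounded_rv_measurable [measurable_dest]: "bounded_rv N f \<Longrightarrow> f \<in> borel_measurable N"
  by (simp add: bounded_rv_def)

lemma bounded_rv_const [simp]: "bounded_rv N (\<lambda>_. c)"
  by (rule bounded_rvI[where C="\<bar>c\<bar>"]) auto

lemma bounded_rv_add:
  assumes "bounded_rv N f" "bounded_rv N g"
  shows "bounded_rv N (\<lambda>\<omega>. f \<omega> + g \<omega>)"
proof -
  obtain C D where CD: "\<And>\<omega>. \<omega> \<in> space N \<Longrightarrow> \<bar>f \<omega>\<bar> \<le> C" "\<And>\<omega>. \<omega> \<in> space N \<Longrightarrow> \<bar>g \<omega>\<bar> \<le> D"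
    using assms unfolding bounded_rv_def by blast
  have "\<bar>f \<omega> + g \<omega>\<bar> \<le> C + D" if "\<omega> \<in> space N" for \<omega>
    using CD[OF that] by linarith
  then show ?thesis using assms by (intro bounded_rvI) auto
qed

lemma bounded_rv_mult:
  assumes "bounded_rv N f" "bounded_rv N g"
  shows "bounded_rv N (\<lambda>\<omega>. f \<omega> * g \<omega>)"
proof -
  obtain C D where CD: "\<And>\<omega>. \<omega> \<in> space N \<Longrightarrow> \<bar>f \<omega>\<bar> \<le> C" "\<And>\<omega>. \<omega> \<in> space N \<Longrightarrow> \<bar>g \<omega>\<bar> \<le> D"
    using assms unfolding bounded_rv_def by blast
  have "\<bar>f \<omega> * g \<omega>\<bar> \<le> C * D" if "\<omega> \<in> space N" for \<omega>
    unfolding abs_mult using CD[OF that] by (intro mult_mono) auto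
  then show ?thesis using assms by (intro bounded_rvI) auto
qed

lemma bounded_rv_power: "bounded_rv N f \<Longrightarrow> bounded_rv N (\<lambda>\<omega>. f \<omega> ^ k)"
  by (induction k) (auto intro: bounded_rv_mult)

lemma bounded_rv_sum:
  "(\<And>i. i \<in> I \<Longrightarrow> bounded_rv N (f i)) \<Longrightarrow> bounded_rv N (\<lambda>\<omega>. \<Sum>i\<in>I. f i \<omega>)"
  by (induction I rule: infinite_finite_induct) (auto intro: bounded_rv_add)

lemma bounded_rv_abs: "bounded_rv N f \<Longrightarrow> bounded_rv N (\<lambda>\<omega>. \<bar>f \<omega>\<bar>)"
  unfolding bounded_rv_def by auto

lemma (in finite_measure) bounded_rv_integrable: "bounded_rv M f \<Longrightarrow> integrable M f"
  unfolding bounded_rv_def by (elim conjE exE, rule integrable_const_bound) auto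

lemmas bounded_rv_intros =
  bounded_rv_add bounded_rv_mult bounded_rv_power bounded_rv_sum bounded_rv_const bounded_rv_abs

text \<open>Bounded test functions are enough: products of finitely many bounded members of the
  sequences are again admissible, and no dual exponent appears.\<close>

definition weakly_null :: "'a measure \<Rightarrow> (nat \<Rightarrow> 'a \<Rightarrow> real) \<Rightarrow> bool" where
  "weakly_null N V \<longleftrightarrow> (\<forall>Z. bounded_rv N Z \<longrightarrow> (\<lambda>n. \<integral>\<omega>. Z \<omega> * V n \<omega> \<partial>N) \<longlonglongrightarrow> 0)"

text \<open>In the binomial expansion the term 4 q u^3 is absorbed by 2 u^2 (q^2 + u^2), which turns
  6 into 8 and 1 into 3. The only signed term left is linear in u, the one that orthogonality can
  make small.\<close>

lemma fourth_power_step: "(q + u) ^ 4 \<le> q ^ 4 + 4 * u * q ^ 3 + 8 * u\<^sup>2 * q\<^sup>2 + 3 * u ^ 4" for q u :: real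
proof -
  have "0 \<le> 2 * u\<^sup>2 * (q - u)\<^sup>2" by simp
  then show ?thesis by (simp add: power2_eq_square power3_eq_cube power4_eq_xxxx algebra_simps)
qed

context finite_measure
begin

text \<open>Adding the n-th term creates a cross term against the partial sum. With |a i| <= 1 it is
  at most the sum of its pairings with the earlier members, hence geometrically small.\<close>

lemma almost_orthogonal_square_bound:
  fixes V :: "nat \<Rightarrow> 'a \<Rightarrow> real" and a :: "nat \<Rightarrow> real"
  assumes V: "\<And>k. bounded_rv M (V k)" and B: "\<And>k. (\<integral>\<omega>. (V k \<omega>)\<^sup>2 \<partial>M) \<le> B"
    and orth: "\<And>k. (\<Sum>i<k. \<bar>\<integral>\<omega>. V i \<omega> * V k \<omega> \<partial>M\<bar>) \<le> \<tau> * (1/2) ^ k"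
    and a: "\<And>i. \<bar>a i\<bar> \<le> 1"
  shows "(\<integral>\<omega>. (\<Sum>i<n. a i * V i \<omega>)\<^sup>2 \<partial>M) \<le> B * (\<Sum>i<n. (a i)\<^sup>2) + 2 * \<tau> * (\<Sum>i<n. (1/2) ^ i)"
proof (induction n)
  case (Suc n)
  let ?S = "\<lambda>\<omega>. \<Sum>i<n. a i * V i \<omega>"
  have S: "bounded_rv M ?S" by (intro bounded_rv_intros V)
  have int: "integrable M (\<lambda>\<omega>. (?S \<omega>)\<^sup>2)" "integrable M (\<lambda>\<omega>. a i * (V i \<omega> * V n \<omega>))"
    "integrable M (\<lambda>\<omega>. ?S \<omega> * V n \<omega>)" "integrable M (\<lambda>\<omega>. (V n \<omega>)\<^sup>2)" for i
    by (intro bounded_rv_integrable bounded_rv_intros V S)+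
  have "(\<integral>\<omega>. ?S \<omega> * V n \<omega> \<partial>M) = (\<integral>\<omega>. (\<Sum>i<n. a i * (V i \<omega> * V n \<omega>)) \<partial>M)"
    by (intro Bochner_Integration.integral_cong) (auto simp: sum_distrib_right mult.assoc)
  also have "\<dots> = (\<Sum>i<n. a i * (\<integral>\<omega>. V i \<omega> * V n \<omega> \<partial>M))"
    using int by (subst Bochner_Integration.integral_sum) auto
  finally have "\<bar>\<integral>\<omega>. ?S \<omega> * V n \<omega> \<partial>M\<bar> \<le> \<tau> * (1/2) ^ n"
    using sum_scaled_abs_bound[of "{..<n}" a "\<lambda>i. \<integral>\<omega>. V i \<omega> * V n \<omega> \<partial>M", OF a] orth[of n] by linarith
  moreover have "\<bar>a n * (\<integral>\<omega>. ?S \<omega> * V n \<omega> \<partial>M)\<bar> \<le> \<bar>\<integral>\<omega>. ?S \<omega> * V n \<omega> \<partial>M\<bar>"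
    unfolding abs_mult using a[of n] by (intro mult_left_le_one_le) auto
  ultimately have cross: "a n * (\<integral>\<omega>. ?S \<omega> * V n \<omega> \<partial>M) \<le> \<tau> * (1/2) ^ n" by linarith
  have "(\<integral>\<omega>. (\<Sum>i<Suc n. a i * V i \<omega>)\<^sup>2 \<partial>M) =
      (\<integral>\<omega>. (?S \<omega>)\<^sup>2 + (2 * a n) * (?S \<omega> * V n \<omega>) + (a n)\<^sup>2 * (V n \<omega>)\<^sup>2 \<partial>M)"
    by (intro Bochner_Integration.integral_cong) (auto simp: power2_eq_square algebra_simps)
  also have "\<dots> = (\<integral>\<omega>. (?S \<omega>)\<^sup>2 \<partial>M) + 2 * (a n * (\<integral>\<omega>. ?S \<omega> * V n \<omega> \<partial>M)) + (a n)\<^sup>2 * (\<integral>\<omega>. (V n \<omega>)\<^sup>2 \<partial>M)"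
    using int by simp
  also have "\<dots> \<le> (B * (\<Sum>i<n. (a i)\<^sup>2) + 2 * \<tau> * (\<Sum>i<n. (1/2) ^ i)) + 2 * (\<tau> * (1/2) ^ n) + (a n)\<^sup>2 * B"
    using Suc.IH cross B by (intro add_mono mult_left_mono) auto
  finally show ?case by (simp add: algebra_simps)
qed simp

text \<open>Induction by \<open>fourth_power_step\<close> with u = a n * psi n. Expanding the cube
  of the partial sum leads to triples of earlier indices, which \<open>orth\<close> controls, while
  the mixed quadratic term is fed by the second moment bound D. From |psi| <= 2 and |a n| <= 1 come
  u^2 <= 4 (a n)^2 and u^4 <= 16 (a n)^2, hence 32 and 48.\<close>

lemma almost_orthogonal_fourth_bound:
  fixes \<psi> :: "nat \<Rightarrow> 'a \<Rightarrow> real" and a :: "nat \<Rightarrow> real"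
  assumes \<psi>: "\<And>k. \<psi> k \<in> borel_measurable M" "\<And>k \<omega>. \<omega> \<in> space M \<Longrightarrow> \<bar>\<psi> k \<omega>\<bar> \<le> 2"
    and mass: "measure M (space M) \<le> 1"
    and orth: "\<And>k. (\<Sum>h\<in>{..<k} \<times> {..<k} \<times> {..<k}.
      \<bar>\<integral>\<omega>. (\<psi> (fst h) \<omega> * \<psi> (fst (snd h)) \<omega> * \<psi> (snd (snd h)) \<omega>) * \<psi> k \<omega> \<partial>M\<bar>) \<le> \<tau> * (1/2) ^ k"
    and sq: "\<And>k. (\<integral>\<omega>. (\<Sum>i<k. a i * \<psi> i \<omega>)\<^sup>2 \<partial>M) \<le> D"
    and a: "\<And>i. \<bar>a i\<bar> \<le> 1"
  shows "(\<integral>\<omega>. (\<Sum>i<n. a i * \<psi> i \<omega>) ^ 4 \<partial>M)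
    \<le> (32 * D + 48) * (\<Sum>i<n. (a i)\<^sup>2) + 4 * \<tau> * (\<Sum>i<n. (1/2) ^ i)"
proof (induction n)
  case (Suc n)
  let ?S = "\<lambda>\<omega>. \<Sum>i<n. a i * \<psi> i \<omega>"
  let ?I = "{..<n} \<times> {..<n} \<times> {..<n}"
  let ?b = "\<lambda>h. a (fst h) * a (fst (snd h)) * a (snd (snd h))"
  let ?c = "\<lambda>h \<omega>. (\<psi> (fst h) \<omega> * \<psi> (fst (snd h)) \<omega> * \<psi> (snd (snd h)) \<omega>) * \<psi> n \<omega>"
  have V: "bounded_rv M (\<psi> k)" for k by (rule bounded_rvI) (use \<psi> in auto)
  have S: "bounded_rv M ?S" by (intro bounded_rv_intros V)
  have int: "integrable M (\<lambda>\<omega>. ?S \<omega> ^ 4)" "integrable M (\<lambda>\<omega>. (?S \<omega>)\<^sup>2)"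
    "integrable M (\<lambda>\<omega>. ?b h * ?c h \<omega>)" "integrable M (\<lambda>\<omega>. ?S \<omega> ^ 3 * \<psi> n \<omega>)"
    "integrable M (\<lambda>\<omega>. (\<Sum>i<Suc n. a i * \<psi> i \<omega>) ^ 4)" for h
    by (intro bounded_rv_integrable bounded_rv_intros V S)+
  have cube: "?S \<omega> ^ 3 * \<psi> n \<omega> = (\<Sum>h\<in>?I. ?b h * ?c h \<omega>)" for \<omega>
  proof -
    have "?S \<omega> ^ 3 = (\<Sum>i<n. \<Sum>j<n. \<Sum>l<n. (a i * \<psi> i \<omega>) * ((a j * \<psi> j \<omega>) * (a l * \<psi> l \<omega>)))"
    proof -
      have "?S \<omega> ^ 3 = ?S \<omega> * (?S \<omega> * ?S \<omega>)" by (simp add: power3_eq_cube)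
      also have "\<dots> = (\<Sum>i<n. (a i * \<psi> i \<omega>) * (?S \<omega> * ?S \<omega>))" by (rule sum_distrib_right)
      also have "?S \<omega> * ?S \<omega> = (\<Sum>j<n. \<Sum>l<n. (a j * \<psi> j \<omega>) * (a l * \<psi> l \<omega>))"
        by (rule sum_product)
      finally show ?thesis by (simp only: sum_distrib_left)
    qed
    also have "\<dots> = (\<Sum>h\<in>?I. (a (fst h) * \<psi> (fst h) \<omega>) *
        ((a (fst (snd h)) * \<psi> (fst (snd h)) \<omega>) * (a (snd (snd h)) * \<psi> (snd (snd h)) \<omega>)))"
      by (simp add: sum.cartesian_product case_prod_unfold)
    finally show ?thesis by (simp add: sum_distrib_left mult_ac)
  qed
  have b: "\<bar>?b h\<bar> \<le> 1" for h
    using a[of "fst h"] a[of "fst (snd h)"] a[of "snd (snd h)"] by (simp add: abs_mult mult_le_one)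
  have "(\<integral>\<omega>. ?S \<omega> ^ 3 * \<psi> n \<omega> \<partial>M) = (\<Sum>h\<in>?I. ?b h * (\<integral>\<omega>. ?c h \<omega> \<partial>M))"
    unfolding cube using int(3) by (subst Bochner_Integration.integral_sum) auto
  then have "\<bar>\<integral>\<omega>. ?S \<omega> ^ 3 * \<psi> n \<omega> \<partial>M\<bar> \<le> \<tau> * (1/2) ^ n"
    using sum_scaled_abs_bound[of ?I ?b "\<lambda>h. \<integral>\<omega>. ?c h \<omega> \<partial>M", OF b] orth[of n] by linarith
  moreover have "\<bar>a n * (\<integral>\<omega>. ?S \<omega> ^ 3 * \<psi> n \<omega> \<partial>M)\<bar> \<le> \<bar>\<integral>\<omega>. ?S \<omega> ^ 3 * \<psi> n \<omega> \<partial>M\<bar>"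
    unfolding abs_mult using a[of n] by (intro mult_left_le_one_le) auto
  ultimately have cross: "a n * (\<integral>\<omega>. ?S \<omega> ^ 3 * \<psi> n \<omega> \<partial>M) \<le> \<tau> * (1/2) ^ n" by linarith
  have pointwise: "(\<Sum>i<Suc n. a i * \<psi> i \<omega>) ^ 4 \<le>
      ?S \<omega> ^ 4 + (4 * a n) * (?S \<omega> ^ 3 * \<psi> n \<omega>) + (32 * (a n)\<^sup>2) * (?S \<omega>)\<^sup>2 + 48 * (a n)\<^sup>2"
    if "\<omega> \<in> space M" for \<omega>
  proof -
    have "(\<psi> n \<omega>)\<^sup>2 \<le> 2\<^sup>2" using \<psi>(2)[OF that, of n] by (intro power2_le_iff_abs_le[THEN iffD2]) auto
    then have u2: "(a n * \<psi> n \<omega>)\<^sup>2 \<le> 4 * (a n)\<^sup>2"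
      using mult_left_mono[of "(\<psi> n \<omega>)\<^sup>2" 4 "(a n)\<^sup>2"] by (simp add: power_mult_distrib)
    have a2: "(a n)\<^sup>2 \<le> 1" using a[of n] by (simp add: abs_square_le_1)
    have "(a n * \<psi> n \<omega>) ^ 4 = (a n * \<psi> n \<omega>)\<^sup>2 * (a n * \<psi> n \<omega>)\<^sup>2" by (simp flip: power_add)
    also have "\<dots> \<le> (4 * (a n)\<^sup>2) * (4 * 1)"
      using u2 a2 by (intro mult_mono) auto
    finally have u4: "(a n * \<psi> n \<omega>) ^ 4 \<le> 16 * (a n)\<^sup>2" by simp
    have "8 * (a n * \<psi> n \<omega>)\<^sup>2 * (?S \<omega>)\<^sup>2 \<le> (32 * (a n)\<^sup>2) * (?S \<omega>)\<^sup>2"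
      using u2 by (intro mult_right_mono) auto
    then show ?thesis using fourth_power_step[of "?S \<omega>" "a n * \<psi> n \<omega>"] u4 by (simp add: mult_ac)
  qed
  have "(\<integral>\<omega>. (\<Sum>i<Suc n. a i * \<psi> i \<omega>) ^ 4 \<partial>M) \<le>
      (\<integral>\<omega>. ?S \<omega> ^ 4 + (4 * a n) * (?S \<omega> ^ 3 * \<psi> n \<omega>) + (32 * (a n)\<^sup>2) * (?S \<omega>)\<^sup>2 + 48 * (a n)\<^sup>2 \<partial>M)"
    using int pointwise by (intro integral_mono Bochner_Integration.integrable_add integrable_mult_right) auto
  also have "\<dots> = (\<integral>\<omega>. ?S \<omega> ^ 4 \<partial>M) + 4 * (a n * (\<integral>\<omega>. ?S \<omega> ^ 3 * \<psi> n \<omega> \<partial>M))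
      + (32 * (a n)\<^sup>2) * (\<integral>\<omega>. (?S \<omega>)\<^sup>2 \<partial>M) + 48 * (a n)\<^sup>2 * measure M (space M)"
    using int by simp
  also have "\<dots> \<le> ((32 * D + 48) * (\<Sum>i<n. (a i)\<^sup>2) + 4 * \<tau> * (\<Sum>i<n. (1/2) ^ i)) + 4 * (\<tau> * (1/2) ^ n)
      + (32 * (a n)\<^sup>2) * D + 48 * (a n)\<^sup>2 * 1"
    using Suc.IH cross sq mass by (intro add_mono mult_left_mono) auto
  finally show ?case by (simp add: algebra_simps)
qed simp

text \<open>The diagonal contributes c (a n)^2 at each step. The pairing is not symmetric, so the
  new V must be nearly orthogonal to the old psi and the new psi to the old V.\<close>

lemma almost_biorthogonal_lower_bound:
  fixes V \<psi> :: "nat \<Rightarrow> 'a \<Rightarrow> real" and a :: "nat \<Rightarrow> real"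
  assumes V: "\<And>k. bounded_rv M (V k)" and \<psi>: "\<And>k. bounded_rv M (\<psi> k)"
    and c: "\<And>k. c \<le> (\<integral>\<omega>. V k \<omega> * \<psi> k \<omega> \<partial>M)"
    and orth1: "\<And>k. (\<Sum>i<k. \<bar>\<integral>\<omega>. V i \<omega> * \<psi> k \<omega> \<partial>M\<bar>) \<le> \<tau> * (1/2) ^ k"
    and orth2: "\<And>k. (\<Sum>i<k. \<bar>\<integral>\<omega>. \<psi> i \<omega> * V k \<omega> \<partial>M\<bar>) \<le> \<tau> * (1/2) ^ k"
    and a: "\<And>i. \<bar>a i\<bar> \<le> 1"
  shows "c * (\<Sum>i<n. (a i)\<^sup>2) - 2 * \<tau> * (\<Sum>i<n. (1/2) ^ i)
    \<le> (\<integral>\<omega>. (\<Sum>i<n. a i * V i \<omega>) * (\<Sum>i<n. a i * \<psi> i \<omega>) \<partial>M)"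
proof (induction n)
  case (Suc n)
  let ?S = "\<lambda>\<omega>. \<Sum>i<n. a i * V i \<omega>" and ?Q = "\<lambda>\<omega>. \<Sum>i<n. a i * \<psi> i \<omega>"
  have cross: "- (\<tau> * (1/2) ^ n) \<le> a n * (\<integral>\<omega>. (\<Sum>i<n. a i * F i \<omega>) * G \<omega> \<partial>M)"
    if F: "\<And>k. bounded_rv M (F k)" and G: "bounded_rv M G"
      and o: "(\<Sum>i<n. \<bar>\<integral>\<omega>. F i \<omega> * G \<omega> \<partial>M\<bar>) \<le> \<tau> * (1/2) ^ n" for F :: "nat \<Rightarrow> 'a \<Rightarrow> real" and G
  proof -
    have int: "integrable M (\<lambda>\<omega>. a i * (F i \<omega> * G \<omega>))" for i
      by (intro bounded_rv_integrable bounded_rv_intros F G)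
    have "(\<integral>\<omega>. (\<Sum>i<n. a i * F i \<omega>) * G \<omega> \<partial>M) = (\<integral>\<omega>. (\<Sum>i<n. a i * (F i \<omega> * G \<omega>)) \<partial>M)"
      by (intro Bochner_Integration.integral_cong) (auto simp: sum_distrib_right mult.assoc)
    also have "\<dots> = (\<Sum>i<n. a i * (\<integral>\<omega>. F i \<omega> * G \<omega> \<partial>M))"
      using int by (subst Bochner_Integration.integral_sum) auto
    finally have "\<bar>\<integral>\<omega>. (\<Sum>i<n. a i * F i \<omega>) * G \<omega> \<partial>M\<bar> \<le> \<tau> * (1/2) ^ n"
      using sum_scaled_abs_bound[of "{..<n}" a "\<lambda>i. \<integral>\<omega>. F i \<omega> * G \<omega> \<partial>M", OF a] o by linarith
    moreover have "\<bar>a n * (\<integral>\<omega>. (\<Sum>i<n. a i * F i \<omega>) * G \<omega> \<partial>M)\<bar> \<le> \<bar>\<integral>\<omega>. (\<Sum>i<n. a i * F i \<omega>) * G \<omega> \<partial>M\<bar>"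
      unfolding abs_mult using a[of n] by (intro mult_left_le_one_le) auto
    ultimately show ?thesis by linarith
  qed
  have S: "bounded_rv M ?S" and Q: "bounded_rv M ?Q" by (intro bounded_rv_intros V \<psi>)+
  have int: "integrable M (\<lambda>\<omega>. ?S \<omega> * ?Q \<omega>)" "integrable M (\<lambda>\<omega>. ?S \<omega> * \<psi> n \<omega>)"
    "integrable M (\<lambda>\<omega>. ?Q \<omega> * V n \<omega>)" "integrable M (\<lambda>\<omega>. V n \<omega> * \<psi> n \<omega>)"
    by (intro bounded_rv_integrable bounded_rv_intros V \<psi> S Q)+
  have "(\<integral>\<omega>. (\<Sum>i<Suc n. a i * V i \<omega>) * (\<Sum>i<Suc n. a i * \<psi> i \<omega>) \<partial>M) =
      (\<integral>\<omega>. ?S \<omega> * ?Q \<omega> + a n * (?S \<omega> * \<psi> n \<omega>) + a n * (?Q \<omega> * V n \<omega>) + (a n)\<^sup>2 * (V n \<omega> * \<psi> n \<omega>) \<partial>M)"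
    by (intro Bochner_Integration.integral_cong) (auto simp: power2_eq_square algebra_simps)
  also have "\<dots> = (\<integral>\<omega>. ?S \<omega> * ?Q \<omega> \<partial>M) + a n * (\<integral>\<omega>. ?S \<omega> * \<psi> n \<omega> \<partial>M)
      + a n * (\<integral>\<omega>. ?Q \<omega> * V n \<omega> \<partial>M) + (a n)\<^sup>2 * (\<integral>\<omega>. V n \<omega> * \<psi> n \<omega> \<partial>M)"
    using int by simp
  also have "\<dots> \<ge> (c * (\<Sum>i<n. (a i)\<^sup>2) - 2 * \<tau> * (\<Sum>i<n. (1/2) ^ i)) + (- (\<tau> * (1/2) ^ n))
      + (- (\<tau> * (1/2) ^ n)) + (a n)\<^sup>2 * c"
    using Suc.IH cross[of V, OF V \<psi> orth1] cross[of \<psi>, OF \<psi> V orth2] c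
    by (intro add_mono mult_left_mono) auto
  finally show ?case by (simp add: algebra_simps)
qed simp

text \<open>Every requirement pairs the new member with finitely many bounded functions built from
  earlier members, so weak nullity makes it hold for all late indices. All five can therefore be met
  in a single selection.\<close>

lemma almost_orthogonal_subsequence:
  fixes V \<psi> :: "nat \<Rightarrow> 'a \<Rightarrow> real"
  assumes V: "\<And>k. bounded_rv M (V k)" and \<psi>: "\<And>k. bounded_rv M (\<psi> k)"
    and wV: "weakly_null M V" and w\<psi>: "weakly_null M \<psi>" and \<tau>: "0 < \<tau>"
  obtains r where "strict_mono r"
    "\<And>k. (\<Sum>i<k. \<bar>\<integral>\<omega>. V (r i) \<omega> * V (r k) \<omega> \<partial>M\<bar>) \<le> \<tau> * (1/2) ^ k"
    "\<And>k. (\<Sum>i<k. \<bar>\<integral>\<omega>. \<psi> (r i) \<omega> * \<psi> (r k) \<omega> \<partial>M\<bar>) \<le> \<tau> * (1/2) ^ k"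
    "\<And>k. (\<Sum>i<k. \<bar>\<integral>\<omega>. V (r i) \<omega> * \<psi> (r k) \<omega> \<partial>M\<bar>) \<le> \<tau> * (1/2) ^ k"
    "\<And>k. (\<Sum>i<k. \<bar>\<integral>\<omega>. \<psi> (r i) \<omega> * V (r k) \<omega> \<partial>M\<bar>) \<le> \<tau> * (1/2) ^ k"
    "\<And>k. (\<Sum>h\<in>{..<k} \<times> {..<k} \<times> {..<k}. \<bar>\<integral>\<omega>. (\<psi> (r (fst h)) \<omega> * \<psi> (r (fst (snd h))) \<omega> *
        \<psi> (r (snd (snd h))) \<omega>) * \<psi> (r k) \<omega> \<partial>M\<bar>) \<le> \<tau> * (1/2) ^ k"
proof -
  define Q where "Q f k n \<longleftrightarrow>
    (\<Sum>i<k. \<bar>\<integral>\<omega>. V (f i) \<omega> * V n \<omega> \<partial>M\<bar>) \<le> \<tau> * (1/2) ^ k \<and>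
    (\<Sum>i<k. \<bar>\<integral>\<omega>. \<psi> (f i) \<omega> * \<psi> n \<omega> \<partial>M\<bar>) \<le> \<tau> * (1/2) ^ k \<and>
    (\<Sum>i<k. \<bar>\<integral>\<omega>. V (f i) \<omega> * \<psi> n \<omega> \<partial>M\<bar>) \<le> \<tau> * (1/2) ^ k \<and>
    (\<Sum>i<k. \<bar>\<integral>\<omega>. \<psi> (f i) \<omega> * V n \<omega> \<partial>M\<bar>) \<le> \<tau> * (1/2) ^ k \<and>
    (\<Sum>h\<in>{..<k} \<times> {..<k} \<times> {..<k}. \<bar>\<integral>\<omega>. (\<psi> (f (fst h)) \<omega> * \<psi> (f (fst (snd h))) \<omega> *
        \<psi> (f (snd (snd h))) \<omega>) * \<psi> n \<omega> \<partial>M\<bar>) \<le> \<tau> * (1/2) ^ k" for f :: "nat \<Rightarrow> nat" and k n :: nat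
  \<comment> \<open>The index type is left open: it is \<open>nat\<close> for the pairings and a
    triple of naturals for the cubic condition.\<close>
  have ev: "eventually (\<lambda>n. (\<Sum>i\<in>I. \<bar>\<integral>\<omega>. F i \<omega> * G n \<omega> \<partial>M\<bar>) \<le> \<tau> * (1/2) ^ k) sequentially"
    if "\<And>i. bounded_rv M (F i)" "weakly_null M G"
    for I :: "'i set" and F G k
  proof -
    have "(\<lambda>n. \<Sum>i\<in>I. \<bar>\<integral>\<omega>. F i \<omega> * G n \<omega> \<partial>M\<bar>) \<longlonglongrightarrow> (\<Sum>i\<in>I. 0)"
      using that by (intro tendsto_sum tendsto_rabs_zero) (auto simp: weakly_null_def)
    then have "eventually (\<lambda>n. (\<Sum>i\<in>I. \<bar>\<integral>\<omega>. F i \<omega> * G n \<omega> \<partial>M\<bar>) < \<tau> * (1/2) ^ k) sequentially"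
      using \<tau> by (intro order_tendstoD(2)[where y="\<Sum>i\<in>I. 0"]) auto
    then show ?thesis by eventually_elim simp
  qed
  have "Q f k n = Q g k n" if eq: "\<And>i. i < k \<Longrightarrow> f i = g i" for f g k n
  proof -
    have single: "(\<Sum>i<k. c (f i)) = (\<Sum>i<k. c (g i))" for c :: "nat \<Rightarrow> real"
      using eq by (intro sum.cong) auto
    have triple: "(\<Sum>h\<in>{..<k} \<times> {..<k} \<times> {..<k}. c (f (fst h)) (f (fst (snd h))) (f (snd (snd h)))) =
       (\<Sum>h\<in>{..<k} \<times> {..<k} \<times> {..<k}. c (g (fst h)) (g (fst (snd h))) (g (snd (snd h))))"
       for c :: "nat \<Rightarrow> nat \<Rightarrow> nat \<Rightarrow> real"
      using eq by (intro sum.cong) auto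
    show ?thesis unfolding Q_def
      using single[of "\<lambda>x. \<bar>\<integral>\<omega>. V x \<omega> * V n \<omega> \<partial>M\<bar>"] single[of "\<lambda>x. \<bar>\<integral>\<omega>. \<psi> x \<omega> * \<psi> n \<omega> \<partial>M\<bar>"]
        single[of "\<lambda>x. \<bar>\<integral>\<omega>. V x \<omega> * \<psi> n \<omega> \<partial>M\<bar>"] single[of "\<lambda>x. \<bar>\<integral>\<omega>. \<psi> x \<omega> * V n \<omega> \<partial>M\<bar>"]
        triple[of "\<lambda>x y z. \<bar>\<integral>\<omega>. (\<psi> x \<omega> * \<psi> y \<omega> * \<psi> z \<omega>) * \<psi> n \<omega> \<partial>M\<bar>"]
      by simp
  qed
  moreover have "eventually (Q f k) sequentially" for f k
    unfolding Q_def by (intro eventually_conj ev bounded_rv_intros V \<psi> wV w\<psi>)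
  ultimately obtain r where "strict_mono r" "\<And>k. Q r k (r k)"
    using strict_mono_selection[of Q] by metis
  then show thesis using that[of r] by (simp add: Q_def)
qed

end

text \<open>The constant \<open>c\<close> must not depend on the sequences: the remainder sequence is made small compared with
  \<open>c\<close> before \<open>V\<close> is chosen.\<close>

lemma (in finite_measure) l2_subsequence:
  assumes mass: "measure M (space M) \<le> 1" and B: "0 \<le> B" and c0: "0 < c0"
  shows "\<exists>c>0. \<forall>V \<psi>. (\<forall>k. bounded_rv M (V k)) \<longrightarrow> (\<forall>k. \<psi> k \<in> borel_measurable M) \<longrightarrow>
      (\<forall>k. \<forall>\<omega>\<in>space M. \<bar>\<psi> k \<omega>\<bar> \<le> 2) \<longrightarrow> weakly_null M V \<longrightarrow> weakly_null M \<psi> \<longrightarrow>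
      (\<forall>k. (\<integral>\<omega>. (V k \<omega>)\<^sup>2 \<partial>M) \<le> B) \<longrightarrow> (\<forall>k. c0 \<le> (\<integral>\<omega>. V k \<omega> * \<psi> k \<omega> \<partial>M)) \<longrightarrow>
      (\<exists>r :: nat \<Rightarrow> nat. strict_mono r \<and> (\<forall>n a. (\<Sum>i<n. (a i)\<^sup>2) = 1 \<longrightarrow>
        c \<le> (\<integral>\<omega>. \<bar>\<Sum>i<n. a i * V (r i) \<omega>\<bar> \<partial>M) \<and>
        (\<integral>\<omega>. (\<Sum>i<n. a i * V (r i) \<omega>)\<^sup>2 \<partial>M) \<le> B + 4))"
proof -
  \<comment> \<open>Budget for the lower bound: the off-diagonal terms take 4 tau <= c0 / 4, the
    quadratic error d (B + 4) = c0 / 8, and the quartic error 312 / (4 d m^2) = c0 / 8, so c0 / 2 is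
    left for m times the L1 norm. The 312 bounds the fourth moment: (32 * 8 + 48) + 8 tau with tau
    <= 1, where 8 bounds the second moments of the psi-sums.\<close>
  define \<tau> where "\<tau> = min 1 (c0 / 16)"
  define d where "d = c0 / (8 * (B + 4))"
  define m where "m = sqrt (624 / (d * c0))"
  have \<tau>: "0 < \<tau>" "\<tau> \<le> 1" "\<tau> \<le> c0 / 16" using c0 by (auto simp: \<tau>_def)
  have B4: "0 < B + 4" using B by simp
  then have d: "0 < d" "d * (B + 4) = c0 / 8"
    using c0 by (auto simp: d_def simp del: distrib_left_numeral)
  have m: "0 < m" using d c0 by (simp add: m_def)
  have m2: "m\<^sup>2 = 624 / (d * c0)" using d c0 by (simp add: m_def)
  have err: "312 / (4 * d * m\<^sup>2) = c0 / 8" unfolding m2 using d c0 by simp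
  show ?thesis
  proof (intro exI[of _ "c0 / (2 * m)"] conjI allI impI)
    show "0 < c0 / (2 * m)" using c0 m by simp
    fix V \<psi> :: "nat \<Rightarrow> 'a \<Rightarrow> real"
    assume V: "\<forall>k. bounded_rv M (V k)" and \<psi>m: "\<forall>k. \<psi> k \<in> borel_measurable M"
      and \<psi>2: "\<forall>k. \<forall>\<omega>\<in>space M. \<bar>\<psi> k \<omega>\<bar> \<le> 2" and wV: "weakly_null M V" and w\<psi>: "weakly_null M \<psi>"
      and sqV: "\<forall>k. (\<integral>\<omega>. (V k \<omega>)\<^sup>2 \<partial>M) \<le> B" and low: "\<forall>k. c0 \<le> (\<integral>\<omega>. V k \<omega> * \<psi> k \<omega> \<partial>M)"
    have \<psi>: "bounded_rv M (\<psi> k)" for k using \<psi>m \<psi>2 by (auto intro!: bounded_rvI)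
    obtain r where r: "strict_mono r"
      and VV: "\<And>k. (\<Sum>i<k. \<bar>\<integral>\<omega>. V (r i) \<omega> * V (r k) \<omega> \<partial>M\<bar>) \<le> \<tau> * (1/2) ^ k"
      and PP: "\<And>k. (\<Sum>i<k. \<bar>\<integral>\<omega>. \<psi> (r i) \<omega> * \<psi> (r k) \<omega> \<partial>M\<bar>) \<le> \<tau> * (1/2) ^ k"
      and VP: "\<And>k. (\<Sum>i<k. \<bar>\<integral>\<omega>. V (r i) \<omega> * \<psi> (r k) \<omega> \<partial>M\<bar>) \<le> \<tau> * (1/2) ^ k"
      and PV: "\<And>k. (\<Sum>i<k. \<bar>\<integral>\<omega>. \<psi> (r i) \<omega> * V (r k) \<omega> \<partial>M\<bar>) \<le> \<tau> * (1/2) ^ k"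
      and PPPP: "\<And>k. (\<Sum>h\<in>{..<k} \<times> {..<k} \<times> {..<k}. \<bar>\<integral>\<omega>. (\<psi> (r (fst h)) \<omega> * \<psi> (r (fst (snd h))) \<omega> *
        \<psi> (r (snd (snd h))) \<omega>) * \<psi> (r k) \<omega> \<partial>M\<bar>) \<le> \<tau> * (1/2) ^ k"
      using almost_orthogonal_subsequence[OF spec[OF V] \<psi> wV w\<psi> \<tau>(1)] by blast
    have bounds: "c0 / (2 * m) \<le> (\<integral>\<omega>. \<bar>\<Sum>i<n. a i * V (r i) \<omega>\<bar> \<partial>M) \<and>
        (\<integral>\<omega>. (\<Sum>i<n. a i * V (r i) \<omega>)\<^sup>2 \<partial>M) \<le> B + 4"
      if a: "\<And>i. \<bar>a i\<bar> \<le> 1" and norm1: "(\<Sum>i<n. (a i)\<^sup>2) = 1" and le1: "\<And>k. (\<Sum>i<k. (a i)\<^sup>2) \<le> 1" for n a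
    proof -
      let ?S = "\<lambda>\<omega>. \<Sum>i<n. a i * V (r i) \<omega>" and ?Q = "\<lambda>\<omega>. \<Sum>i<n. a i * \<psi> (r i) \<omega>"
      have gs: "\<tau> * (\<Sum>i<k. (1/2) ^ i) \<le> \<tau> * 2" for k
        using sum_geometric_half \<tau>(1) by (intro mult_left_mono) auto
      have "(\<integral>\<omega>. (?S \<omega>)\<^sup>2 \<partial>M) \<le> B * (\<Sum>i<n. (a i)\<^sup>2) + 2 * \<tau> * (\<Sum>i<n. (1/2) ^ i)"
        by (rule almost_orthogonal_square_bound) (use V sqV VV a in auto)
      then have S2: "(\<integral>\<omega>. (?S \<omega>)\<^sup>2 \<partial>M) \<le> B + 4" using gs[of n] \<tau>(2) norm1 by simp
      have Q2: "(\<integral>\<omega>. (\<Sum>i<k. a i * \<psi> (r i) \<omega>)\<^sup>2 \<partial>M) \<le> 8" for k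
      proof -
        have "(\<integral>\<omega>. (\<psi> j \<omega>)\<^sup>2 \<partial>M) \<le> 4" for j
        proof -
          have "(\<psi> j \<omega>)\<^sup>2 \<le> 4" if "\<omega> \<in> space M" for \<omega>
            using \<psi>2[rule_format, of \<omega> j] that power2_le_iff_abs_le[of 2 "\<psi> j \<omega>"] by simp
          then have "(\<integral>\<omega>. (\<psi> j \<omega>)\<^sup>2 \<partial>M) \<le> (\<integral>\<omega>. 4 \<partial>M)"
            by (intro integral_mono bounded_rv_integrable bounded_rv_intros \<psi>) auto
          then show ?thesis using mass by simp
        qed
        then have "(\<integral>\<omega>. (\<Sum>i<k. a i * \<psi> (r i) \<omega>)\<^sup>2 \<partial>M) \<le> 4 * (\<Sum>i<k. (a i)\<^sup>2) + 2 * \<tau> * (\<Sum>i<k. (1/2) ^ i)"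
          by (intro almost_orthogonal_square_bound) (use \<psi> PP a in auto)
        then show ?thesis using gs[of k] \<tau>(2) le1[of k] by simp
      qed
      have "(\<integral>\<omega>. (?Q \<omega>) ^ 4 \<partial>M) \<le> (32 * 8 + 48) * (\<Sum>i<n. (a i)\<^sup>2) + 4 * \<tau> * (\<Sum>i<n. (1/2) ^ i)"
        by (rule almost_orthogonal_fourth_bound) (use \<psi>m \<psi>2 PPPP Q2 a mass in auto)
      then have Q4: "(\<integral>\<omega>. (?Q \<omega>) ^ 4 \<partial>M) \<le> 312" using gs[of n] \<tau>(2) norm1 by simp
      have "c0 * (\<Sum>i<n. (a i)\<^sup>2) - 2 * \<tau> * (\<Sum>i<n. (1/2) ^ i) \<le> (\<integral>\<omega>. ?S \<omega> * ?Q \<omega> \<partial>M)"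
        by (rule almost_biorthogonal_lower_bound) (use V \<psi> low VP PV a in auto)
      then have SQ: "3 * c0 / 4 \<le> (\<integral>\<omega>. ?S \<omega> * ?Q \<omega> \<partial>M)" using gs[of n] \<tau>(3) norm1 by simp
      have S: "bounded_rv M ?S" and Q: "bounded_rv M ?Q" using V \<psi> by (intro bounded_rv_intros; simp)+
      have int: "integrable M (\<lambda>\<omega>. ?S \<omega> * ?Q \<omega>)" "integrable M (\<lambda>\<omega>. \<bar>?S \<omega>\<bar>)"
        "integrable M (\<lambda>\<omega>. (?S \<omega>)\<^sup>2)" "integrable M (\<lambda>\<omega>. (?Q \<omega>) ^ 4)"
        by (intro bounded_rv_integrable bounded_rv_intros S Q)+
      have "(\<integral>\<omega>. ?S \<omega> * ?Q \<omega> \<partial>M) \<le> (\<integral>\<omega>. m * \<bar>?S \<omega>\<bar> + d * (?S \<omega>)\<^sup>2 + (?Q \<omega>) ^ 4 / (4 * d * m\<^sup>2) \<partial>M)"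
        using int truncated_product_bound[OF m d(1)] by (intro integral_mono) auto
      also have "\<dots> = m * (\<integral>\<omega>. \<bar>?S \<omega>\<bar> \<partial>M) + d * (\<integral>\<omega>. (?S \<omega>)\<^sup>2 \<partial>M) + (\<integral>\<omega>. (?Q \<omega>) ^ 4 \<partial>M) / (4 * d * m\<^sup>2)"
        using int by simp
      also have "\<dots> \<le> m * (\<integral>\<omega>. \<bar>?S \<omega>\<bar> \<partial>M) + d * (B + 4) + 312 / (4 * d * m\<^sup>2)"
        using S2 Q4 d(1) m by (intro add_mono mult_left_mono divide_right_mono) auto
      finally have "c0 / 2 \<le> m * (\<integral>\<omega>. \<bar>?S \<omega>\<bar> \<partial>M)" using SQ d(2) err by linarith
      then show ?thesis using S2 m by (simp add: field_simps)
    qed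
    show "\<exists>r :: nat \<Rightarrow> nat. strict_mono r \<and> (\<forall>n a. (\<Sum>i<n. (a i)\<^sup>2) = 1 \<longrightarrow>
        c0 / (2 * m) \<le> (\<integral>\<omega>. \<bar>\<Sum>i<n. a i * V (r i) \<omega>\<bar> \<partial>M) \<and>
        (\<integral>\<omega>. (\<Sum>i<n. a i * V (r i) \<omega>)\<^sup>2 \<partial>M) \<le> B + 4)"
    proof (intro exI[of _ r] conjI r allI impI)
      fix n and a :: "nat \<Rightarrow> real"
      assume norm1: "(\<Sum>i<n. (a i)\<^sup>2) = 1"
      \<comment> \<open>Coefficients from n on are unconstrained by the claim. Zero extension gives
        |b i| <= 1 and partial square sums at most 1 at every index, as the inductive estimates
        demand.\<close>
      define b where "b i = (if i < n then a i else 0)" for i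
      have b1: "(\<Sum>i<n. (b i)\<^sup>2) = 1" using norm1 by (simp add: b_def)
      have ble: "(\<Sum>i<k. (b i)\<^sup>2) \<le> 1" for k
      proof -
        have "(\<Sum>i<k. (b i)\<^sup>2) \<le> (\<Sum>i<max k n. (b i)\<^sup>2)" by (intro sum_mono2) auto
        also have "\<dots> = (\<Sum>i<n. (b i)\<^sup>2)" by (intro sum.mono_neutral_right) (auto simp: b_def)
        finally show ?thesis using b1 by simp
      qed
      have "\<bar>b i\<bar> \<le> 1" for i
      proof -
        have "(b i)\<^sup>2 \<le> (\<Sum>j<Suc i. (b j)\<^sup>2)" by (simp add: sum_nonneg)
        also have "\<dots> \<le> 1" by (rule ble)
        finally show ?thesis by (simp add: abs_square_le_1)
      qed
      moreover have "(\<Sum>i<n. a i * V (r i) \<omega>) = (\<Sum>i<n. b i * V (r i) \<omega>)" for \<omega>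
        by (intro sum.cong) (auto simp: b_def)
      ultimately show "c0 / (2 * m) \<le> (\<integral>\<omega>. \<bar>\<Sum>i<n. a i * V (r i) \<omega>\<bar> \<partial>M)"
        "(\<integral>\<omega>. (\<Sum>i<n. a i * V (r i) \<omega>)\<^sup>2 \<partial>M) \<le> B + 4"
        using bounds[OF _ b1 ble] by auto
    qed
  qed
qed

section \<open>Khinchin's inequality and the square function\<close>

text \<open>A sign pattern is the set of indices with sign +1. Rademacher averages become finite
  sums over a power set, without an auxiliary probability space.\<close>

definition sign_sum :: "nat set \<Rightarrow> (nat \<Rightarrow> real) \<Rightarrow> nat \<Rightarrow> real" where
  "sign_sum T x k = (\<Sum>i<k. (if i \<in> T then 1 else -1) * x i)"

lemma sum_Pow_Suc:
  fixes F :: "nat set \<Rightarrow> real"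
  shows "(\<Sum>T\<in>Pow {..<Suc k}. F T) = (\<Sum>T\<in>Pow {..<k}. F T + F (insert k T))"
proof -
  have "Pow {..<Suc k} = Pow {..<k} \<union> insert k ` Pow {..<k}"
    by (simp add: lessThan_Suc Pow_insert)
  moreover have "inj_on (insert k) (Pow {..<k})"
    by (intro inj_onI) (metis PowD insert_ident lessThan_iff less_irrefl subsetD)
  moreover have "Pow {..<k} \<inter> insert k ` Pow {..<k} = {}" by auto
  ultimately show ?thesis
    by (simp add: sum.union_disjoint sum.reindex sum.distrib)
qed

lemma sign_sum_Suc:
  assumes "T \<in> Pow {..<k}"
  shows "sign_sum T x (Suc k) = sign_sum T x k - x k"
    "sign_sum (insert k T) x (Suc k) = sign_sum T x k + x k"
proof -
  show "sign_sum T x (Suc k) = sign_sum T x k - x k"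
    using assms by (auto simp: sign_sum_def)
  have "(\<Sum>i<k. (if i \<in> insert k T then 1 else -1) * x i) = (\<Sum>i<k. (if i \<in> T then 1 else -1) * x i)"
    by (intro sum.cong) auto
  then show "sign_sum (insert k T) x (Suc k) = sign_sum T x k + x k"
    by (simp add: sign_sum_def)
qed

lemma sign_sum_second_moment: "(\<Sum>T\<in>Pow {..<k}. (sign_sum T x k)\<^sup>2) = 2 ^ k * (\<Sum>i<k. (x i)\<^sup>2)"
proof (induction k)
  case (Suc k)
  have "(\<Sum>T\<in>Pow {..<Suc k}. (sign_sum T x (Suc k))\<^sup>2) = (\<Sum>T\<in>Pow {..<k}. 2 * (sign_sum T x k)\<^sup>2 + 2 * (x k)\<^sup>2)"
    unfolding sum_Pow_Suc
    by (intro sum.cong) (simp_all add: sign_sum_Suc power2_eq_square algebra_simps)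
  also have "\<dots> = 2 * (\<Sum>T\<in>Pow {..<k}. (sign_sum T x k)\<^sup>2) + 2 ^ k * (2 * (x k)\<^sup>2)"
    by (simp add: sum.distrib sum_distrib_left card_Pow)
  finally show ?case by (simp add: Suc.IH algebra_simps)
qed (simp add: sign_sum_def)

lemma sign_sum_fourth_moment: "(\<Sum>T\<in>Pow {..<k}. sign_sum T x k ^ 4) \<le> 2 ^ k * (3 * (\<Sum>i<k. (x i)\<^sup>2)\<^sup>2)"
proof (induction k)
  case (Suc k)
  let ?v = "\<Sum>i<k. (x i)\<^sup>2"
  have step: "(s - y) ^ 4 + (s + y) ^ 4 = 2 * s ^ 4 + (12 * y\<^sup>2) * s\<^sup>2 + 2 * y ^ 4" for s y :: real
    by (simp add: power4_eq_xxxx power2_eq_square algebra_simps)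
  have "(\<Sum>T\<in>Pow {..<Suc k}. sign_sum T x (Suc k) ^ 4) =
      (\<Sum>T\<in>Pow {..<k}. 2 * sign_sum T x k ^ 4 + (12 * (x k)\<^sup>2) * (sign_sum T x k)\<^sup>2 + 2 * x k ^ 4)"
    unfolding sum_Pow_Suc by (intro sum.cong) (simp_all only: sign_sum_Suc step)
  also have "\<dots> = 2 * (\<Sum>T\<in>Pow {..<k}. sign_sum T x k ^ 4)
      + (12 * (x k)\<^sup>2) * (\<Sum>T\<in>Pow {..<k}. (sign_sum T x k)\<^sup>2) + 2 ^ k * (2 * x k ^ 4)"
    by (simp add: sum.distrib sum_distrib_left card_Pow)
  \<comment> \<open>Enlarging 2 x_k^4 to 6 x_k^4 completes the square 6 (v + x_k^2)^2.\<close>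
  also have "\<dots> \<le> 2 * (2 ^ k * (3 * ?v\<^sup>2)) + (12 * (x k)\<^sup>2) * (2 ^ k * ?v) + 2 ^ k * (6 * x k ^ 4)"
    using Suc.IH unfolding sign_sum_second_moment by (intro add_mono mult_left_mono) auto
  also have "\<dots> = 2 ^ Suc k * (3 * (?v + (x k)\<^sup>2)\<^sup>2)"
    by (simp add: power2_sum algebra_simps flip: power_mult)
  finally show ?case by simp
qed (simp add: sign_sum_def)

text \<open>For u <= 1 already u^2 <= u^p, and for u > 1 the left side is negative. A p-th moment
  can thus be bounded below from second and fourth moments without interpolation by Hoelder.\<close>

lemma powr_ge_quadratic_minus_quartic:
  fixes u p :: real
  assumes "0 \<le> u" "0 \<le> p" "p \<le> 2"
  shows "u\<^sup>2 - u ^ 4 \<le> u powr p"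
proof (cases "u \<le> 1")
  case True
  show ?thesis
  proof (cases "u = 0")
    case False
    then have "u powr 2 \<le> u powr p" using True assms by (intro powr_mono') auto
    then have "u\<^sup>2 \<le> u powr p" using False assms by simp
    then show ?thesis by (smt (verit) zero_le_even_power even_numeral)
  qed simp
next
  case False
  then have "u ^ 2 \<le> u ^ 4" by (intro power_increasing) auto
  then show ?thesis by (smt (verit) powr_ge_zero)
qed

lemma khinchin_lower_bound:
  fixes x :: "nat \<Rightarrow> real"
  assumes p: "0 < p" "p \<le> 2"
  shows "2 ^ k * (\<Sum>i<k. (x i)\<^sup>2) powr (p / 2) \<le> 12 * (\<Sum>T\<in>Pow {..<k}. \<bar>sign_sum T x k\<bar> powr p)"
proof -
  define v where "v = (\<Sum>i<k. (x i)\<^sup>2)"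
  have "0 \<le> v" by (simp add: v_def sum_nonneg)
  show ?thesis
  proof (cases "v = 0")
    case True
    then show ?thesis unfolding v_def[symmetric] using p by (simp add: sum_nonneg)
  next
    case False
    then have v: "0 < v" using \<open>0 \<le> v\<close> by simp
    \<comment> \<open>With the moments v and at most 3 v^2, the scaled lower bound is t^2 v - 3 t^4
      v^2. It is largest at t^2 = 1 / (6 v), with value 1 / 12, the origin of the constant
      12.\<close>
    define t where "t = 1 / sqrt (6 * v)"
    have t: "0 < t" using v by (simp add: t_def)
    have t2: "t\<^sup>2 = 1 / (6 * v)" using v by (simp add: t_def power_divide)
    have "t ^ 4 = (t\<^sup>2)\<^sup>2" by simp
    then have t4: "t ^ 4 = 1 / (36 * v\<^sup>2)"
      unfolding t2 by (simp add: power_divide power_mult_distrib)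
    have "2 ^ k / 12 = t\<^sup>2 * (2 ^ k * v) - t ^ 4 * (2 ^ k * (3 * v\<^sup>2))"
      unfolding t2 t4 using v by simp
    also have "\<dots> \<le> t\<^sup>2 * (\<Sum>T\<in>Pow {..<k}. (sign_sum T x k)\<^sup>2) - t ^ 4 * (\<Sum>T\<in>Pow {..<k}. sign_sum T x k ^ 4)"
      using sign_sum_second_moment[of x k] sign_sum_fourth_moment[of x k]
      by (intro diff_mono mult_left_mono) (auto simp: v_def)
    also have "\<dots> = (\<Sum>T\<in>Pow {..<k}. (t * \<bar>sign_sum T x k\<bar>)\<^sup>2 - (t * \<bar>sign_sum T x k\<bar>) ^ 4)"
      by (simp add: sum_subtractf sum_distrib_left power_mult_distrib)
    also have "\<dots> \<le> (\<Sum>T\<in>Pow {..<k}. (t * \<bar>sign_sum T x k\<bar>) powr p)"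
      using t p by (intro sum_mono powr_ge_quadratic_minus_quartic) auto
    also have "\<dots> = t powr p * (\<Sum>T\<in>Pow {..<k}. \<bar>sign_sum T x k\<bar> powr p)"
      using t by (simp add: powr_mult sum_distrib_left)
    finally have low: "2 ^ k / 12 \<le> t powr p * (\<Sum>T\<in>Pow {..<k}. \<bar>sign_sum T x k\<bar> powr p)" .
    have "t powr p = (6 * v) powr (- (p / 2))"
      using v by (simp add: t_def powr_half_sqrt[symmetric] powr_minus_divide[symmetric] powr_powr)
    then have inv: "t powr p * (6 * v) powr (p / 2) = 1"
      using v by (simp flip: powr_add)
    have "2 ^ k * v powr (p / 2) \<le> 2 ^ k * (6 * v) powr (p / 2)"
      using v p by (intro mult_left_mono powr_mono2) auto
    also have "\<dots> = 12 * ((2 ^ k / 12) * (6 * v) powr (p / 2))" by simp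
    also have "\<dots> \<le> 12 * ((t powr p * (\<Sum>T\<in>Pow {..<k}. \<bar>sign_sum T x k\<bar> powr p)) * (6 * v) powr (p / 2))"
      using low by (intro mult_left_mono mult_right_mono) auto
    also have "\<dots> = 12 * (\<Sum>T\<in>Pow {..<k}. \<bar>sign_sum T x k\<bar> powr p) * (t powr p * (6 * v) powr (p / 2))"
      by (simp only: mult_ac)
    finally show ?thesis unfolding inv by (simp add: v_def)
  qed
qed

section \<open>Square functions under an upper l2 estimate\<close>

lemma in_Lp_add:
  assumes "in_Lp M p f" "in_Lp M p g" "0 \<le> p"
  shows "in_Lp M p (\<lambda>\<omega>. f \<omega> + g \<omega>)"
proof -
  have [measurable]: "f \<in> borel_measurable M" "g \<in> borel_measurable M" using assms by (auto simp: in_Lp_def)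
  have "integrable M (\<lambda>\<omega>. \<bar>f \<omega> + g \<omega>\<bar> powr p)"
  proof (rule Bochner_Integration.integrable_bound)
    show "integrable M (\<lambda>\<omega>. 2 powr p * (\<bar>f \<omega>\<bar> powr p + \<bar>g \<omega>\<bar> powr p))"
      using assms by (simp add: in_Lp_def)
    show "AE \<omega> in M. norm (\<bar>f \<omega> + g \<omega>\<bar> powr p) \<le> norm (2 powr p * (\<bar>f \<omega>\<bar> powr p + \<bar>g \<omega>\<bar> powr p))"
    proof (rule AE_I2)
      fix \<omega>
      have "\<bar>f \<omega> + g \<omega>\<bar> powr p \<le> (\<bar>f \<omega>\<bar> + \<bar>g \<omega>\<bar>) powr p" using assms by (intro powr_mono2) auto
      also have "\<dots> \<le> 2 powr p * (\<bar>f \<omega>\<bar> powr p + \<bar>g \<omega>\<bar> powr p)" using assms by (intro powr_add_le) auto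
      finally show "norm (\<bar>f \<omega> + g \<omega>\<bar> powr p) \<le> norm (2 powr p * (\<bar>f \<omega>\<bar> powr p + \<bar>g \<omega>\<bar> powr p))" by simp
    qed
  qed simp
  then show ?thesis by (simp add: in_Lp_def)
qed

lemma in_Lp_scale: "in_Lp M p f \<Longrightarrow> in_Lp M p (\<lambda>\<omega>. c * f \<omega>)"
  by (auto simp: in_Lp_def abs_mult powr_mult)

lemma in_Lp_lincomb:
  "(\<And>i. in_Lp M p (Y i)) \<Longrightarrow> 0 \<le> p \<Longrightarrow> in_Lp M p (\<lambda>\<omega>. \<Sum>i<(n::nat). a i * Y i \<omega>)"
proof (induction n)
  case 0
  then show ?case by (simp add: in_Lp_def)
next
  case (Suc n)
  then show ?case using in_Lp_add[of M p "\<lambda>\<omega>. \<Sum>i<n. a i * Y i \<omega>" "\<lambda>\<omega>. a n * Y n \<omega>"] in_Lp_scale[of M p "Y n" "a n"] by auto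
qed

lemma integral_powr_eq_Lp_norm: "0 < p \<Longrightarrow> (\<integral>\<omega>. \<bar>f \<omega>\<bar> powr p \<partial>M) = Lp_norm M p f powr p"
  by (simp add: Lp_norm_def powr_powr integral_nonneg_AE)

text \<open>K is a parameter and not bound by a quantifier: a different further subsequence will be
  taken for every truncation level, and all of them must share the constant.\<close>

definition l2_upper :: "'a measure \<Rightarrow> real \<Rightarrow> real \<Rightarrow> (nat \<Rightarrow> 'a \<Rightarrow> real) \<Rightarrow> bool" where
  "l2_upper M p K Y \<longleftrightarrow> (\<forall>n (a :: nat \<Rightarrow> real). Lp_norm M p (\<lambda>\<omega>. \<Sum>i<n. a i * Y i \<omega>) \<le> K * sqrt (\<Sum>i<n. (a i)\<^sup>2))"

text \<open>A combination along the subsequence is a combination of the whole sequence with zero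
  coefficients off the range of s, and both sums ignore the zeros.\<close>

lemma l2_upper_subseq:
  assumes "l2_upper M p K Y" and s: "strict_mono s"
  shows "l2_upper M p K (\<lambda>k. Y (s k))"
  unfolding l2_upper_def
proof (intro allI)
  fix n and a :: "nat \<Rightarrow> real"
  define b where "b i = (if i \<in> s ` {..<n} then a (inv_into {..<n} s i) else 0)" for i
  have inj: "inj_on s {..<n}" using s by (simp add: strict_mono_imp_inj_on inj_on_subset)
  have b: "b (s j) = a j" if "j < n" for j using that inj by (simp add: b_def)
  have reindex: "(\<Sum>i<s n. h (b i) i) = (\<Sum>j<n. h (a j) (s j))" if "\<And>i. h 0 i = 0" for h :: "real \<Rightarrow> nat \<Rightarrow> real"
  proof -
    have "(\<Sum>i<s n. h (b i) i) = (\<Sum>i\<in>s ` {..<n}. h (b i) i)"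
      using s that by (intro sum.mono_neutral_right) (auto simp: b_def strict_mono_less)
    also have "\<dots> = (\<Sum>j<n. h (a j) (s j))" using inj b by (simp add: sum.reindex)
    finally show ?thesis .
  qed
  have "Lp_norm M p (\<lambda>\<omega>. \<Sum>i<s n. b i * Y i \<omega>) \<le> K * sqrt (\<Sum>i<s n. (b i)\<^sup>2)"
    using assms(1) by (simp add: l2_upper_def)
  moreover have "(\<Sum>i<s n. b i * Y i \<omega>) = (\<Sum>j<n. a j * Y (s j) \<omega>)" for \<omega>
    by (rule reindex[of "\<lambda>c i. c * Y i \<omega>"]) simp
  moreover have "(\<Sum>i<s n. (b i)\<^sup>2) = (\<Sum>j<n. (a j)\<^sup>2)"
    by (rule reindex[of "\<lambda>c i. c\<^sup>2"]) simp
  ultimately show "Lp_norm M p (\<lambda>\<omega>. \<Sum>j<n. a j * Y (s j) \<omega>) \<le> K * sqrt (\<Sum>j<n. (a j)\<^sup>2)" by simp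
qed

text \<open>Khinchin is applied at each omega and then integrated. Every sign pattern is a
  coefficient vector of l2 norm sqrt k, so all patterns obey the same bound.\<close>

lemma l2_upper_square_function:
  assumes up: "l2_upper M p K Y" and Y: "\<And>i. in_Lp M p (Y i)" and p: "0 < p" "p \<le> 2" and K: "0 \<le> K"
  shows "integrable M (\<lambda>\<omega>. (\<Sum>i<k. (Y i \<omega>)\<^sup>2) powr (p / 2))" (is ?int)
    and "(\<integral>\<omega>. (\<Sum>i<k. (Y i \<omega>)\<^sup>2) powr (p / 2) \<partial>M) \<le> 12 * K powr p * real k powr (p / 2)" (is ?le)
proof -
  have [measurable]: "Y i \<in> borel_measurable M" for i using Y by (simp add: in_Lp_def)
  have intT: "integrable M (\<lambda>\<omega>. \<bar>sign_sum T (\<lambda>i. Y i \<omega>) k\<bar> powr p)" for T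
    using in_Lp_lincomb[of M p Y "\<lambda>i. if i \<in> T then 1 else -1" k] Y p by (simp add: in_Lp_def sign_sum_def)
  have leT: "(\<integral>\<omega>. \<bar>sign_sum T (\<lambda>i. Y i \<omega>) k\<bar> powr p \<partial>M) \<le> K powr p * real k powr (p / 2)" for T
  proof -
    have "(\<integral>\<omega>. \<bar>sign_sum T (\<lambda>i. Y i \<omega>) k\<bar> powr p \<partial>M) = Lp_norm M p (\<lambda>\<omega>. sign_sum T (\<lambda>i. Y i \<omega>) k) powr p"
      by (rule integral_powr_eq_Lp_norm) (rule p)
    also have "\<dots> \<le> (K * sqrt (\<Sum>i<k. (if i \<in> T then 1 else -1)\<^sup>2)) powr p"
      using up p unfolding l2_upper_def sign_sum_def by (intro powr_mono2) (auto simp: Lp_norm_def)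
    also have "(\<Sum>i<k. (if i \<in> T then 1 else -1)\<^sup>2) = real k"
      by (simp add: if_distrib[of "\<lambda>x. x\<^sup>2"] cong: if_cong)
    also have "(K * sqrt (real k)) powr p = K powr p * real k powr (p / 2)"
      using K by (simp add: powr_mult powr_half_sqrt[symmetric] powr_powr)
    finally show ?thesis .
  qed
  let ?R = "\<lambda>\<omega>. (12 / 2 ^ k) * (\<Sum>T\<in>Pow {..<k}. \<bar>sign_sum T (\<lambda>i. Y i \<omega>) k\<bar> powr p)"
  have le: "(\<Sum>i<k. (Y i \<omega>)\<^sup>2) powr (p / 2) \<le> ?R \<omega>" for \<omega>
    using khinchin_lower_bound[OF p, of k "\<lambda>i. Y i \<omega>"] by (simp add: field_simps)
  have R: "integrable M ?R" by (intro integrable_mult_right Bochner_Integration.integrable_sum intT)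
  show ?int
  proof (rule Bochner_Integration.integrable_bound[OF R])
    have "norm ((\<Sum>i<k. (Y i \<omega>)\<^sup>2) powr (p / 2)) \<le> norm (?R \<omega>)" for \<omega>
      unfolding real_norm_def using le[of \<omega>] by (simp only: abs_of_nonneg powr_ge_zero)
    then show "AE \<omega> in M. norm ((\<Sum>i<k. (Y i \<omega>)\<^sup>2) powr (p / 2)) \<le> norm (?R \<omega>)" by (intro AE_I2)
  qed simp
  then have "(\<integral>\<omega>. (\<Sum>i<k. (Y i \<omega>)\<^sup>2) powr (p / 2) \<partial>M) \<le> (\<integral>\<omega>. ?R \<omega> \<partial>M)"
    using R le by (intro integral_mono) auto
  also have "\<dots> = (12 / 2 ^ k) * (\<Sum>T\<in>Pow {..<k}. \<integral>\<omega>. \<bar>sign_sum T (\<lambda>i. Y i \<omega>) k\<bar> powr p \<partial>M)"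
    using intT by simp
  also have "\<dots> \<le> (12 / 2 ^ k) * (\<Sum>T\<in>Pow {..<k}. K powr p * real k powr (p / 2))"
    by (intro mult_left_mono sum_mono leT) auto
  also have "\<dots> = 12 * K powr p * real k powr (p / 2)" by (simp add: card_Pow)
  finally show ?le .
qed

section \<open>The upper estimate bounds the limit variance\<close>

lemma weakly_null_subseq: "weakly_null N V \<Longrightarrow> strict_mono s \<Longrightarrow> weakly_null N (\<lambda>k. V (s k))"
  unfolding weakly_null_def
  using LIMSEQ_subseq_LIMSEQ[of "\<lambda>n. \<integral>\<omega>. _ \<omega> * V n \<omega> \<partial>N" 0 s] by (auto simp: o_def)

context random_limit
begin

lemma bounded_rv_function:
  fixes f :: "real \<Rightarrow> real"
  assumes "f \<in> borel_measurable borel" "\<And>x. \<bar>f x\<bar> \<le> B"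
  shows "bounded_rv M (\<lambda>\<omega>. f (X n \<omega>))" "bounded_rv M (\<lambda>\<omega>. \<integral>x. f x \<partial>\<mu> \<omega>)"
proof -
  note [measurable] = assms(1)
  show "bounded_rv M (\<lambda>\<omega>. f (X n \<omega>))" using assms(2) by (intro bounded_rvI[where C=B]) auto
  show "bounded_rv M (\<lambda>\<omega>. \<integral>x. f x \<partial>\<mu> \<omega>)"
    by (intro bounded_rvI[where C=B] kernel_integral_bound assms) measurable
qed

lemma weakly_null_centered:
  fixes f :: "real \<Rightarrow> real"
  assumes f: "\<And>x. isCont f x" "\<And>x. \<bar>f x\<bar> \<le> B"
  shows "weakly_null M (\<lambda>n \<omega>. f (X n \<omega>) - (\<integral>x. f x \<partial>\<mu> \<omega>))"
  unfolding weakly_null_def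
proof (intro allI impI)
  fix Z assume Z: "bounded_rv M Z"
  have fm: "f \<in> borel_measurable borel"
    using f(1) by (intro borel_measurable_continuous_onI continuous_at_imp_continuous_on) auto
  note b = bounded_rv_function[OF fm f(2)]
  have int: "integrable M (\<lambda>\<omega>. Z \<omega> * f (X n \<omega>))" "integrable M (\<lambda>\<omega>. Z \<omega> * (\<integral>x. f x \<partial>\<mu> \<omega>))" for n
    by (intro bounded_rv_integrable bounded_rv_intros Z b)+
  have "(\<lambda>n. (\<integral>\<omega>. Z \<omega> * f (X n \<omega>) \<partial>M) - (\<integral>\<omega>. Z \<omega> * (\<integral>x. f x \<partial>\<mu> \<omega>) \<partial>M)) \<longlonglongrightarrow> 0"
    using stable_convergence[OF f bounded_rv_integrable[OF Z]] by (simp add: LIM_zero_iff)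
  then show "(\<lambda>n. \<integral>\<omega>. Z \<omega> * (f (X n \<omega>) - (\<integral>x. f x \<partial>\<mu> \<omega>)) \<partial>M) \<longlonglongrightarrow> 0"
    using int by (simp add: right_diff_distrib)
qed

text \<open>The cut is made on x^2, which keeps the integrand bounded and continuous. At level L^2
  this is the second moment of \<open>clamp_to L\<close> under the kernel.\<close>

definition trunc_var :: "real \<Rightarrow> 'a \<Rightarrow> real" where
  "trunc_var L \<omega> = (\<integral>x. min (x\<^sup>2) L \<partial>\<mu> \<omega>)"

definition limit_var :: "'a \<Rightarrow> ennreal" where
  "limit_var \<omega> = (\<integral>\<^sup>+x. ennreal (x\<^sup>2) \<partial>\<mu> \<omega>)"

lemma trunc_var_measurable [measurable]: "trunc_var L \<in> borel_measurable M"
  unfolding trunc_var_def[abs_def] by measurable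

lemma limit_var_measurable [measurable]: "limit_var \<in> borel_measurable M"
  unfolding limit_var_def[abs_def] by measurable

lemma ennreal_trunc_var:
  assumes "\<omega> \<in> space M" "0 \<le> L"
  shows "ennreal (trunc_var L \<omega>) = (\<integral>\<^sup>+x. ennreal (min (x\<^sup>2) L) \<partial>\<mu> \<omega>)"
  unfolding trunc_var_def using assms
  by (intro nn_integral_eq_integral[symmetric] kernel_integrable[where B=L]) auto

lemma trunc_var_nonneg: "0 \<le> L \<Longrightarrow> 0 \<le> trunc_var L \<omega>"
  unfolding trunc_var_def by (intro integral_nonneg_AE) auto

lemma trunc_var_mono: "\<omega> \<in> space M \<Longrightarrow> 0 \<le> L \<Longrightarrow> L \<le> L' \<Longrightarrow> trunc_var L \<omega> \<le> trunc_var L' \<omega>"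
  unfolding trunc_var_def
  by (intro integral_mono kernel_integrable[where B=L'] kernel_integrable[where B=L]) auto

lemma trunc_var_le_limit_var:
  assumes "\<omega> \<in> space M" "0 \<le> L"
  shows "ennreal (trunc_var L \<omega>) \<le> limit_var \<omega>"
  unfolding ennreal_trunc_var[OF assms] limit_var_def
  using assms by (intro nn_integral_mono ennreal_leI) auto

lemma limit_var_le:
  assumes \<omega>: "\<omega> \<in> space M" and le: "\<And>n::nat. trunc_var (real n) \<omega> \<le> c"
  shows "limit_var \<omega> \<le> ennreal c"
proof -
  have sup: "(SUP n::nat. ennreal (min (x\<^sup>2) (real n))) = ennreal (x\<^sup>2)" for x :: real
  proof (rule antisym)
    obtain n :: nat where "x\<^sup>2 \<le> real n" using real_arch_simple by blast
    then show "ennreal (x\<^sup>2) \<le> (SUP n::nat. ennreal (min (x\<^sup>2) (real n)))"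
      by (intro SUP_upper2[of n]) auto
  qed (auto intro!: SUP_least ennreal_leI)
  have meas: "measurable (\<mu> \<omega>) borel = (borel_measurable borel :: (real \<Rightarrow> ennreal) set)"
    using kernel_at(2)[OF \<omega>] by (rule measurable_cong_sets) simp
  have "limit_var \<omega> = (\<integral>\<^sup>+x. (SUP n::nat. ennreal (min (x\<^sup>2) (real n))) \<partial>\<mu> \<omega>)"
    unfolding limit_var_def sup ..
  also have "\<dots> = (SUP n::nat. \<integral>\<^sup>+x. ennreal (min (x\<^sup>2) (real n)) \<partial>\<mu> \<omega>)"
    by (rule nn_integral_monotone_convergence_SUP)
      (auto simp: meas incseq_def le_fun_def intro!: ennreal_leI)
  also have "\<dots> \<le> ennreal c"
    using le by (intro SUP_least) (simp add: ennreal_trunc_var[OF \<omega>, symmetric] ennreal_leI)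
  finally show ?thesis .
qed

text \<open>Along an almost orthogonal further subsequence, \<open>trunc_var L\<close> is an average
  G of the truncated squares minus an average D of their centred versions. D is small in L2 by
  orthogonality; G is at most the averaged square function, whose p/2-th moment is bounded because
  the factor k^(p/2) cancels. The right side is independent of L, the form that a passage to L =
  infinity requires.\<close>

lemma trunc_var_moment_bound:
  assumes up: "l2_upper M p K (\<lambda>k. X (s k))" and s: "strict_mono s"
    and X: "\<And>n. in_Lp M p (X n)" and p: "0 < p" "p \<le> 2" and K: "0 \<le> K" and L: "0 \<le> L"
  shows "(\<integral>\<omega>. trunc_var L \<omega> powr (p / 2) \<partial>M) \<le> 24 * K powr p + 4"
proof -
  define f where "f x = min (x\<^sup>2) L" for x :: real
  have f: "\<And>x. isCont f x" "\<And>x. \<bar>f x\<bar> \<le> L"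
    unfolding f_def by (intro continuous_intros, use L in auto)
  have fm [measurable]: "f \<in> borel_measurable borel" unfolding f_def by measurable
  note bf = bounded_rv_function[OF fm f(2)]
  define h where "h k \<omega> = f (X (s k) \<omega>) - trunc_var L \<omega>" for k \<omega>
  have h: "bounded_rv M (h k)" for k
    using bounded_rv_add[OF bf(1)[of "s k"] bounded_rv_mult[OF bounded_rv_const[of M "-1"] bf(2)]]
    by (simp add: h_def[abs_def] f_def trunc_var_def)
  have wh: "weakly_null M h"
    using weakly_null_subseq[OF weakly_null_centered[OF f] s] by (simp add: h_def[abs_def] trunc_var_def f_def)
  obtain r where r: "strict_mono r"
    and orth: "\<And>k. (\<Sum>i<k. \<bar>\<integral>\<omega>. h (r i) \<omega> * h (r k) \<omega> \<partial>M\<bar>) \<le> 1 * (1/2) ^ k"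
    by (rule almost_orthogonal_subsequence[OF h h wh wh zero_less_one], rule that)
  have h2: "(\<integral>\<omega>. (h k \<omega>)\<^sup>2 \<partial>M) \<le> (2 * L)\<^sup>2" for k
  proof -
    have "(h k \<omega>)\<^sup>2 \<le> (2 * L)\<^sup>2" if "\<omega> \<in> space M" for \<omega>
    proof -
      have "h k \<omega> = f (X (s k) \<omega>) - (\<integral>x. f x \<partial>\<mu> \<omega>)" by (simp add: h_def trunc_var_def f_def)
      then have "\<bar>h k \<omega>\<bar> \<le> 2 * L"
        using f(2)[of "X (s k) \<omega>"] kernel_integral_bound[OF that f(2) fm] by linarith
      then show ?thesis using L by (subst power2_le_iff_abs_le) auto
    qed
    then have "(\<integral>\<omega>. (h k \<omega>)\<^sup>2 \<partial>M) \<le> (\<integral>\<omega>. (2 * L)\<^sup>2 \<partial>M)"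
      by (intro integral_mono bounded_rv_integrable bounded_rv_intros h) auto
    then show ?thesis by (simp add: prob_space)
  qed
  \<comment> \<open>Chosen so that the second moment of D, at most ((2 L)^2 k + 4) / k^2, is at most
    1.\<close>
  obtain k :: nat where k: "(2 * L)\<^sup>2 + 4 \<le> real k" using real_arch_simple by blast
  have k1: "1 \<le> real k" using k by (smt (verit) zero_le_power2)
  define G where "G \<omega> = (\<Sum>i<k. f (X (s (r i)) \<omega>)) / real k" for \<omega>
  define D where "D \<omega> = (\<Sum>i<k. h (r i) \<omega>) / real k" for \<omega>
  have G0: "0 \<le> G \<omega>" for \<omega> unfolding G_def using L by (intro divide_nonneg_nonneg sum_nonneg) (auto simp: f_def)
  have GD: "trunc_var L \<omega> = G \<omega> - D \<omega>" for \<omega>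
    using k1 by (simp add: G_def D_def h_def sum_subtractf diff_divide_distrib)
  have bG: "bounded_rv M G" and bD: "bounded_rv M D"
    unfolding G_def D_def divide_inverse by (intro bounded_rv_intros bf h)+
  have Dint: "(\<integral>\<omega>. (D \<omega>)\<^sup>2 \<partial>M) \<le> 1"
  proof -
    have "(\<integral>\<omega>. (\<Sum>i<k. 1 * h (r i) \<omega>)\<^sup>2 \<partial>M) \<le> (2 * L)\<^sup>2 * (\<Sum>i<k. 1\<^sup>2) + 2 * 1 * (\<Sum>i<k. (1/2) ^ i)"
      by (rule almost_orthogonal_square_bound) (use h h2 orth in auto)
    also have "\<dots> \<le> (2 * L)\<^sup>2 * real k + 4 * real k"
      using sum_geometric_half[of k] k1 by simp
    also have "\<dots> \<le> (real k)\<^sup>2"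
      using k k1 mult_right_mono[OF k, of "real k"] by (simp add: power2_eq_square algebra_simps)
    finally have "(\<integral>\<omega>. (\<Sum>i<k. h (r i) \<omega>)\<^sup>2 \<partial>M) \<le> (real k)\<^sup>2" by simp
    then show ?thesis using k1 by (simp add: D_def power_divide)
  qed
  let ?q = "p / 2"
  let ?sq = "\<lambda>\<omega>. (\<Sum>i<k. (X (s (r i)) \<omega>)\<^sup>2) powr ?q"
  have sq: "integrable M ?sq" "(\<integral>\<omega>. ?sq \<omega> \<partial>M) \<le> 12 * K powr p * real k powr ?q"
    using l2_upper_square_function[OF l2_upper_subseq[OF up r] _ p K] X by auto
  have pointwise: "trunc_var L \<omega> powr ?q \<le> 2 * (?sq \<omega> / real k powr ?q) + 2 * (1 + (D \<omega>)\<^sup>2)" for \<omega>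
  proof -
    have "trunc_var L \<omega> powr ?q \<le> (G \<omega> + \<bar>D \<omega>\<bar>) powr ?q"
      using trunc_var_nonneg[OF L, of \<omega>] p by (intro powr_mono2) (auto simp: GD)
    also have "\<dots> \<le> 2 powr ?q * (G \<omega> powr ?q + \<bar>D \<omega>\<bar> powr ?q)"
      using G0 p by (intro powr_add_le) auto
    also have "\<dots> \<le> 2 * (?sq \<omega> / real k powr ?q + (1 + (D \<omega>)\<^sup>2))"
    proof (rule mult_mono)
      show "2 powr ?q \<le> (2::real)" using powr_mono[of ?q 1 "2::real"] p by simp
      have "G \<omega> powr ?q \<le> ((\<Sum>i<k. (X (s (r i)) \<omega>)\<^sup>2) / real k) powr ?q"
        using G0 p unfolding G_def by (intro powr_mono2 divide_right_mono sum_mono) (auto simp: f_def)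
      then have "G \<omega> powr ?q \<le> ?sq \<omega> / real k powr ?q" by (simp add: powr_divide sum_nonneg)
      moreover have "\<bar>D \<omega>\<bar> powr ?q \<le> 1 + (D \<omega>)\<^sup>2"
      proof (cases "\<bar>D \<omega>\<bar> \<le> 1")
        case True
        then have "\<bar>D \<omega>\<bar> powr ?q \<le> 1 powr ?q" using p by (intro powr_mono2) auto
        then show ?thesis by (smt (verit) powr_one_eq_one zero_le_power2)
      next
        case False
        then have "\<bar>D \<omega>\<bar> powr ?q \<le> \<bar>D \<omega>\<bar> powr 2" using p by (intro powr_mono) auto
        also have "\<dots> = (D \<omega>)\<^sup>2" using False by simp
        finally show ?thesis by simp
      qed
      ultimately show "G \<omega> powr ?q + \<bar>D \<omega>\<bar> powr ?q \<le> ?sq \<omega> / real k powr ?q + (1 + (D \<omega>)\<^sup>2)" by linarith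
    qed auto
    finally show ?thesis by simp
  qed
  have D2: "integrable M (\<lambda>\<omega>. (D \<omega>)\<^sup>2)" by (intro bounded_rv_integrable bounded_rv_intros bD)
  have tv: "integrable M (\<lambda>\<omega>. trunc_var L \<omega> powr ?q)"
  proof (rule integrable_const_bound[where B="L powr ?q"])
    show "AE \<omega> in M. norm (trunc_var L \<omega> powr ?q) \<le> L powr ?q"
    proof (rule AE_I2)
      fix \<omega> assume "\<omega> \<in> space M"
      then have "trunc_var L \<omega> \<le> L"
        using kernel_integral_bound[OF _ f(2) fm, of \<omega>] by (auto simp: trunc_var_def f_def)
      then show "norm (trunc_var L \<omega> powr ?q) \<le> L powr ?q"
        using trunc_var_nonneg[OF L, of \<omega>] p by (auto intro: powr_mono2)
    qed
  qed simp
  have "(\<integral>\<omega>. trunc_var L \<omega> powr ?q \<partial>M) \<le> (\<integral>\<omega>. 2 * (?sq \<omega> / real k powr ?q) + 2 * (1 + (D \<omega>)\<^sup>2) \<partial>M)"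
    using pointwise sq D2 tv by (intro integral_mono) auto
  also have "\<dots> = 2 * ((\<integral>\<omega>. ?sq \<omega> \<partial>M) / real k powr ?q) + 2 * (1 + (\<integral>\<omega>. (D \<omega>)\<^sup>2 \<partial>M))"
    using sq D2 by (simp add: prob_space)
  also have "\<dots> \<le> 2 * ((12 * K powr p * real k powr ?q) / real k powr ?q) + 2 * (1 + 1)"
    using sq(2) Dint by (intro add_mono mult_left_mono divide_right_mono) auto
  also have "\<dots> = 24 * K powr p + 4" using k1 by simp
  finally show ?thesis .
qed

text \<open>Monotone convergence in L. Finiteness is a conclusion of its own because
  \<open>enn2real\<close> sends infinity to 0: integrability alone would also hold for a variance
  that is infinite everywhere.\<close>

lemma limit_var_integrable_if_l2_upper:
  assumes up: "l2_upper M p K (\<lambda>k. X (s k))" and s: "strict_mono s"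
    and X: "\<And>n. in_Lp M p (X n)" and p: "0 < p" "p \<le> 2" and K: "0 \<le> K"
  shows "AE \<omega> in M. limit_var \<omega> < \<infinity>"
    and "integrable M (\<lambda>\<omega>. enn2real (limit_var \<omega>) powr (p / 2))"
proof -
  let ?q = "p / 2"
  \<comment> \<open>The supremum of the powers is finite almost everywhere. Where F equals a real c,
    all truncated variances stay below c^(2/p), and so does the full variance.\<close>
  define F where "F \<omega> = (SUP n::nat. ennreal (trunc_var (real n) \<omega> powr ?q))" for \<omega>
  have Fm [measurable]: "F \<in> borel_measurable M" unfolding F_def by measurable
  have "(\<integral>\<^sup>+\<omega>. F \<omega> \<partial>M) = (SUP n::nat. \<integral>\<^sup>+\<omega>. ennreal (trunc_var (real n) \<omega> powr ?q) \<partial>M)"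
    unfolding F_def
    by (rule nn_integral_monotone_convergence_SUP_AE)
      (use p in \<open>auto intro!: ennreal_leI powr_mono2 trunc_var_mono trunc_var_nonneg\<close>)
  also have "\<dots> \<le> ennreal (24 * K powr p + 4)"
  proof (rule SUP_least)
    fix n :: nat
    have b: "bounded_rv M (trunc_var (real n))"
      using bounded_rv_function(2)[of "\<lambda>x. min (x\<^sup>2) (real n)" "real n"] by (simp add: trunc_var_def[abs_def])
    then obtain C where C: "\<And>\<omega>. \<omega> \<in> space M \<Longrightarrow> \<bar>trunc_var (real n) \<omega>\<bar> \<le> C"
      by (auto simp: bounded_rv_def)
    have "integrable M (\<lambda>\<omega>. trunc_var (real n) \<omega> powr ?q)"
    proof (rule integrable_const_bound[where B="C powr ?q"])
      show "AE \<omega> in M. norm (trunc_var (real n) \<omega> powr ?q) \<le> C powr ?q"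
      proof (rule AE_I2)
        fix \<omega> assume "\<omega> \<in> space M"
        then have "trunc_var (real n) \<omega> \<le> C" using C[of \<omega>] by linarith
        then show "norm (trunc_var (real n) \<omega> powr ?q) \<le> C powr ?q"
          using trunc_var_nonneg[of "real n" \<omega>] p by (auto intro: powr_mono2)
      qed
    qed simp
    then have "(\<integral>\<^sup>+\<omega>. ennreal (trunc_var (real n) \<omega> powr ?q) \<partial>M) = ennreal (\<integral>\<omega>. trunc_var (real n) \<omega> powr ?q \<partial>M)"
      by (intro nn_integral_eq_integral) auto
    also have "\<dots> \<le> ennreal (24 * K powr p + 4)"
      by (intro ennreal_leI trunc_var_moment_bound[OF up s X p K]) simp
    finally show "(\<integral>\<^sup>+\<omega>. ennreal (trunc_var (real n) \<omega> powr ?q) \<partial>M) \<le> ennreal (24 * K powr p + 4)" .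
  qed
  finally have F: "(\<integral>\<^sup>+\<omega>. F \<omega> \<partial>M) \<noteq> \<infinity>" by (auto simp: top_unique)
  have bound: "limit_var \<omega> < \<infinity> \<and> enn2real (limit_var \<omega>) powr ?q \<le> enn2real (F \<omega>)"
    if \<omega>: "\<omega> \<in> space M" and fin: "F \<omega> \<noteq> \<infinity>" for \<omega>
  proof -
    define c where "c = enn2real (F \<omega>)"
    have c: "F \<omega> = ennreal c" "0 \<le> c" using fin by (auto simp: c_def less_top)
    have "trunc_var (real n) \<omega> \<le> c powr (1 / ?q)" for n :: nat
    proof -
      have "ennreal (trunc_var (real n) \<omega> powr ?q) \<le> ennreal c"
        unfolding c(1)[symmetric] F_def by (rule SUP_upper) simp
      then have "trunc_var (real n) \<omega> powr ?q \<le> c" using c(2) by simp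
      then have "(trunc_var (real n) \<omega> powr ?q) powr (1 / ?q) \<le> c powr (1 / ?q)"
        using p by (intro powr_mono2) auto
      then show ?thesis using p trunc_var_nonneg[of "real n" \<omega>] by (simp add: powr_powr)
    qed
    then have le: "limit_var \<omega> \<le> ennreal (c powr (1 / ?q))" by (rule limit_var_le[OF \<omega>])
    then have "enn2real (limit_var \<omega>) \<le> c powr (1 / ?q)"
      using enn2real_mono[OF le] by simp
    then have "enn2real (limit_var \<omega>) powr ?q \<le> (c powr (1 / ?q)) powr ?q"
      using p by (intro powr_mono2) auto
    then show ?thesis using le c(2) p by (auto simp: powr_powr c_def intro: le_less_trans)
  qed
  have AEF: "AE \<omega> in M. F \<omega> \<noteq> \<infinity>" by (rule nn_integral_PInf_AE[OF Fm F])
  show "AE \<omega> in M. limit_var \<omega> < \<infinity>" using AEF AE_space by eventually_elim (use bound in blast)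
  show "integrable M (\<lambda>\<omega>. enn2real (limit_var \<omega>) powr ?q)"
  proof (rule integrableI_bounded)
    have "AE \<omega> in M. ennreal (norm (enn2real (limit_var \<omega>) powr ?q)) \<le> F \<omega>"
      using AEF AE_space
    proof eventually_elim
      case (elim \<omega>)
      then have "ennreal (norm (enn2real (limit_var \<omega>) powr ?q)) \<le> ennreal (enn2real (F \<omega>))"
        using bound[of \<omega>] by (intro ennreal_leI) auto
      also have "\<dots> = F \<omega>" using elim by (simp add: less_top)
      finally show ?case .
    qed
    then have "(\<integral>\<^sup>+\<omega>. ennreal (norm (enn2real (limit_var \<omega>) powr ?q)) \<partial>M) \<le> (\<integral>\<^sup>+\<omega>. F \<omega> \<partial>M)"
      by (rule nn_integral_mono_AE)
    then show "(\<integral>\<^sup>+\<omega>. ennreal (norm (enn2real (limit_var \<omega>) powr ?q)) \<partial>M) < \<infinity>"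
      using F by (auto simp: less_top intro: le_less_trans)
  qed simp
qed

end

section \<open>Truncation and the weighted measure\<close>

lemma Lp_norm_scale: "0 < p \<Longrightarrow> Lp_norm M p (\<lambda>\<omega>. c * f \<omega>) = \<bar>c\<bar> * Lp_norm M p f"
  by (simp add: Lp_norm_def abs_mult powr_mult powr_powr)

text \<open>Homogeneity reduces both estimates to unit coefficient vectors; the zero vector, which
  cannot be normalized, is treated apart.\<close>

lemma equiv_l2_basisI:
  assumes p: "0 < p" and lo: "0 < lo"
    and bounds: "\<And>n a. (\<Sum>i<n. (a i)\<^sup>2) = 1 \<Longrightarrow>
      lo \<le> Lp_norm M p (\<lambda>\<omega>. \<Sum>i<n. a i * Y i \<omega>) \<and> Lp_norm M p (\<lambda>\<omega>. \<Sum>i<n. a i * Y i \<omega>) \<le> hi"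
  shows "equiv_l2_basis M p Y"
proof -
  define K where "K = max (1 / lo) hi"
  have Klo: "1 / lo \<le> K" and K3: "hi \<le> K" by (auto simp: K_def)
  have "0 < 1 / lo" using lo by simp
  then have K0: "0 < K" using Klo by linarith
  have "1 / K \<le> lo" using Klo K0 lo by (simp add: field_simps)
  note K = K0 this K3
  have "sqrt (\<Sum>i<n. (a i)\<^sup>2) / K \<le> Lp_norm M p (\<lambda>\<omega>. \<Sum>i<n. a i * Y i \<omega>) \<and>
     Lp_norm M p (\<lambda>\<omega>. \<Sum>i<n. a i * Y i \<omega>) \<le> K * sqrt (\<Sum>i<n. (a i)\<^sup>2)" for n and a :: "nat \<Rightarrow> real"
  proof -
    define N where "N = sqrt (\<Sum>i<n. (a i)\<^sup>2)"
    have N2: "N\<^sup>2 = (\<Sum>i<n. (a i)\<^sup>2)" unfolding N_def by (simp add: sum_nonneg)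
    show ?thesis
    proof (cases "N = 0")
      case True
      then have "\<forall>i\<in>{..<n}. (a i)\<^sup>2 = 0" using N2 by (subst sum_nonneg_eq_0_iff[symmetric]) auto
      then have "(\<lambda>\<omega>. \<Sum>i<n. a i * Y i \<omega>) = (\<lambda>_. 0)" by auto
      then show ?thesis using True p by (simp add: N_def Lp_norm_def)
    next
      case False
      then have N: "0 < N" by (simp add: N_def sum_nonneg less_le)
      define b where "b i = a i / N" for i
      have "(\<Sum>i<n. (b i)\<^sup>2) = 1"
        using False by (simp add: b_def power_divide N2[symmetric] flip: sum_divide_distrib)
      note b = bounds[OF this]
      have "(\<lambda>\<omega>. \<Sum>i<n. a i * Y i \<omega>) = (\<lambda>\<omega>. N * (\<Sum>i<n. b i * Y i \<omega>))"
        using False by (simp add: b_def sum_distrib_left)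
      then have eq: "Lp_norm M p (\<lambda>\<omega>. \<Sum>i<n. a i * Y i \<omega>) = N * Lp_norm M p (\<lambda>\<omega>. \<Sum>i<n. b i * Y i \<omega>)"
        using N p by (simp add: Lp_norm_scale)
      have "N * (1 / K) \<le> N * Lp_norm M p (\<lambda>\<omega>. \<Sum>i<n. b i * Y i \<omega>)"
        "N * Lp_norm M p (\<lambda>\<omega>. \<Sum>i<n. b i * Y i \<omega>) \<le> N * K"
        using b K N by (intro mult_left_mono; linarith)+
      then show ?thesis unfolding eq by (simp add: N_def[symmetric] mult.commute)
    qed
  qed
  then show ?thesis using K(1) unfolding equiv_l2_basis_def by blast
qed

section \<open>Weak nullity, tails and nondegeneracy under the L^p hypotheses\<close>

locale lp_random_limit = random_limit +
  fixes p :: real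
  assumes p1: "1 \<le> p" and p2: "p < 2"
    and Lp: "\<And>n. in_Lp M p (X n)"
    and norm1: "\<And>n. Lp_norm M p (X n) = 1"
    and ui: "uniformly_integrable M (\<lambda>n \<omega>. \<bar>X n \<omega>\<bar> powr p)"
    and weak: "weakly_to_zero_Lp M p X"
begin

lemma abs_le_powr: "1 \<le> x \<Longrightarrow> x \<le> x powr p" for x :: real
  using powr_mono[OF p1, of x] by simp

lemma X_powr_integrable: "integrable M (\<lambda>\<omega>. \<bar>X n \<omega>\<bar> powr p)"
  using Lp by (simp add: in_Lp_def)

lemma X_integrable: "integrable M (X n)"
proof (rule Bochner_Integration.integrable_bound)
  show "integrable M (\<lambda>\<omega>. 1 + \<bar>X n \<omega>\<bar> powr p)" using X_powr_integrable by simp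
  have "\<bar>X n \<omega>\<bar> \<le> 1 + \<bar>X n \<omega>\<bar> powr p" for \<omega>
    using abs_le_powr[of "\<bar>X n \<omega>\<bar>"] powr_ge_zero[of "\<bar>X n \<omega>\<bar>" p] by linarith
  then show "AE \<omega> in M. norm (X n \<omega>) \<le> norm (1 + \<bar>X n \<omega>\<bar> powr p)"
    by (intro AE_I2) (simp add: abs_of_nonneg add_nonneg_nonneg)
qed simp

lemma moment_one: "(\<integral>\<omega>. \<bar>X n \<omega>\<bar> powr p \<partial>M) = 1"
  using integral_powr_eq_Lp_norm[of p M "X n"] norm1 p1 by simp

text \<open>Bounded functions belong to the dual of L^p both for p = 1 and for p > 1, so the two
  cases in the definition of weak convergence are merged here.\<close>

lemma bounded_tendsto_zero:
  assumes Z: "bounded_rv M Z"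
  shows "(\<lambda>n. \<integral>\<omega>. Z \<omega> * X n \<omega> \<partial>M) \<longlonglongrightarrow> 0"
proof -
  obtain C where C: "\<And>\<omega>. \<omega> \<in> space M \<Longrightarrow> \<bar>Z \<omega>\<bar> \<le> C" and [measurable]: "Z \<in> borel_measurable M"
    using Z by (auto simp: bounded_rv_def)
  have "in_dual_Lp M p Z"
  proof (cases "p = 1")
    case True
    then show ?thesis using C by (auto simp: in_dual_Lp_def in_Linf_def intro!: exI[of _ C] AE_I2)
  next
    case False
    let ?q = "p / (p - 1)"
    have "integrable M (\<lambda>\<omega>. \<bar>Z \<omega>\<bar> powr ?q)"
    proof (rule integrable_const_bound[where B="C powr ?q"])
      show "AE \<omega> in M. norm (\<bar>Z \<omega>\<bar> powr ?q) \<le> C powr ?q"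
        using C p1 False by (intro AE_I2) (auto intro!: powr_mono2)
    qed simp
    then show ?thesis using False by (simp add: in_dual_Lp_def in_Lp_def)
  qed
  then show ?thesis using weak by (simp add: weakly_to_zero_Lp_def mult.commute)
qed

definition tail :: "real \<Rightarrow> 'a \<Rightarrow> nat \<Rightarrow> real" where
  "tail L \<omega> n = (if L \<le> \<bar>X n \<omega>\<bar> then \<bar>X n \<omega>\<bar> powr p else 0)"

lemma tail_measurable [measurable]: "(\<lambda>\<omega>. tail L \<omega> n) \<in> borel_measurable M"
  unfolding tail_def by measurable

lemma tail_integrable: "integrable M (\<lambda>\<omega>. tail L \<omega> n)"
  by (rule Bochner_Integration.integrable_bound[OF X_powr_integrable]) (auto simp: tail_def)

text \<open>Uniform integrability cuts where |X n|^p >= K, whereas \<open>tail\<close> cuts where |X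
  n| >= L. With L = max 1 K the second event lies in the first, because |x| <= |x|^p once |x| >=
  1.\<close>

lemma tail_small:
  assumes "0 < e"
  obtains L where "1 \<le> L" "\<And>n. (\<integral>\<omega>. tail L \<omega> n \<partial>M) < e"
proof -
  obtain K where K: "\<And>n. (\<integral>\<omega>. indicator {\<omega>. \<bar>\<bar>X n \<omega>\<bar> powr p\<bar> \<ge> K} \<omega> * \<bar>\<bar>X n \<omega>\<bar> powr p\<bar> \<partial>M) < e"
    using ui assms unfolding uniformly_integrable_def by blast
  have "(\<integral>\<omega>. tail (max 1 K) \<omega> n \<partial>M) < e" for n
  proof -
    let ?I = "\<lambda>\<omega>. if K \<le> \<bar>X n \<omega>\<bar> powr p then \<bar>X n \<omega>\<bar> powr p else 0"
    have "integrable M ?I"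
      by (rule Bochner_Integration.integrable_bound[OF X_powr_integrable[of n]]) auto
    moreover have "tail (max 1 K) \<omega> n \<le> ?I \<omega>" for \<omega>
      using abs_le_powr[of "\<bar>X n \<omega>\<bar>"] by (auto simp: tail_def)
    ultimately have "(\<integral>\<omega>. tail (max 1 K) \<omega> n \<partial>M) \<le> (\<integral>\<omega>. ?I \<omega> \<partial>M)"
      by (intro integral_mono tail_integrable) auto
    also have "\<dots> = (\<integral>\<omega>. indicator {\<omega>. \<bar>\<bar>X n \<omega>\<bar> powr p\<bar> \<ge> K} \<omega> * \<bar>\<bar>X n \<omega>\<bar> powr p\<bar> \<partial>M)"
      by (intro Bochner_Integration.integral_cong) auto
    finally show ?thesis using K[of n] by linarith
  qed
  then show thesis using that[of "max 1 K"] by simp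
qed

text \<open>The remainder vanishes below L, and beyond L >= 1 one has |x| <= |x|^p; so a single tail
  controls the remainder in L1 and in L^p.\<close>

lemma remainder_le_tail:
  assumes "1 \<le> L"
  shows "\<bar>X n \<omega> - clamp_to L (X n \<omega>)\<bar> \<le> tail L \<omega> n"
    "\<bar>X n \<omega> - clamp_to L (X n \<omega>)\<bar> powr p \<le> tail L \<omega> n"
proof -
  let ?r = "\<bar>X n \<omega> - clamp_to L (X n \<omega>)\<bar>"
  have r: "?r \<le> (if L \<le> \<bar>X n \<omega>\<bar> then \<bar>X n \<omega>\<bar> else 0)"
    using assms by (intro clamp_to_remainder) auto
  show "?r \<le> tail L \<omega> n" using r abs_le_powr[of "\<bar>X n \<omega>\<bar>"] assms by (auto simp: tail_def split: if_splits)
  have "?r powr p \<le> (if L \<le> \<bar>X n \<omega>\<bar> then \<bar>X n \<omega>\<bar> else 0) powr p"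
    using r p1 by (intro powr_mono2) auto
  then show "?r powr p \<le> tail L \<omega> n" by (auto simp: tail_def split: if_splits)
qed

text \<open>If this vanished, stable convergence would give E min(X_n^2, 1) -> 0, that is X_n -> 0
  in probability. With |X_n|^p uniformly integrable the norms would tend to 0, against the
  normalization.\<close>

lemma trunc_var_one_pos: "0 < (\<integral>\<omega>. trunc_var 1 \<omega> \<partial>M)"
proof (rule ccontr)
  assume "\<not> 0 < (\<integral>\<omega>. trunc_var 1 \<omega> \<partial>M)"
  moreover have "0 \<le> (\<integral>\<omega>. trunc_var 1 \<omega> \<partial>M)" by (intro integral_nonneg_AE) (simp add: trunc_var_nonneg)
  ultimately have zero: "(\<integral>\<omega>. trunc_var 1 \<omega> \<partial>M) = 0" by linarith
  have cont: "isCont (\<lambda>x. min (x\<^sup>2) 1) x" for x :: real by (intro continuous_intros)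
  have "(\<lambda>n. \<integral>\<omega>. 1 * min ((X n \<omega>)\<^sup>2) 1 \<partial>M) \<longlonglongrightarrow> (\<integral>\<omega>. 1 * (\<integral>x. min (x\<^sup>2) 1 \<partial>\<mu> \<omega>) \<partial>M)"
    by (rule stable_convergence[where B=1]) (auto intro: cont)
  then have lim: "(\<lambda>n. \<integral>\<omega>. min ((X n \<omega>)\<^sup>2) 1 \<partial>M) \<longlonglongrightarrow> 0"
    using zero by (simp add: trunc_var_def)
  obtain L where L: "1 \<le> L" "\<And>n. (\<integral>\<omega>. tail L \<omega> n \<partial>M) < 1 / 4"
    using tail_small[of "1/4"] by auto
  have "(\<lambda>n. L powr p * (\<integral>\<omega>. min ((X n \<omega>)\<^sup>2) 1 \<partial>M)) \<longlonglongrightarrow> 0"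
    using tendsto_mult_left[OF lim, of "L powr p"] by simp
  then have "eventually (\<lambda>n. L powr p * (\<integral>\<omega>. min ((X n \<omega>)\<^sup>2) 1 \<partial>M) < 1 / 4) sequentially"
    by (rule order_tendstoD(2)) simp
  then obtain n where n: "L powr p * (\<integral>\<omega>. min ((X n \<omega>)\<^sup>2) 1 \<partial>M) < 1 / 4"
    by (auto simp: eventually_sequentially)
  \<comment> \<open>Above L the tail term suffices, between 1 and L the minimum equals 1, and below
    1 one has x^p <= x <= 1/4 + x^2 from (x - 1/2)^2 >= 0. Each of the three terms integrates to at
    most 1/4, too little for a total of 1.\<close>
  have pointwise: "x powr p \<le> (if L \<le> x then x powr p else 0) + 1 / 4 + L powr p * min (x\<^sup>2) 1"
    if "0 \<le> x" for x
  proof -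
    have Lp1: "1 \<le> L powr p" using L(1) p1 by (intro ge_one_powr_ge_zero) auto
    consider "L \<le> x" | "x < L" "1 \<le> x" | "x < 1" by linarith
    then show ?thesis
    proof cases
      case 1
      then show ?thesis using Lp1 by (simp add: zero_le_mult_iff)
    next
      case 2
      then have "x powr p \<le> L powr p" using p1 by (intro powr_mono2) auto
      moreover have "min (x\<^sup>2) 1 = 1" using 2 by (simp add: min_absorb2)
      ultimately show ?thesis using 2 by simp
    next
      case 3
      have "x powr p \<le> x"
      proof (cases "x = 0")
        case False
        then show ?thesis using powr_mono'[OF p1, of x] that 3 by simp
      qed (use p1 in simp)
      also have "x \<le> 1 / 4 + x\<^sup>2"
        using zero_le_power2[of "x - 1 / 2"] by (simp add: power2_diff power_divide)
      also have "x\<^sup>2 \<le> L powr p * min (x\<^sup>2) 1"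
      proof -
        have "x\<^sup>2 \<le> 1" using 3 that by (simp add: abs_square_le_1)
        then show ?thesis using mult_right_mono[OF Lp1, of "x\<^sup>2"] by (simp add: min_absorb1)
      qed
      finally show ?thesis using 3 L(1) by simp
    qed
  qed
  have int: "integrable M (\<lambda>\<omega>. min ((X n \<omega>)\<^sup>2) 1)"
    by (rule integrable_const_bound[where B=1]) auto
  have "1 = (\<integral>\<omega>. \<bar>X n \<omega>\<bar> powr p \<partial>M)" by (simp add: moment_one)
  also have "\<dots> \<le> (\<integral>\<omega>. tail L \<omega> n + 1 / 4 + L powr p * min ((X n \<omega>)\<^sup>2) 1 \<partial>M)"
    using pointwise[of "\<bar>X n _\<bar>"] int tail_integrable X_powr_integrable by (intro integral_mono) (auto simp: tail_def)
  also have "\<dots> = (\<integral>\<omega>. tail L \<omega> n \<partial>M) + 1 / 4 + L powr p * (\<integral>\<omega>. min ((X n \<omega>)\<^sup>2) 1 \<partial>M)"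
    using int tail_integrable by (simp add: prob_space)
  finally show False using n L(2)[of n] by linarith
qed

end

section \<open>The weight built from the limit variance\<close>

context lp_random_limit
begin

text \<open>The weight is chosen so that \<open>\<bar>x\<bar> powr p \<le> weight \<omega> * x\<^sup>2 + (1 + limit_sd \<omega>) powr p\<close>, while \<open>weight * limit_sd\<^sup>2\<close>
  is integrable: weighted second moments then control the \<open>p\<close>-th moments.\<close>

definition limit_sd :: "'a \<Rightarrow> real" where
  "limit_sd \<omega> = sqrt (enn2real (limit_var \<omega>))"

definition weight :: "'a \<Rightarrow> real" where
  "weight \<omega> = (1 + limit_sd \<omega>) powr (p - 2)"

lemma limit_sd_nonneg: "0 \<le> limit_sd \<omega>"
  by (simp add: limit_sd_def)

lemma limit_sd_measurable [measurable]: "limit_sd \<in> borel_measurable M"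
  unfolding limit_sd_def[abs_def] by measurable

lemma weight_measurable [measurable]: "weight \<in> borel_measurable M"
  unfolding weight_def[abs_def] by measurable

lemma weight_pos: "0 < weight \<omega>"
  using limit_sd_nonneg[of \<omega>] by (simp add: weight_def)

lemma weight_le_1: "weight \<omega> \<le> 1"
  using powr_mono[of "p - 2" 0 "1 + limit_sd \<omega>"] p2 limit_sd_nonneg[of \<omega>] by (simp add: weight_def)

lemma bounded_weight: "bounded_rv M weight"
  using weight_pos weight_le_1 by (intro bounded_rvI[where C=1]) (auto simp: abs_of_pos)

text \<open>Up to 1 + sigma the last term dominates; beyond it, |x|^(p - 2) is at most the weight
  since p - 2 < 0.\<close>

lemma powr_le_weighted_square: "\<bar>x\<bar> powr p \<le> weight \<omega> * x\<^sup>2 + (1 + limit_sd \<omega>) powr p"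
proof (cases "\<bar>x\<bar> \<le> 1 + limit_sd \<omega>")
  case True
  then have "\<bar>x\<bar> powr p \<le> (1 + limit_sd \<omega>) powr p" using p1 by (intro powr_mono2) auto
  then show ?thesis using weight_pos[of \<omega>] by (smt (verit) mult_nonneg_nonneg zero_le_power2)
next
  case False
  then have x: "0 < \<bar>x\<bar>" using limit_sd_nonneg[of \<omega>] by linarith
  have "\<bar>x\<bar> powr p = \<bar>x\<bar> powr (p - 2) * \<bar>x\<bar> powr 2" unfolding powr_add[symmetric] by simp
  also have "\<bar>x\<bar> powr 2 = x\<^sup>2" using x by simp
  also have "\<bar>x\<bar> powr (p - 2) * x\<^sup>2 \<le> weight \<omega> * x\<^sup>2"
    unfolding weight_def using False p2 limit_sd_nonneg[of \<omega>]
    by (intro mult_right_mono powr_mono2') auto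
  finally show ?thesis using powr_ge_zero[of "1 + limit_sd \<omega>" p] by linarith
qed

text \<open>Left unnormalized, of total mass at most 1. This is why the almost orthogonality
  estimates are stated for finite measures and not for probabilities.\<close>

definition weighted :: "'a measure" where
  "weighted = density M (\<lambda>\<omega>. ennreal (weight \<omega>))"

lemma sets_weighted [measurable_cong]: "sets weighted = sets M"
  by (simp add: weighted_def)

lemma space_weighted: "space weighted = space M"
  by (simp add: weighted_def)

lemma integral_weighted:
  assumes [measurable]: "f \<in> borel_measurable M"
  shows "(\<integral>\<omega>. f \<omega> \<partial>weighted) = (\<integral>\<omega>. weight \<omega> * f \<omega> \<partial>M)"
  unfolding weighted_def
  by (subst integral_density) (auto intro: less_imp_le[OF weight_pos])

lemma bounded_rv_weighted: "bounded_rv weighted f \<longleftrightarrow> bounded_rv M f"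
  by (simp add: bounded_rv_def space_weighted measurable_cong_sets[OF sets_weighted refl])

text \<open>The weight is bounded, so multiplying a test function by it gives a test function
  again.\<close>

lemma weakly_null_weighted:
  assumes meas: "\<And>n. V n \<in> borel_measurable M" and V: "weakly_null M V"
  shows "weakly_null weighted V"
  unfolding weakly_null_def bounded_rv_weighted
proof (intro allI impI)
  fix Z assume Z: "bounded_rv M Z"
  note [measurable] = meas
  have [measurable]: "Z \<in> borel_measurable M" using Z by (simp add: bounded_rv_def)
  have "(\<lambda>n. \<integral>\<omega>. (weight \<omega> * Z \<omega>) * V n \<omega> \<partial>M) \<longlonglongrightarrow> 0"
    using V bounded_rv_mult[OF bounded_weight Z] by (simp add: weakly_null_def)
  then show "(\<lambda>n. \<integral>\<omega>. Z \<omega> * V n \<omega> \<partial>weighted) \<longlonglongrightarrow> 0"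
    by (simp add: integral_weighted mult.assoc)
qed

lemma finite_measure_weighted: "finite_measure weighted"
  and measure_weighted_le_1: "measure weighted (space weighted) \<le> 1"
proof -
  have "emeasure weighted (space weighted) = (\<integral>\<^sup>+\<omega>. ennreal (weight \<omega>) * indicator (space M) \<omega> \<partial>M)"
    unfolding weighted_def by (simp add: emeasure_density)
  also have "\<dots> \<le> (\<integral>\<^sup>+\<omega>. 1 \<partial>M)"
    using weight_le_1 by (intro nn_integral_mono) (auto simp: indicator_def)
  finally have le: "emeasure weighted (space weighted) \<le> 1" by (simp add: emeasure_space_1)
  show "finite_measure weighted" by (rule finite_measureI) (use le in \<open>auto simp: top_unique\<close>)
  show "measure weighted (space weighted) \<le> 1"
    using le enn2real_mono[OF le] by (simp add: measure_def)
qed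

text \<open>Integrating |x| <= c + c^(1-p) |x|^p over a probability space yields c <= c^(1-p)
  E|f|^p. This stands in for monotonicity of the L^p norms, at the price of a factor 2.\<close>

lemma Lp_norm_ge:
  assumes f: "in_Lp M p f" and c: "0 < c" "2 * c \<le> (\<integral>\<omega>. \<bar>f \<omega>\<bar> \<partial>M)"
  shows "c \<le> Lp_norm M p f"
proof -
  note [measurable] = f[unfolded in_Lp_def, THEN conjunct1]
  have pw: "\<bar>x\<bar> \<le> c + c powr (1 - p) * \<bar>x\<bar> powr p" for x :: real
  proof (cases "\<bar>x\<bar> \<le> c")
    case True
    then show ?thesis by (simp add: add_increasing2)
  next
    case False
    then have "\<bar>x\<bar> = \<bar>x\<bar> powr (1 - p) * \<bar>x\<bar> powr p" using c by (simp flip: powr_add)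
    also have "\<dots> \<le> c powr (1 - p) * \<bar>x\<bar> powr p"
      using False c p1 by (intro mult_right_mono powr_mono2') auto
    finally show ?thesis using c by linarith
  qed
  have R: "integrable M (\<lambda>\<omega>. c + c powr (1 - p) * \<bar>f \<omega>\<bar> powr p)"
    using f by (simp add: in_Lp_def)
  have I: "integrable M (\<lambda>\<omega>. \<bar>f \<omega>\<bar>)"
  proof (rule Bochner_Integration.integrable_bound[OF R])
    show "AE \<omega> in M. norm \<bar>f \<omega>\<bar> \<le> norm (c + c powr (1 - p) * \<bar>f \<omega>\<bar> powr p)"
      using pw by (intro AE_I2) (metis abs_ge_self abs_idempotent order_trans real_norm_def)
  qed simp
  have "2 * c \<le> (\<integral>\<omega>. c + c powr (1 - p) * \<bar>f \<omega>\<bar> powr p \<partial>M)"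
    using c(2) integral_mono[OF I R pw] by linarith
  also have "\<dots> = c + c powr (1 - p) * (\<integral>\<omega>. \<bar>f \<omega>\<bar> powr p \<partial>M)"
    using f by (simp add: in_Lp_def prob_space)
  finally have "c \<le> c powr (1 - p) * (\<integral>\<omega>. \<bar>f \<omega>\<bar> powr p \<partial>M)" by simp
  then have "c powr (p - 1) * c \<le> c powr (p - 1) * (c powr (1 - p) * (\<integral>\<omega>. \<bar>f \<omega>\<bar> powr p \<partial>M))"
    by (intro mult_left_mono) auto
  also have "\<dots> = (\<integral>\<omega>. \<bar>f \<omega>\<bar> powr p \<partial>M)" using c by (simp add: mult.assoc[symmetric] flip: powr_add)
  also have "c powr (p - 1) * c = c powr p" using c powr_add[of c "p - 1" 1] by simp
  finally have "(c powr p) powr (1 / p) \<le> Lp_norm M p f"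
    unfolding Lp_norm_def using p1 by (intro powr_mono2) auto
  then show ?thesis using c p1 by (simp add: powr_powr)
qed

context
  assumes fin: "AE \<omega> in M. limit_var \<omega> < \<infinity>"
    and int: "integrable M (\<lambda>\<omega>. enn2real (limit_var \<omega>) powr (p / 2))"
begin

lemma limit_sd_powr_integrable: "integrable M (\<lambda>\<omega>. (1 + limit_sd \<omega>) powr p)"
proof (rule Bochner_Integration.integrable_bound)
  have "limit_sd \<omega> powr p = enn2real (limit_var \<omega>) powr (p / 2)" for \<omega>
    by (simp add: limit_sd_def powr_half_sqrt[symmetric] powr_powr)
  then show "integrable M (\<lambda>\<omega>. 2 powr p * (1 powr p + limit_sd \<omega> powr p))"
    using int by simp
  show "AE \<omega> in M. norm ((1 + limit_sd \<omega>) powr p) \<le> norm (2 powr p * (1 powr p + limit_sd \<omega> powr p))"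
    using powr_add_le[of 1 "limit_sd _" p] limit_sd_nonneg p1 by (intro AE_I2) simp
qed simp

lemma weighted_var_integrable: "integrable M (\<lambda>\<omega>. weight \<omega> * (limit_sd \<omega>)\<^sup>2)"
proof (rule Bochner_Integration.integrable_bound[OF limit_sd_powr_integrable])
  show "AE \<omega> in M. norm (weight \<omega> * (limit_sd \<omega>)\<^sup>2) \<le> norm ((1 + limit_sd \<omega>) powr p)"
  proof (rule AE_I2)
    fix \<omega>
    have "weight \<omega> * (limit_sd \<omega>)\<^sup>2 \<le> weight \<omega> * (1 + limit_sd \<omega>)\<^sup>2"
      using weight_pos[of \<omega>] limit_sd_nonneg[of \<omega>] by (intro mult_left_mono power_mono) auto
    also have "(1 + limit_sd \<omega>)\<^sup>2 = (1 + limit_sd \<omega>) powr 2" using limit_sd_nonneg[of \<omega>] by simp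
    also have "weight \<omega> * (1 + limit_sd \<omega>) powr 2 = (1 + limit_sd \<omega>) powr p"
      by (simp add: weight_def flip: powr_add)
    finally show "norm (weight \<omega> * (limit_sd \<omega>)\<^sup>2) \<le> norm ((1 + limit_sd \<omega>) powr p)"
      using weight_pos[of \<omega>] by (simp add: abs_mult)
  qed
qed simp

lemma weighted_truncation_limit:
  assumes "0 \<le> L"
  shows "(\<lambda>n. \<integral>\<omega>. weight \<omega> * (clamp_to L (X n \<omega>))\<^sup>2 \<partial>M) \<longlonglongrightarrow> (\<integral>\<omega>. weight \<omega> * trunc_var (L\<^sup>2) \<omega> \<partial>M)"
proof -
  have sq: "(clamp_to L x)\<^sup>2 = min (x\<^sup>2) (L\<^sup>2)" for x
  proof (cases "\<bar>x\<bar> \<le> L")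
    case True
    then have "x\<^sup>2 \<le> L\<^sup>2" using assms power2_le_iff_abs_le by blast
    moreover have "clamp_to L x = x" using True by (auto simp: clamp_to_def)
    ultimately show ?thesis by simp
  next
    case False
    then have "L\<^sup>2 \<le> x\<^sup>2" using assms by (metis abs_le_square_iff abs_of_nonneg linear)
    moreover have "\<bar>clamp_to L x\<bar> = L" using False assms by (auto simp: clamp_to_def)
    ultimately show ?thesis by (metis min_absorb2 power2_abs)
  qed
  have cont: "isCont (\<lambda>x. min (x\<^sup>2) (L\<^sup>2)) x" for x :: real by (intro continuous_intros)
  show ?thesis unfolding sq trunc_var_def
    by (rule stable_convergence[where B="L\<^sup>2"]) (auto intro: cont bounded_rv_integrable bounded_weight)
qed

lemma weighted_truncation_limit_le:
  assumes "0 \<le> L"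
  shows "(\<integral>\<omega>. weight \<omega> * trunc_var L \<omega> \<partial>M) \<le> (\<integral>\<omega>. weight \<omega> * (limit_sd \<omega>)\<^sup>2 \<partial>M)"
proof (rule integral_mono_AE)
  show "integrable M (\<lambda>\<omega>. weight \<omega> * trunc_var L \<omega>)"
    using bounded_rv_function(2)[of "\<lambda>x. min (x\<^sup>2) L" L] assms
    by (intro bounded_rv_integrable bounded_rv_intros bounded_weight) (simp add: trunc_var_def[abs_def])
  show "AE \<omega> in M. weight \<omega> * trunc_var L \<omega> \<le> weight \<omega> * (limit_sd \<omega>)\<^sup>2"
    using fin AE_space
  proof eventually_elim
    case (elim \<omega>)
    have "trunc_var L \<omega> = enn2real (ennreal (trunc_var L \<omega>))" using trunc_var_nonneg[OF assms] by simp
    \<comment> \<open>Finiteness of the variance matters here: \<open>enn2real\<close> is monotone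
      only below infinity.\<close>
    also have "\<dots> \<le> enn2real (limit_var \<omega>)"
      using elim trunc_var_le_limit_var[OF elim(2) assms] by (intro enn2real_mono) auto
    also have "\<dots> = (limit_sd \<omega>)\<^sup>2" by (simp add: limit_sd_def)
    finally show ?case using weight_pos[of \<omega>] by (intro mult_left_mono) auto
  qed
qed (rule weighted_var_integrable)

text \<open>Strict positivity of the weight: an integral 0 would make \<open>trunc_var 1\<close>
  vanish almost everywhere for P as well.\<close>

lemma weighted_trunc_var_one_pos: "0 < (\<integral>\<omega>. weight \<omega> * trunc_var 1 \<omega> \<partial>M)"
proof -
  have nn: "0 \<le> weight \<omega> * trunc_var 1 \<omega>" for \<omega>
    using weight_pos[of \<omega>] trunc_var_nonneg[of 1 \<omega>] by simp
  have "integrable M (\<lambda>\<omega>. weight \<omega> * trunc_var 1 \<omega>)"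
    using bounded_rv_function(2)[of "\<lambda>x. min (x\<^sup>2) 1" 1]
    by (intro bounded_rv_integrable bounded_rv_intros bounded_weight) (simp add: trunc_var_def[abs_def])
  note zero_iff = integral_nonneg_eq_0_iff_AE[OF this AE_I2[OF nn]]
  have "(\<integral>\<omega>. weight \<omega> * trunc_var 1 \<omega> \<partial>M) \<noteq> 0"
  proof
    assume "(\<integral>\<omega>. weight \<omega> * trunc_var 1 \<omega> \<partial>M) = 0"
    then have "AE \<omega> in M. weight \<omega> * trunc_var 1 \<omega> = 0" using zero_iff by simp
    then have "AE \<omega> in M. trunc_var 1 \<omega> = 0"
      by eventually_elim (use weight_pos in \<open>auto simp: less_le\<close>)
    then have "(\<integral>\<omega>. trunc_var 1 \<omega> \<partial>M) = 0" by (rule integral_eq_zero_AE)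
    then show False using trunc_var_one_pos by simp
  qed
  moreover have "0 \<le> (\<integral>\<omega>. weight \<omega> * trunc_var 1 \<omega> \<partial>M)" using nn by (intro integral_nonneg_AE AE_I2)
  ultimately show ?thesis by linarith
qed

text \<open>The level L k comes first, from tail bounds uniform in n; then r k is taken so late that
  the limits at this level are nearly attained. For the last claim let U and g be X clamped at L k
  and at 1, and m the kernel mean of g. Then U (g - m) = U g - X m + (X - U) m, where U g >= g^2,
  the w-average of g^2 tends to 2 c0, that of X m tends to 0 by weak nullity, and the last term is
  at most the tail.\<close>

lemma truncated_subsequence:
  assumes \<eta>: "0 < \<eta>" and c0: "0 < c0" "2 * c0 = (\<integral>\<omega>. weight \<omega> * trunc_var 1 \<omega> \<partial>M)" and \<eta>c: "\<eta> \<le> c0 / 4"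
  obtains L r where "strict_mono r" "\<And>k. 1 \<le> L k"
    "\<And>k n. (\<integral>\<omega>. tail (L k) \<omega> n \<partial>M) \<le> \<eta> * (1/8) ^ Suc k"
    "\<And>k. (\<integral>\<omega>. weight \<omega> * (clamp_to (L k) (X (r k) \<omega>))\<^sup>2 \<partial>M) \<le> (\<integral>\<omega>. weight \<omega> * (limit_sd \<omega>)\<^sup>2 \<partial>M) + 1"
    "\<And>k. c0 \<le> (\<integral>\<omega>. weight \<omega> * (clamp_to (L k) (X (r k) \<omega>) *
        (clamp_to 1 (X (r k) \<omega>) - (\<integral>x. clamp_to 1 x \<partial>\<mu> \<omega>))) \<partial>M)"
proof -
  have "\<exists>L. 1 \<le> L \<and> (\<forall>n. (\<integral>\<omega>. tail L \<omega> n \<partial>M) < \<eta> * (1/8) ^ Suc k)" for k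
    by (rule tail_small[of "\<eta> * (1/8) ^ Suc k"]) (use \<eta> in auto)
  then obtain L where L: "\<And>k. 1 \<le> L k" "\<And>k n. (\<integral>\<omega>. tail (L k) \<omega> n \<partial>M) < \<eta> * (1/8) ^ Suc k"
    by metis
  define m where "m \<omega> = (\<integral>x. clamp_to 1 x \<partial>\<mu> \<omega>)" for \<omega>
  have m: "bounded_rv M m"
    using bounded_rv_function(2)[of "clamp_to 1" 1] clamp_to_bound[of 1] by (simp add: m_def[abs_def])
  have m1: "\<bar>m \<omega>\<bar> \<le> 1" if "\<omega> \<in> space M" for \<omega>
    unfolding m_def by (rule kernel_integral_bound[OF that]) (auto intro: clamp_to_bound)
  have [measurable]: "m \<in> borel_measurable M" using m by (simp add: bounded_rv_def)
  \<comment> \<open>The conditions tie the candidate n to the level k alone; the argument f is there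
    to fit the selection principle.\<close>
  define Q :: "(nat \<Rightarrow> nat) \<Rightarrow> nat \<Rightarrow> nat \<Rightarrow> bool" where "Q f k n \<longleftrightarrow>
    (\<integral>\<omega>. weight \<omega> * (clamp_to (L k) (X n \<omega>))\<^sup>2 \<partial>M) < (\<integral>\<omega>. weight \<omega> * (limit_sd \<omega>)\<^sup>2 \<partial>M) + 1 \<and>
    7 / 4 * c0 < (\<integral>\<omega>. weight \<omega> * (clamp_to 1 (X n \<omega>))\<^sup>2 \<partial>M) \<and>
    (\<integral>\<omega>. (weight \<omega> * m \<omega>) * X n \<omega> \<partial>M) < c0 / 4" for f k n
  have "eventually (Q f k) sequentially" for f k
    unfolding Q_def
  proof (intro eventually_conj)
    have L0: "0 \<le> L k" using L(1)[of k] by linarith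
    have "(\<integral>\<omega>. weight \<omega> * trunc_var ((L k)\<^sup>2) \<omega> \<partial>M) < (\<integral>\<omega>. weight \<omega> * (limit_sd \<omega>)\<^sup>2 \<partial>M) + 1"
      using weighted_truncation_limit_le[of "(L k)\<^sup>2"] by simp
    then show "eventually (\<lambda>n. (\<integral>\<omega>. weight \<omega> * (clamp_to (L k) (X n \<omega>))\<^sup>2 \<partial>M) < (\<integral>\<omega>. weight \<omega> * (limit_sd \<omega>)\<^sup>2 \<partial>M) + 1) sequentially"
      by (rule order_tendstoD(2)[OF weighted_truncation_limit[OF L0]])
    show "eventually (\<lambda>n. 7 / 4 * c0 < (\<integral>\<omega>. weight \<omega> * (clamp_to 1 (X n \<omega>))\<^sup>2 \<partial>M)) sequentially"
      using weighted_truncation_limit[of 1] c0 by (intro order_tendstoD(1)) auto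
    show "eventually (\<lambda>n. (\<integral>\<omega>. (weight \<omega> * m \<omega>) * X n \<omega> \<partial>M) < c0 / 4) sequentially"
      using bounded_tendsto_zero[OF bounded_rv_mult[OF bounded_weight m]] c0 by (intro order_tendstoD(2)) auto
  qed
  moreover have "Q f k n = Q g k n" for f g k n by (simp add: Q_def)
  ultimately obtain r where r: "strict_mono r" and Q: "\<And>k. Q r k (r k)"
    using strict_mono_selection[of Q] by metis
  have low: "c0 \<le> (\<integral>\<omega>. weight \<omega> * (clamp_to (L k) (X (r k) \<omega>) * (clamp_to 1 (X (r k) \<omega>) - m \<omega>)) \<partial>M)" for k
  proof -
    let ?U = "\<lambda>\<omega>. clamp_to (L k) (X (r k) \<omega>)" and ?g = "\<lambda>\<omega>. clamp_to 1 (X (r k) \<omega>)"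
    have L0: "0 \<le> L k" using L(1)[of k] by linarith
    have U: "bounded_rv M ?U" and g: "bounded_rv M ?g"
      using clamp_to_bound[OF L0] clamp_to_bound[of 1]
      by (auto intro: bounded_rv_function(1)[OF borel_measurable_clamp_to])
    note X' = X_integrable[of "r k"]
    have wmX: "integrable M (\<lambda>\<omega>. (weight \<omega> * m \<omega>) * X (r k) \<omega>)"
    proof -
      obtain C where "\<And>\<omega>. \<omega> \<in> space M \<Longrightarrow> \<bar>weight \<omega> * m \<omega>\<bar> \<le> C"
        using bounded_rv_mult[OF bounded_weight m] by (auto simp: bounded_rv_def)
      then have "integrable M (\<lambda>\<omega>. X (r k) \<omega> * (weight \<omega> * m \<omega>))"
        using X' by (intro integrable_mult_bounded[where C=C]) auto
      then show ?thesis by (simp add: mult.commute)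
    qed
    have ints: "integrable M (\<lambda>\<omega>. weight \<omega> * (?U \<omega> * (?g \<omega> - m \<omega>)))"
      "integrable M (\<lambda>\<omega>. weight \<omega> * (?g \<omega>)\<^sup>2)"
      using bounded_rv_add[OF g bounded_rv_mult[OF bounded_rv_const[of M "-1"] m]]
      by (auto intro!: bounded_rv_integrable bounded_rv_intros bounded_weight U g)
    have pw: "weight \<omega> * (?g \<omega>)\<^sup>2 - (weight \<omega> * m \<omega>) * X (r k) \<omega> - tail (L k) \<omega> (r k)
        \<le> weight \<omega> * (?U \<omega> * (?g \<omega> - m \<omega>))" if "\<omega> \<in> space M" for \<omega>
    proof -
      have "weight \<omega> * (?g \<omega>)\<^sup>2 \<le> weight \<omega> * (?U \<omega> * ?g \<omega>)"
        using clamp_to_mult_mono[OF L(1)] weight_pos[of \<omega>] by (intro mult_left_mono) auto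
      moreover have "\<bar>(weight \<omega> * m \<omega>) * (X (r k) \<omega> - ?U \<omega>)\<bar> \<le> 1 * tail (L k) \<omega> (r k)"
        unfolding abs_mult using weight_pos[of \<omega>] weight_le_1[of \<omega>] m1[OF that] remainder_le_tail(1)[OF L(1)]
        by (intro mult_mono mult_le_one) auto
      ultimately show ?thesis by (simp add: algebra_simps)
    qed
    \<comment> \<open>From 7/4 c0, a little below the limit 2 c0, weak nullity takes c0/4 and the
      tail at most eta <= c0/4, which leaves 5/4 c0.\<close>
    have "7 / 4 * c0 - c0 / 4 - c0 / 4 \<le> (\<integral>\<omega>. weight \<omega> * (?g \<omega>)\<^sup>2 \<partial>M) - (\<integral>\<omega>. (weight \<omega> * m \<omega>) * X (r k) \<omega> \<partial>M)
        - (\<integral>\<omega>. tail (L k) \<omega> (r k) \<partial>M)"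
    proof -
      have "\<eta> * (1/8) ^ Suc k \<le> \<eta> * 1" using \<eta> by (intro mult_left_mono power_le_one) auto
      then show ?thesis using Q[of k] L(2)[of k "r k"] \<eta>c unfolding Q_def by linarith
    qed
    also have "\<dots> = (\<integral>\<omega>. weight \<omega> * (?g \<omega>)\<^sup>2 - (weight \<omega> * m \<omega>) * X (r k) \<omega> - tail (L k) \<omega> (r k) \<partial>M)"
      using ints wmX tail_integrable by simp
    also have "\<dots> \<le> (\<integral>\<omega>. weight \<omega> * (?U \<omega> * (?g \<omega> - m \<omega>)) \<partial>M)"
      using ints wmX tail_integrable pw by (intro integral_mono) auto
    finally show ?thesis using c0 by linarith
  qed
  show thesis
  proof (rule that[OF r L(1)])
    show "(\<integral>\<omega>. tail (L k) \<omega> n \<partial>M) \<le> \<eta> * (1/8) ^ Suc k" for k n using L(2)[of k n] by linarith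
    show "(\<integral>\<omega>. weight \<omega> * (clamp_to (L k) (X (r k) \<omega>))\<^sup>2 \<partial>M) \<le> (\<integral>\<omega>. weight \<omega> * (limit_sd \<omega>)\<^sup>2 \<partial>M) + 1" for k
      using Q[of k] by (auto simp: Q_def)
    show "c0 \<le> (\<integral>\<omega>. weight \<omega> * (clamp_to (L k) (X (r k) \<omega>) *
        (clamp_to 1 (X (r k) \<omega>) - (\<integral>x. clamp_to 1 x \<partial>\<mu> \<omega>))) \<partial>M)" for k
      using low[of k] by (simp add: m_def)
  qed
qed

end

end

section \<open>Transfer from the truncations to the original sequence\<close>

lemma sum_geometric_eighth: "(\<Sum>i<n. (1/8) ^ Suc i) \<le> (1::real)"
proof -
  have "(\<Sum>i<n. (1/8) ^ Suc i) \<le> (\<Sum>i<n. (1/2) * (1/2) ^ i :: real)"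
  proof (rule sum_mono)
    fix i
    have "(1/8) * (1/8) ^ i \<le> (1/2) * (1/2 :: real) ^ i" by (intro mult_mono power_mono) auto
    then show "(1/8) ^ Suc i \<le> (1/2) * (1/2 :: real) ^ i" by simp
  qed
  also have "\<dots> = (1/2) * (\<Sum>i<n. (1/2) ^ i)" by (simp add: sum_distrib_left)
  also have "\<dots> \<le> (1/2) * 2" using sum_geometric_half by (intro mult_left_mono) auto
  finally show ?thesis by simp
qed

lemma sum_geometric_four_eighth: "(\<Sum>i<n. 4 ^ Suc i * (1/8) ^ Suc i) \<le> (1::real)"
proof -
  have "(\<Sum>i<n. 4 ^ Suc i * (1/8) ^ Suc i) = (\<Sum>i<n. (1/2) * (1/2) ^ i :: real)"
    by (intro sum.cong) (auto simp flip: power_Suc power_mult_distrib)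
  also have "\<dots> = (1/2) * (\<Sum>i<n. (1/2) ^ i)" by (simp add: sum_distrib_left)
  also have "\<dots> \<le> (1/2) * 2" using sum_geometric_half by (intro mult_left_mono) auto
  finally show ?thesis by simp
qed

lemma abs_coeff_le_1:
  fixes a :: "nat \<Rightarrow> real"
  assumes "(\<Sum>i<n. (a i)\<^sup>2) = 1" "i < n"
  shows "\<bar>a i\<bar> \<le> 1"
proof -
  have "(a i)\<^sup>2 \<le> (\<Sum>i<n. (a i)\<^sup>2)" using assms(2) by (intro member_le_sum) auto
  then show ?thesis using assms(1) by (simp add: abs_square_le_1)
qed

context lp_random_limit
begin

lemma remainder_small:
  assumes L: "1 \<le> L" and t: "(\<integral>\<omega>. tail L \<omega> n \<partial>M) \<le> e"
  defines "R \<equiv> \<lambda>\<omega>. X n \<omega> - clamp_to L (X n \<omega>)"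
  shows "integrable M (\<lambda>\<omega>. \<bar>R \<omega>\<bar>)" "(\<integral>\<omega>. \<bar>R \<omega>\<bar> \<partial>M) \<le> e"
    "integrable M (\<lambda>\<omega>. \<bar>R \<omega>\<bar> powr p)" "(\<integral>\<omega>. \<bar>R \<omega>\<bar> powr p \<partial>M) \<le> e"
proof -
  have [measurable]: "R \<in> borel_measurable M" unfolding R_def by measurable
  have nn: "0 \<le> tail L \<omega> n" for \<omega> by (simp add: tail_def)
  show i1: "integrable M (\<lambda>\<omega>. \<bar>R \<omega>\<bar>)"
    by (rule Bochner_Integration.integrable_bound[OF tail_integrable[of L n]])
      (use remainder_le_tail(1)[OF L] nn in \<open>auto simp: R_def\<close>)
  show i2: "integrable M (\<lambda>\<omega>. \<bar>R \<omega>\<bar> powr p)"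
    by (rule Bochner_Integration.integrable_bound[OF tail_integrable[of L n]])
      (use remainder_le_tail(2)[OF L] nn in \<open>auto simp: R_def\<close>)
  have "(\<integral>\<omega>. \<bar>R \<omega>\<bar> \<partial>M) \<le> (\<integral>\<omega>. tail L \<omega> n \<partial>M)" "(\<integral>\<omega>. \<bar>R \<omega>\<bar> powr p \<partial>M) \<le> (\<integral>\<omega>. tail L \<omega> n \<partial>M)"
    using remainder_le_tail[OF L] i1 i2 by (auto intro!: integral_mono tail_integrable simp: R_def)
  then show "(\<integral>\<omega>. \<bar>R \<omega>\<bar> \<partial>M) \<le> e" "(\<integral>\<omega>. \<bar>R \<omega>\<bar> powr p \<partial>M) \<le> e" using t by linarith+
qed

text \<open>Below: as the weight is at most 1, the weighted L1 norm of the V-sum is at most the L1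
  norm of the X-sum plus the remainders. These add up to at most eta <= c / 2, and
  \<open>Lp_norm_ge\<close> halves the surviving c / 2. Above: the V-sum is handled by
  \<open>powr_le_weighted_square\<close> and the remainders by \<open>powr_sum_le\<close>.\<close>

lemma equiv_l2_basis_of_weighted:
  fixes s :: "nat \<Rightarrow> nat" and V :: "nat \<Rightarrow> 'a \<Rightarrow> real"
  assumes V: "\<And>k. bounded_rv M (V k)" and c: "0 < c" and \<eta>: "0 < \<eta>" "\<eta> \<le> 1" "\<eta> \<le> c / 2"
    and sd: "integrable M (\<lambda>\<omega>. (1 + limit_sd \<omega>) powr p)"
    and R: "\<And>k. integrable M (\<lambda>\<omega>. \<bar>X (s k) \<omega> - V k \<omega>\<bar>)"
      "\<And>k. (\<integral>\<omega>. \<bar>X (s k) \<omega> - V k \<omega>\<bar> \<partial>M) \<le> \<eta> * (1/8) ^ Suc k"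
      "\<And>k. integrable M (\<lambda>\<omega>. \<bar>X (s k) \<omega> - V k \<omega>\<bar> powr p)"
      "\<And>k. (\<integral>\<omega>. \<bar>X (s k) \<omega> - V k \<omega>\<bar> powr p \<partial>M) \<le> \<eta> * (1/8) ^ Suc k"
    and est: "\<And>n a. (\<Sum>i<n. (a i)\<^sup>2) = 1 \<Longrightarrow> c \<le> (\<integral>\<omega>. weight \<omega> * \<bar>\<Sum>i<n. a i * V i \<omega>\<bar> \<partial>M) \<and>
        (\<integral>\<omega>. weight \<omega> * (\<Sum>i<n. a i * V i \<omega>)\<^sup>2 \<partial>M) \<le> D"
  shows "equiv_l2_basis M p (\<lambda>k. X (s k))"
proof (rule equiv_l2_basisI)
  show "0 < p" using p1 by linarith
  show "0 < c / 4" using c by simp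
  fix n and a :: "nat \<Rightarrow> real"
  assume a: "(\<Sum>i<n. (a i)\<^sup>2) = 1"
  let ?S = "\<lambda>\<omega>. \<Sum>i<n. a i * X (s i) \<omega>" and ?T = "\<lambda>\<omega>. \<Sum>i<n. a i * V i \<omega>"
  let ?r = "\<lambda>i \<omega>. \<bar>X (s i) \<omega> - V i \<omega>\<bar>"
  have ST: "\<bar>?S \<omega> - ?T \<omega>\<bar> \<le> (\<Sum>i<n. ?r i \<omega>)" for \<omega>
  proof -
    have "?S \<omega> - ?T \<omega> = (\<Sum>i<n. a i * (X (s i) \<omega> - V i \<omega>))"
      by (simp add: sum_subtractf right_diff_distrib)
    then show ?thesis
      using sum_scaled_abs_bound[of "{..<n}" a "\<lambda>i. X (s i) \<omega> - V i \<omega>"] abs_coeff_le_1[OF a] by simp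
  qed
  have S: "in_Lp M p ?S" using in_Lp_lincomb[of M p "\<lambda>i. X (s i)"] Lp p1 by simp
  then have [measurable]: "?S \<in> borel_measurable M" by (simp add: in_Lp_def)
  have T: "bounded_rv M ?T" by (intro bounded_rv_intros V)
  have Sint: "integrable M (\<lambda>\<omega>. \<bar>?S \<omega>\<bar>)"
    by (intro integrable_abs Bochner_Integration.integrable_sum integrable_mult_right X_integrable)
  have rint: "integrable M (\<lambda>\<omega>. \<Sum>i<n. ?r i \<omega>)" by (intro Bochner_Integration.integrable_sum R)
  have wT: "integrable M (\<lambda>\<omega>. weight \<omega> * \<bar>?T \<omega>\<bar>)" "integrable M (\<lambda>\<omega>. weight \<omega> * (?T \<omega>)\<^sup>2)"
    by (intro bounded_rv_integrable bounded_rv_intros bounded_weight T)+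
  have "c / 4 \<le> Lp_norm M p ?S"
  proof (rule Lp_norm_ge[OF S])
    have "weight \<omega> * \<bar>?T \<omega>\<bar> \<le> \<bar>?S \<omega>\<bar> + (\<Sum>i<n. ?r i \<omega>)" for \<omega>
    proof -
      have "weight \<omega> * \<bar>?T \<omega>\<bar> \<le> \<bar>?T \<omega>\<bar>"
        using weight_pos[of \<omega>] weight_le_1[of \<omega>] by (intro mult_left_le_one_le) auto
      then show ?thesis using ST[of \<omega>] by linarith
    qed
    then have "(\<integral>\<omega>. weight \<omega> * \<bar>?T \<omega>\<bar> \<partial>M) \<le> (\<integral>\<omega>. \<bar>?S \<omega>\<bar> + (\<Sum>i<n. ?r i \<omega>) \<partial>M)"
      using wT Sint rint by (intro integral_mono) auto
    also have "\<dots> = (\<integral>\<omega>. \<bar>?S \<omega>\<bar> \<partial>M) + (\<Sum>i<n. \<integral>\<omega>. ?r i \<omega> \<partial>M)"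
      using Sint rint R(1) by simp
    also have "(\<Sum>i<n. \<integral>\<omega>. ?r i \<omega> \<partial>M) \<le> (\<Sum>i<n. \<eta> * (1/8) ^ Suc i)" by (intro sum_mono R(2))
    also have "\<dots> = \<eta> * (\<Sum>i<n. (1/8) ^ Suc i)" by (simp only: sum_distrib_left)
    also have "\<dots> \<le> \<eta> * 1" using sum_geometric_eighth \<eta> by (intro mult_left_mono) auto
    finally show "2 * (c / 4) \<le> (\<integral>\<omega>. \<bar>?S \<omega>\<bar> \<partial>M)" using est[OF a] \<eta> by linarith
  qed (use c in simp)
  \<comment> \<open>The 4 majorizes 2^p. The final 1 covers the remainders, where 4^(i+1) 8^-(i+1)
    is summable with sum at most 1.\<close>
  moreover have "Lp_norm M p ?S \<le> (4 * (D + (\<integral>\<omega>. (1 + limit_sd \<omega>) powr p \<partial>M) + 1)) powr (1 / p)"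
    unfolding Lp_norm_def
  proof (rule powr_mono2)
    have two: "2 powr p \<le> (4::real)" using powr_mono[of p 2 "2::real"] p2 by simp
    let ?B = "\<lambda>\<omega>. 4 * (weight \<omega> * (?T \<omega>)\<^sup>2 + (1 + limit_sd \<omega>) powr p + (\<Sum>i<n. 4 ^ Suc i * ?r i \<omega> powr p))"
    have "\<bar>?S \<omega>\<bar> powr p \<le> ?B \<omega>" for \<omega>
    proof -
      have "\<bar>?S \<omega>\<bar> powr p \<le> (\<bar>?T \<omega>\<bar> + (\<Sum>i<n. ?r i \<omega>)) powr p"
        using ST[of \<omega>] p1 by (intro powr_mono2) linarith+
      also have "\<dots> \<le> 2 powr p * (\<bar>?T \<omega>\<bar> powr p + (\<Sum>i<n. ?r i \<omega>) powr p)"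
        using p1 by (intro powr_add_le sum_nonneg) auto
      also have "\<dots> \<le> 4 * ((weight \<omega> * (?T \<omega>)\<^sup>2 + (1 + limit_sd \<omega>) powr p) + (\<Sum>i<n. 4 ^ Suc i * ?r i \<omega> powr p))"
        using two powr_le_weighted_square p1 p2 by (intro mult_mono add_mono powr_sum_le) auto
      finally show ?thesis .
    qed
    moreover have Bint: "integrable M ?B"
      by (intro integrable_mult_right Bochner_Integration.integrable_add Bochner_Integration.integrable_sum wT sd R(3))
    ultimately have "(\<integral>\<omega>. \<bar>?S \<omega>\<bar> powr p \<partial>M) \<le> (\<integral>\<omega>. ?B \<omega> \<partial>M)"
      using S by (intro integral_mono) (auto simp: in_Lp_def)
    also have "\<dots> = 4 * ((\<integral>\<omega>. weight \<omega> * (?T \<omega>)\<^sup>2 \<partial>M) + (\<integral>\<omega>. (1 + limit_sd \<omega>) powr p \<partial>M)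
        + (\<Sum>i<n. 4 ^ Suc i * (\<integral>\<omega>. ?r i \<omega> powr p \<partial>M)))"
      using wT sd R(3) by simp
    also have "\<dots> \<le> 4 * (D + (\<integral>\<omega>. (1 + limit_sd \<omega>) powr p \<partial>M) + 1)"
    proof (intro mult_left_mono add_mono order_refl)
      show "(\<integral>\<omega>. weight \<omega> * (?T \<omega>)\<^sup>2 \<partial>M) \<le> D" using est[OF a] by simp
      have "(\<Sum>i<n. 4 ^ Suc i * (\<integral>\<omega>. ?r i \<omega> powr p \<partial>M)) \<le> (\<Sum>i<n. 4 ^ Suc i * (\<eta> * (1/8) ^ Suc i))"
        by (intro sum_mono mult_left_mono R(4)) auto
      also have "\<dots> = \<eta> * (\<Sum>i<n. 4 ^ Suc i * (1/8) ^ Suc i)"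
        unfolding sum_distrib_left by (intro sum.cong) (simp_all only: mult_ac)
      also have "\<dots> \<le> 1 * 1"
        using sum_geometric_four_eighth \<eta> by (intro mult_mono sum_nonneg) auto
      finally show "(\<Sum>i<n. 4 ^ Suc i * (\<integral>\<omega>. ?r i \<omega> powr p \<partial>M)) \<le> 1" by simp
    qed simp
    finally show "(\<integral>\<omega>. \<bar>?S \<omega>\<bar> powr p \<partial>M) \<le> 4 * (D + (\<integral>\<omega>. (1 + limit_sd \<omega>) powr p \<partial>M) + 1)" .
  qed (use p1 in \<open>auto intro!: integral_nonneg_AE\<close>)
  ultimately show "c / 4 \<le> Lp_norm M p ?S \<and>
      Lp_norm M p ?S \<le> (4 * (D + (\<integral>\<omega>. (1 + limit_sd \<omega>) powr p \<partial>M) + 1)) powr (1 / p)" by blast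
qed

lemma equiv_l2_if_limit_var_integrable:
  assumes fin: "AE \<omega> in M. limit_var \<omega> < \<infinity>"
    and int: "integrable M (\<lambda>\<omega>. enn2real (limit_var \<omega>) powr (p / 2))"
  shows "\<exists>r. strict_mono r \<and> equiv_l2_basis M p (\<lambda>k. X (r k))"
proof -
  define B where "B = (\<integral>\<omega>. weight \<omega> * (limit_sd \<omega>)\<^sup>2 \<partial>M) + 1"
  define c0 where "c0 = (\<integral>\<omega>. weight \<omega> * trunc_var 1 \<omega> \<partial>M) / 2"
  have "0 \<le> (\<integral>\<omega>. weight \<omega> * (limit_sd \<omega>)\<^sup>2 \<partial>M)"
    using weight_pos by (intro integral_nonneg_AE AE_I2) (simp add: less_imp_le)
  then have B: "0 \<le> B" by (simp add: B_def)
  have c0: "0 < c0" using weighted_trunc_var_one_pos[OF fin int] by (simp add: c0_def)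
  obtain c where c: "0 < c" and sub: "\<And>V \<psi>. (\<forall>k. bounded_rv weighted (V k)) \<Longrightarrow> (\<forall>k. \<psi> k \<in> borel_measurable weighted) \<Longrightarrow>
      (\<forall>k. \<forall>\<omega>\<in>space weighted. \<bar>\<psi> k \<omega>\<bar> \<le> 2) \<Longrightarrow> weakly_null weighted V \<Longrightarrow> weakly_null weighted \<psi> \<Longrightarrow>
      (\<forall>k. (\<integral>\<omega>. (V k \<omega>)\<^sup>2 \<partial>weighted) \<le> B) \<Longrightarrow> (\<forall>k. c0 \<le> (\<integral>\<omega>. V k \<omega> * \<psi> k \<omega> \<partial>weighted)) \<Longrightarrow>
      (\<exists>r :: nat \<Rightarrow> nat. strict_mono r \<and> (\<forall>n a. (\<Sum>i<n. (a i)\<^sup>2) = 1 \<longrightarrow>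
        c \<le> (\<integral>\<omega>. \<bar>\<Sum>i<n. a i * V (r i) \<omega>\<bar> \<partial>weighted) \<and>
        (\<integral>\<omega>. (\<Sum>i<n. a i * V (r i) \<omega>)\<^sup>2 \<partial>weighted) \<le> B + 4))"
    using finite_measure.l2_subsequence[OF finite_measure_weighted measure_weighted_le_1 B c0] by blast
  \<comment> \<open>The bound c0 / 4 protects the pairing of V_k with psi_k, and c / 2 protects the
    L1 lower bound when V_k is replaced by X_(r k). The latter is possible since c depends on B and
    c0 only.\<close>
  define \<eta> where "\<eta> = min 1 (min (c0 / 4) (c / 2))"
  have \<eta>: "0 < \<eta>" "\<eta> \<le> 1" "\<eta> \<le> c0 / 4" "\<eta> \<le> c / 2" using c c0 by (auto simp: \<eta>_def)
  obtain L r where r: "strict_mono r" and L: "\<And>k. 1 \<le> L k"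
    and tl: "\<And>k n. (\<integral>\<omega>. tail (L k) \<omega> n \<partial>M) \<le> \<eta> * (1/8) ^ Suc k"
    and sq: "\<And>k. (\<integral>\<omega>. weight \<omega> * (clamp_to (L k) (X (r k) \<omega>))\<^sup>2 \<partial>M) \<le> B"
    and low: "\<And>k. c0 \<le> (\<integral>\<omega>. weight \<omega> * (clamp_to (L k) (X (r k) \<omega>) *
        (clamp_to 1 (X (r k) \<omega>) - (\<integral>x. clamp_to 1 x \<partial>\<mu> \<omega>))) \<partial>M)"
    by (rule truncated_subsequence[OF fin int \<eta>(1) c0 _ \<eta>(3), folded B_def]) (simp add: c0_def, rule that)
  define V where "V k \<omega> = clamp_to (L k) (X (r k) \<omega>)" for k \<omega>
  define \<psi> where "\<psi> k \<omega> = clamp_to 1 (X (r k) \<omega>) - (\<integral>x. clamp_to 1 x \<partial>\<mu> \<omega>)" for k \<omega>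
  have L0: "0 \<le> L k" for k using L[of k] by linarith
  have V: "bounded_rv M (V k)" for k
    unfolding V_def[abs_def] by (rule bounded_rv_function(1)[OF borel_measurable_clamp_to clamp_to_bound[OF L0]])
  have \<psi>m: "\<psi> k \<in> borel_measurable M" for k unfolding \<psi>_def by measurable
  have Vm: "V k \<in> borel_measurable M" for k using V by (simp add: bounded_rv_def)
  have \<psi>2: "\<bar>\<psi> k \<omega>\<bar> \<le> 2" if "\<omega> \<in> space M" for k \<omega>
  proof -
    have "\<bar>\<integral>x. clamp_to 1 x \<partial>\<mu> \<omega>\<bar> \<le> 1"
      by (rule kernel_integral_bound[OF that]) (auto intro: clamp_to_bound)
    then show ?thesis using clamp_to_bound[of 1 "X (r k) \<omega>"] unfolding \<psi>_def by linarith
  qed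
  have w\<psi>: "weakly_null M \<psi>"
    using weakly_null_subseq[OF weakly_null_centered[of "clamp_to 1" 1] r] isCont_clamp_to clamp_to_bound[of 1]
    by (simp add: \<psi>_def[abs_def])
  have R: "integrable M (\<lambda>\<omega>. \<bar>X (r k) \<omega> - V k \<omega>\<bar>)" "(\<integral>\<omega>. \<bar>X (r k) \<omega> - V k \<omega>\<bar> \<partial>M) \<le> \<eta> * (1/8) ^ Suc k"
    "integrable M (\<lambda>\<omega>. \<bar>X (r k) \<omega> - V k \<omega>\<bar> powr p)" "(\<integral>\<omega>. \<bar>X (r k) \<omega> - V k \<omega>\<bar> powr p \<partial>M) \<le> \<eta> * (1/8) ^ Suc k" for k
    unfolding V_def using remainder_small[OF L tl] by auto
  \<comment> \<open>The levels L k vary with k, so stable convergence for one fixed test function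
    says nothing here. Instead V inherits weak nullity from X, because the remainders tend to 0 in
    L1.\<close>
  have wV: "weakly_null M V"
    unfolding weakly_null_def
  proof (intro allI impI)
    fix Z assume Z: "bounded_rv M Z"
    obtain C where C: "\<And>\<omega>. \<omega> \<in> space M \<Longrightarrow> \<bar>Z \<omega>\<bar> \<le> C" and [measurable]: "Z \<in> borel_measurable M"
      using Z by (auto simp: bounded_rv_def)
    have C0: "0 \<le> C" using C not_empty by (meson abs_ge_zero ex_in_conv order_trans)
    have Rint: "integrable M (\<lambda>\<omega>. X (r k) \<omega> - V k \<omega>)" for k
      using X_integrable bounded_rv_integrable[OF V] by simp
    have ZX: "integrable M (\<lambda>\<omega>. X (r k) \<omega> * Z \<omega>)" for k
      by (rule integrable_mult_bounded[OF X_integrable]) (use C in auto)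
    have ZR: "integrable M (\<lambda>\<omega>. (X (r k) \<omega> - V k \<omega>) * Z \<omega>)" for k
      by (rule integrable_mult_bounded[OF Rint]) (use C in auto)
    have small: "\<bar>\<integral>\<omega>. (X (r k) \<omega> - V k \<omega>) * Z \<omega> \<partial>M\<bar> \<le> C * (1/8) ^ k" for k
    proof -
      have "\<bar>\<integral>\<omega>. (X (r k) \<omega> - V k \<omega>) * Z \<omega> \<partial>M\<bar> \<le> (\<integral>\<omega>. \<bar>(X (r k) \<omega> - V k \<omega>) * Z \<omega>\<bar> \<partial>M)"
        by (rule integral_abs_bound)
      also have "\<dots> \<le> (\<integral>\<omega>. C * \<bar>X (r k) \<omega> - V k \<omega>\<bar> \<partial>M)"
        using C by (intro integral_mono integrable_abs ZR Rint integrable_mult_right)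
          (auto simp: abs_mult mult.commute[of C] intro!: mult_left_mono)
      also have "\<dots> = C * (\<integral>\<omega>. \<bar>X (r k) \<omega> - V k \<omega>\<bar> \<partial>M)" by simp
      also have "\<dots> \<le> C * (\<eta> * (1/8) ^ Suc k)" using R(2) C0 by (intro mult_left_mono)
      also have "\<dots> \<le> C * (1 * (1/8) ^ k)"
        using \<eta> C0 by (intro mult_left_mono mult_mono) auto
      finally show ?thesis by simp
    qed
    have "(\<lambda>k. C * (1/8) ^ k) \<longlonglongrightarrow> 0"
      using tendsto_mult_left[OF LIMSEQ_power_zero[of "1/8 :: real"], of C] by simp
    then have lim: "(\<lambda>k. \<integral>\<omega>. (X (r k) \<omega> - V k \<omega>) * Z \<omega> \<partial>M) \<longlonglongrightarrow> 0"
      by (rule Lim_null_comparison[rotated]) (use small in auto)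
    have "(\<lambda>k. \<integral>\<omega>. Z \<omega> * X (r k) \<omega> \<partial>M) \<longlonglongrightarrow> 0"
      using LIMSEQ_subseq_LIMSEQ[OF bounded_tendsto_zero[OF Z] r] by (simp add: o_def)
    from tendsto_diff[OF this lim]
    have "(\<lambda>k. (\<integral>\<omega>. Z \<omega> * X (r k) \<omega> \<partial>M) - (\<integral>\<omega>. (X (r k) \<omega> - V k \<omega>) * Z \<omega> \<partial>M)) \<longlonglongrightarrow> 0" by simp
    moreover have "(\<integral>\<omega>. Z \<omega> * X (r k) \<omega> \<partial>M) - (\<integral>\<omega>. (X (r k) \<omega> - V k \<omega>) * Z \<omega> \<partial>M) = (\<integral>\<omega>. Z \<omega> * V k \<omega> \<partial>M)" for k
    proof -
      have "(\<integral>\<omega>. Z \<omega> * V k \<omega> \<partial>M) = (\<integral>\<omega>. X (r k) \<omega> * Z \<omega> - (X (r k) \<omega> - V k \<omega>) * Z \<omega> \<partial>M)"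
        by (intro Bochner_Integration.integral_cong) (auto simp: algebra_simps)
      also have "\<dots> = (\<integral>\<omega>. X (r k) \<omega> * Z \<omega> \<partial>M) - (\<integral>\<omega>. (X (r k) \<omega> - V k \<omega>) * Z \<omega> \<partial>M)"
        by (intro Bochner_Integration.integral_diff ZX ZR)
      finally show ?thesis by (simp add: mult.commute)
    qed
    ultimately show "(\<lambda>k. \<integral>\<omega>. Z \<omega> * V k \<omega> \<partial>M) \<longlonglongrightarrow> 0" by simp
  qed
  note meas [measurable] = Vm \<psi>m
  have "\<exists>r :: nat \<Rightarrow> nat. strict_mono r \<and> (\<forall>n a. (\<Sum>i<n. (a i)\<^sup>2) = 1 \<longrightarrow>
        c \<le> (\<integral>\<omega>. \<bar>\<Sum>i<n. a i * V (r i) \<omega>\<bar> \<partial>weighted) \<and>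
        (\<integral>\<omega>. (\<Sum>i<n. a i * V (r i) \<omega>)\<^sup>2 \<partial>weighted) \<le> B + 4)"
  proof (rule sub[of V \<psi>])
    show "\<forall>k. \<forall>\<omega>\<in>space weighted. \<bar>\<psi> k \<omega>\<bar> \<le> 2" using \<psi>2 by (simp add: space_weighted)
    show "\<forall>k. \<psi> k \<in> borel_measurable weighted" by (simp add: measurable_cong_sets[OF sets_weighted refl] \<psi>m)
    show "weakly_null weighted V" "weakly_null weighted \<psi>" by (intro weakly_null_weighted Vm \<psi>m wV w\<psi>)+
    show "\<forall>k. (\<integral>\<omega>. (V k \<omega>)\<^sup>2 \<partial>weighted) \<le> B" using sq by (simp add: integral_weighted V_def[symmetric])
    show "\<forall>k. c0 \<le> (\<integral>\<omega>. V k \<omega> * \<psi> k \<omega> \<partial>weighted)"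
      using low by (simp add: integral_weighted V_def[symmetric] \<psi>_def[symmetric])
  qed (simp add: bounded_rv_weighted V)
  then obtain t :: "nat \<Rightarrow> nat" where t: "strict_mono t" and est: "\<And>n a. (\<Sum>i<n. (a i)\<^sup>2) = 1 \<Longrightarrow>
        c \<le> (\<integral>\<omega>. \<bar>\<Sum>i<n. a i * V (t i) \<omega>\<bar> \<partial>weighted) \<and>
        (\<integral>\<omega>. (\<Sum>i<n. a i * V (t i) \<omega>)\<^sup>2 \<partial>weighted) \<le> B + 4" by blast
  \<comment> \<open>The second extraction only improves the remainders: t k >= k, so the error
    allowed at index t k is within the one allowed at k.\<close>
  have mono: "\<eta> * (1/8) ^ Suc (t k) \<le> \<eta> * (1/8) ^ Suc k" for k
    using \<eta>(1) seq_suble[OF t, of k] by (intro mult_left_mono power_decreasing) auto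
  have "equiv_l2_basis M p (\<lambda>k. X (r (t k)))"
  proof (rule equiv_l2_basis_of_weighted[of "\<lambda>k. V (t k)" c \<eta> "\<lambda>k. r (t k)" "B + 4"])
    show "(\<integral>\<omega>. \<bar>X (r (t k)) \<omega> - V (t k) \<omega>\<bar> \<partial>M) \<le> \<eta> * (1/8) ^ Suc k" for k
      using R(2)[of "t k"] mono[of k] by (rule order_trans)
    show "(\<integral>\<omega>. \<bar>X (r (t k)) \<omega> - V (t k) \<omega>\<bar> powr p \<partial>M) \<le> \<eta> * (1/8) ^ Suc k" for k
      using R(4)[of "t k"] mono[of k] by (rule order_trans)
    show "c \<le> (\<integral>\<omega>. weight \<omega> * \<bar>\<Sum>i<n. a i * V (t i) \<omega>\<bar> \<partial>M) \<and>
        (\<integral>\<omega>. weight \<omega> * (\<Sum>i<n. a i * V (t i) \<omega>)\<^sup>2 \<partial>M) \<le> B + 4"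
      if "(\<Sum>i<n. (a i)\<^sup>2) = 1" for n a
      using est[OF that] by (simp add: integral_weighted)
  qed (use V c \<eta> R limit_sd_powr_integrable[OF fin int] in auto)
  moreover have "strict_mono (\<lambda>k. r (t k))" using r t by (simp add: strict_mono_def)
  ultimately show ?thesis by blast
qed

end

theorem theorem1:
  fixes M :: "'a measure" and X :: "nat \<Rightarrow> 'a \<Rightarrow> real" and p :: real
    and \<mu> :: "'a \<Rightarrow> real measure"
  assumes "prob_space M"
    and "1 \<le> p" and "p < 2"
    and "\<And>n. X n \<in> borel_measurable M"
    and "determining M X"
    and "\<And>n. in_Lp M p (X n)"
    and "\<And>n. Lp_norm M p (X n) = 1"
    and "uniformly_integrable M (\<lambda>n \<omega>. \<bar>X n \<omega>\<bar> powr p)"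
    and "weakly_to_zero_Lp M p X"
    and "limit_random_measure M X \<mu>"
  shows "(\<exists>r. strict_mono r \<and> equiv_l2_basis M p (\<lambda>k. X (r k))) \<longleftrightarrow>
         ((AE \<omega> in M. (\<integral>\<^sup>+ x. ennreal (x\<^sup>2) \<partial>\<mu> \<omega>) < \<infinity>) \<and>
          integrable M (\<lambda>\<omega>. enn2real (\<integral>\<^sup>+ x. ennreal (x\<^sup>2) \<partial>\<mu> \<omega>) powr (p / 2)))"
proof -
  interpret prob_space M by fact
  interpret lp_random_limit M X \<mu> p
    by unfold_locales (use assms in auto)
  show ?thesis
    unfolding limit_var_def[symmetric]
  proof (intro iffI conjI)
    assume "\<exists>r. strict_mono r \<and> equiv_l2_basis M p (\<lambda>k. X (r k))"
    then obtain r K where r: "strict_mono r" "l2_upper M p K (\<lambda>k. X (r k))" "0 \<le> K"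
      unfolding equiv_l2_basis_def l2_upper_def using less_imp_le by blast
    show "AE \<omega> in M. limit_var \<omega> < \<infinity>" "integrable M (\<lambda>\<omega>. enn2real (limit_var \<omega>) powr (p / 2))"
      using limit_var_integrable_if_l2_upper[OF r(2,1) Lp _ _ r(3)] p1 p2 by auto
  next
    assume "(AE \<omega> in M. limit_var \<omega> < \<infinity>) \<and> integrable M (\<lambda>\<omega>. enn2real (limit_var \<omega>) powr (p / 2))"
    then show "\<exists>r. strict_mono r \<and> equiv_l2_basis M p (\<lambda>k. X (r k))"
      using equiv_l2_if_limit_var_integrable by blast
  qed
qed

end
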